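(* Suppose that $\mathcal{F}$, a class of measurable functions on $(\mathcal{X},\mathcal{A})$, is $P_0$-Glivenko-Cantelli. Then, as $N\to\infty$, $$\lVert \mathbb{P}_N^{\mathrm H}-\tilde P_0\rVert_{\mathcal F}=\sup_{f\in\mathcal F}\left|(\mathbb{P}_N^{\mathrm H}-\tilde P_0)f\right|\to_{P^*}0 .$$
   Context: Setting. $X$ takes values in a measurable space $(\mathcal{X},\mathcal{A})$ and has law $P_0$. $U\in\mathcal U$ is a vector of auxiliary variables, $W=(X,U)\in\mathcal W=\mathcal X\times\mathcal U$ has law $\tilde P_0$, and $V=(\check X,U)\in\mathcal V$, where $\check X$ is a coarsening (measurable function) of $X$. The space $\mathcal V=\bigcup_{j=1}^J\mathcal V^{(j)}$ is a union of $J$ measurable, possibly overlapping data sources $\mathcal V^{(j)}$ (with $\mathcal V^{(j)}\cap\mathcal V^{(j')}\ne\emptyset$ for some $j\ne j'$). Functions of $X$ or of $V$ are viewed as functions of $W$, and $Qf=\int f\,dQ$; for $f$ on $\mathcal X$, $\tilde P_0f=P_0f$. Sampling. $W_1,\dots,W_N$ are i.i.d. copies of $W$ with corresponding $X_i,V_i$; $N^{(j)}=\#\{i\le N:V_i\in\mathcal V^{(j)}\}$. From each source $j$ a simple random sample of size $n^{(j)}\le N^{(j)}$ ($n^{(j)}$ is random, through $N^{(j)}$) is drawn without replacement from the units $i$ with $V_i\in\mathcal V^{(j)}$; $R_i^{(j)}\in\{0,1\}$ indicates that unit $i$ is selected from source $j$ ($R_i^{(j)}=0$ if $V_i\notin\mathcal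 V^{(j)}$). Conditionally on the data, the samplings from different sources are independent. The sampling probability is $\pi^{(j)}(V_i)=(n^{(j)}/N^{(j)})I\{V_i\in\mathcal V^{(j)}\}$, with convention $0/0=0$ in $R_i^{(j)}/\pi^{(j)}(V_i)$. It is assumed that $n^{(j)}/N^{(j)}\to p^{(j)}$ as $N\to\infty$, with $p^{(j)}\ge c>0$ for a constant $c$. Weight function. $\rho=(\rho^{(1)},\dots,\rho^{(J)}):\mathcal V\to[0,1]^J$ is a fixed function that is constant on each of the disjoint regions of $\mathcal V$ determined by which of the sources $\mathcal V^{(1)},\dots,\mathcal V^{(J)}$ contain $v$, with $\rho^{(j)}(v)=0$ if $v\notin\mathcal V^{(j)}$, $\rho^{(j)}(v)=1$ if $v$ belongs to $\mathcal V^{(j)}$ only, and $\sum_{j=1}^J\rho^{(j)}(v)=1$ for all $v$. H-empirical measure. $\mathbb{P}_N^{\mathrm H}f=\frac1N\sum_{i=1}^N\sum_{j=1}^J\frac{R_i^{(j)}\rho^{(j)}(V_i)}{\pi^{(j)}(V_i)}f(X_i)$. $P^*$ is outer probability for the joint law of data and sampling indicators; $\to_{P^*}$ is convergence in outer probability. $\lVert\ell\rVert_{\mathcal F}=\sup_{f\in\mathcal F}|\ell(f)|$ for a functional $\ell$ on $\mathcal F$. "$P_0$-Glivenko-Cantelli" is the usual notion for i.i.d. samples from $P_0$ (uniform law of large numbers over $\mathcal F$ for the ordinary empirical measure).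
   Formalization: The formal theorem additionally assumes that the means P_0 f are bounded over F (sup over F of |P_0 f| is finite); without this the claim fails, e.g. for F the class of all constant functions, since the H-empirical measure of 1 need not equal 1. *)

theory Defs
  imports "HOL-Probability.Probability"
begin

section \<open>Suprema over function classes and outer modes of convergence\<close>

text \<open>Valued in \<^typ>\<open>ennreal\<close>: an unbounded functional has infinite norm, and the norm over the
  empty class is zero.\<close>

definition sup_norm :: "('x \<Rightarrow> real) set \<Rightarrow> (('x \<Rightarrow> real) \<Rightarrow> real) \<Rightarrow> ennreal" where
  "sup_norm F l = (SUP f\<in>F. ennreal \<bar>l f\<bar>)"

text \<open>For a measurable \<open>Z\<close> the first notion is ordinary convergence to zero in probability. In the
  second, the measurable majorants \<open>D\<close> express that the minimal measurable majorants of \<open>Z\<close> tend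
  to zero almost surely.\<close>

definition outer_prob_null :: "'o measure \<Rightarrow> (nat \<Rightarrow> 'o \<Rightarrow> ennreal) \<Rightarrow> bool" where
  "outer_prob_null M Z \<longleftrightarrow>
    (\<forall>e::real. e > 0 \<longrightarrow>
      (\<lambda>N. outer_measure_of M {\<omega> \<in> space M. Z N \<omega> > ennreal e}) \<longlonglongrightarrow> 0)"

definition outer_AE_null :: "'o measure \<Rightarrow> (nat \<Rightarrow> 'o \<Rightarrow> ennreal) \<Rightarrow> bool" where
  "outer_AE_null M Z \<longleftrightarrow>
    (\<exists>D. (\<forall>N. D N \<in> borel_measurable M \<and> (\<forall>\<omega>\<in>space M. Z N \<omega> \<le> D N \<omega>)) \<and>
         (AE \<omega> in M. (\<lambda>N. D N \<omega>) \<longlonglongrightarrow> 0))"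

text \<open>Samples are indexed from \<open>0\<close>: a sample of size \<open>N\<close> consists of the units \<open>i < N\<close>.\<close>

definition empirical :: "nat \<Rightarrow> (nat \<Rightarrow> 'x) \<Rightarrow> ('x \<Rightarrow> real) \<Rightarrow> real" where
  "empirical N x f = (\<Sum>i<N. f (x i)) / real N"

text \<open>As usual for Glivenko-Cantelli classes, the i.i.d. sample is given by the coordinate
  projections of the infinite product space.\<close>

definition glivenko_cantelli :: "'x measure \<Rightarrow> ('x \<Rightarrow> real) set \<Rightarrow> bool" where
  "glivenko_cantelli P F \<longleftrightarrow>
    (\<forall>f\<in>F. integrable P f) \<and>
    outer_AE_null (Pi\<^sub>M (UNIV :: nat set) (\<lambda>_. P))
      (\<lambda>N x. sup_norm F (\<lambda>f. empirical N x f - (\<integral>y. f y \<partial>P)))"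

section \<open>Sampling from overlapping sources\<close>

definition coarse_obs :: "('x \<Rightarrow> 'c) \<Rightarrow> 'x \<times> 'u \<Rightarrow> 'c \<times> 'u" where
  "coarse_obs chi w = (chi (fst w), snd w)"

definition units :: "'v set \<Rightarrow> nat \<Rightarrow> (nat \<Rightarrow> 'v) \<Rightarrow> nat set" where
  "units A N v = {i. i < N \<and> v i \<in> A}"

text \<open>The law of a simple random sample of size \<open>k\<close> drawn without replacement from \<open>I\<close>.\<close>

definition srs :: "nat set \<Rightarrow> nat \<Rightarrow> nat set pmf" where
  "srs I k = pmf_of_set {S. S \<subseteq> I \<and> card S = k}"

text \<open>The function \<open>k\<close> gives the sample size in terms of the number of units in the source \<open>A\<close>.\<close>

definition sampling_prob :: "'v set \<Rightarrow> (nat \<Rightarrow> nat) \<Rightarrow> nat \<Rightarrow> (nat \<Rightarrow> 'v) \<Rightarrow> 'v \<Rightarrow> real" where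
  "sampling_prob A k N v u =
    (let m = card (units A N v) in real (k m) / real m * indicator A u)"

text \<open>Division by zero being zero implements the convention \<open>0/0 = 0\<close>.\<close>

definition H_empirical ::
  "nat \<Rightarrow> (nat \<Rightarrow> 'v set) \<Rightarrow> (nat \<Rightarrow> 'v \<Rightarrow> real) \<Rightarrow> (nat \<Rightarrow> nat \<Rightarrow> nat) \<Rightarrow> (nat \<Rightarrow> nat \<Rightarrow> bool) \<Rightarrow>
   nat \<Rightarrow> (nat \<Rightarrow> 'v) \<Rightarrow> (nat \<Rightarrow> 'x) \<Rightarrow> ('x \<Rightarrow> real) \<Rightarrow> real" where
  "H_empirical J Vs \<rho> k r N v x f =
    (\<Sum>i<N. \<Sum>j=1..J.
       of_bool (r j i) * \<rho> j (v i) / sampling_prob (Vs j) (k j) N v (v i) * f (x i)) / real N"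

definition weight_function ::
  "nat \<Rightarrow> (nat \<Rightarrow> 'v set) \<Rightarrow> (nat \<Rightarrow> 'v \<Rightarrow> real) \<Rightarrow> bool" where
  "weight_function J Vs \<rho> \<longleftrightarrow>
    (\<forall>v \<in> (\<Union>j\<in>{1..J}. Vs j).
      (\<forall>j\<in>{1..J}. 0 \<le> \<rho> j v \<and> \<rho> j v \<le> 1) \<and>
      (\<forall>j\<in>{1..J}. v \<notin> Vs j \<longrightarrow> \<rho> j v = 0) \<and>
      (\<forall>j\<in>{1..J}. v \<in> Vs j \<and> (\<forall>l\<in>{1..J} - {j}. v \<notin> Vs l) \<longrightarrow> \<rho> j v = 1) \<and>
      (\<Sum>j=1..J. \<rho> j v) = 1) \<and>
    (\<forall>v \<in> (\<Union>j\<in>{1..J}. Vs j). \<forall>v' \<in> (\<Union>j\<in>{1..J}. Vs j).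
      (\<forall>l\<in>{1..J}. v \<in> Vs l \<longleftrightarrow> v' \<in> Vs l) \<longrightarrow> (\<forall>j\<in>{1..J}. \<rho> j v = \<rho> j v'))"

text \<open>The sigma-algebra on the space of \<open>M\<close> generated by the first \<open>N\<close> observations.\<close>

definition data_algebra ::
  "'o measure \<Rightarrow> 'w measure \<Rightarrow> (nat \<Rightarrow> 'o \<Rightarrow> 'w) \<Rightarrow> nat \<Rightarrow> 'o measure" where
  "data_algebra M S W N =
    vimage_algebra (space M) (\<lambda>\<omega>. \<lambda>i\<in>{..<N}. W i \<omega>) (Pi\<^sub>M {..<N} (\<lambda>_. S))"

text \<open>Versions of conditional probabilities are only determined up to null sets.\<close>

definition cond_prob_alg :: "'o measure \<Rightarrow> 'o measure \<Rightarrow> ('o \<Rightarrow> bool) \<Rightarrow> 'o \<Rightarrow> real" where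
  "cond_prob_alg M G Q = real_cond_exp M G (indicator {\<omega> \<in> space M. Q \<omega>})"

text \<open>The sampling design for the samples of size \<open>N\<close>. Here \<open>V i\<close> is the source variable of unit
  \<open>i\<close>, \<open>k j m\<close> is the size of the sample drawn from source \<open>j\<close> when \<open>m\<close> units belong to it, and
  \<open>r j i\<close> indicates the selection of unit \<open>i\<close> from source \<open>j\<close>.\<close>

definition multi_source_design ::
  "'o measure \<Rightarrow> 'o measure \<Rightarrow> nat \<Rightarrow> (nat \<Rightarrow> 'v set) \<Rightarrow> nat \<Rightarrow> (nat \<Rightarrow> 'o \<Rightarrow> 'v) \<Rightarrow>
   (nat \<Rightarrow> nat \<Rightarrow> nat) \<Rightarrow> (nat \<Rightarrow> nat \<Rightarrow> 'o \<Rightarrow> bool) \<Rightarrow> bool" where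
  "multi_source_design M G J Vs N V k r \<longleftrightarrow>
    (let selected = (\<lambda>j \<omega>. {i. i < N \<and> r j i \<omega>});
         source_units = (\<lambda>j \<omega>. units (Vs j) N (\<lambda>i. V i \<omega>))
     in
      (\<forall>j\<in>{1..J}. \<forall>i<N. r j i \<in> measurable M (count_space UNIV)) \<and>
      (\<forall>j\<in>{1..J}. \<forall>i<N. \<forall>\<omega>\<in>space M. V i \<omega> \<notin> Vs j \<longrightarrow> \<not> r j i \<omega>) \<and>
      (\<forall>j\<in>{1..J}. \<forall>m. k j m \<le> m) \<and>
      (\<forall>j\<in>{1..J}. \<forall>S. AE \<omega> in M.
         cond_prob_alg M G (\<lambda>\<omega>'. selected j \<omega>' = S) \<omega> =
         pmf (srs (source_units j \<omega>) (k j (card (source_units j \<omega>)))) S) \<and>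
      (\<forall>S :: nat \<Rightarrow> nat set. AE \<omega> in M.
         cond_prob_alg M G (\<lambda>\<omega>'. \<forall>j\<in>{1..J}. selected j \<omega>' = S j) \<omega> =
         (\<Prod>j=1..J. cond_prob_alg M G (\<lambda>\<omega>'. selected j \<omega>' = S j) \<omega>)))"

end

theory Submission
  imports Defs "HOL-Real_Asymp.Real_Asymp"
begin

text \<open>Call the set of sources containing \<open>V\<^sub>i\<close> the stratum of unit \<open>i\<close>. The weights \<open>\<rho>\<close> and the
  conditional laws of the selected sets given the data depend on the strata only. Hence, given the
  strata and the set selected from a source, the observations are still independent, each with the law
  of its stratum, and the H-empirical measure is a linear combination, with bounded coefficients, of
  sums of \<open>f\<close> over sets that are independent of the observations given the strata.

  The centred sum over such a set is dominated as follows. A Glivenko-Cantelli class with bounded means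
  has an integrable envelope, so the empirical process has measurable majorants whose integrals tend to
  zero. Redrawing the units outside the set from the laws of their strata and averaging gives, by
  Jensen's inequality, a majorant for the sum over the set with the same integral. The remaining terms
  involve only counts: the frequencies of the strata obey the law of large numbers, and the
  numbers of selected units in a stratum are hypergeometric, with variance of order \<open>N\<close>.\<close>

section \<open>Glivenko-Cantelli classes\<close>

text \<open>Suprema over \<open>F\<close> need not be measurable, so neither Fubini nor conditioning
  applies to them. Integration is therefore confined to measurable majorants that are fixed in
  advance, are common to all members of \<open>F\<close> and depend on the first N observations
  alone; the redrawing argument is applied to one function at a time.

  Convergence in mean is needed, not just almost surely: redrawing preserves the integral of a
  majorant for each N, but destroys the coupling of the samples along N, so pathwise limits would
  not survive. The envelope is what upgrades one mode to the other.

  Bounded means are a genuine restriction. The centred condition \<open>glivenko_cantelli\<close> is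
  insensitive to adding constants to the functions, and even the class of all constants satisfies
  it. The H-empirical measure has in general a random total mass different from one, and for that
  class the error is then infinite. With bounded means the errors in the counts are only multiplied
  by bounded stratum means.\<close>

lemma sup_norm_upper: "f \<in> F \<Longrightarrow> ennreal \<bar>l f\<bar> \<le> sup_norm F l"
  unfolding sup_norm_def by (rule SUP_upper)

lemma sup_norm_least: "(\<And>f. f \<in> F \<Longrightarrow> ennreal \<bar>l f\<bar> \<le> a) \<Longrightarrow> sup_norm F l \<le> a"
  unfolding sup_norm_def by (rule SUP_least)

section \<open>Transfer of the Glivenko-Cantelli property along a measurable map\<close>

text \<open>Preimages of cylinders under the componentwise map are cylinders, and cylinders
  determine the product measure. The index set is arbitrary because the Glivenko-Cantelli property
  lives on infinite sequences.\<close>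

lemma distr_PiM_componentwise:
  assumes M: "prob_space M" and g[measurable]: "g \<in> measurable M N"
  shows "distr (\<Pi>\<^sub>M i\<in>I. M) (\<Pi>\<^sub>M i\<in>I. distr M N g) (\<lambda>x. \<lambda>i\<in>I. g (x i)) = (\<Pi>\<^sub>M i\<in>I. distr M N g)"
    (is "distr ?K ?I ?t = ?I")
proof (rule measure_eqI_PiM_infinite[symmetric, OF refl])
  have ps: "prob_space (distr M N g)"
    using M by (intro prob_space.prob_space_distr) auto
  have t[measurable]: "?t \<in> measurable ?K ?I"
    by (rule measurable_restrict) simp
  interpret I: prob_space ?I
    by (intro prob_space_PiM ps)
  show "finite_measure ?I"
    by unfold_locales
  fix A J assume J: "finite J" "J \<subseteq> I" and A: "\<And>i. i \<in> J \<Longrightarrow> A i \<in> sets (distr M N g)"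
  have "?I (prod_emb I (\<lambda>i. distr M N g) J (Pi\<^sub>E J A)) = (\<Prod>j\<in>J. distr M N g (A j))"
    using J A by (intro emeasure_PiM_emb ps) auto
  also have "\<dots> = (\<Prod>j\<in>J. M (g -` A j \<inter> space M))"
    using A by (intro prod.cong) (auto simp: emeasure_distr)
  also have "\<dots> = ?K (prod_emb I (\<lambda>i. M) J (\<Pi>\<^sub>E j\<in>J. g -` A j \<inter> space M))"
    using J A by (intro emeasure_PiM_emb[symmetric] M) auto
  also have "prod_emb I (\<lambda>i. M) J (\<Pi>\<^sub>E j\<in>J. g -` A j \<inter> space M)
      = ?t -` prod_emb I (\<lambda>i. distr M N g) J (Pi\<^sub>E J A) \<inter> space ?K"
    using J A measurable_space[OF g]
    by (auto simp: prod_emb_def space_PiM Pi_iff PiE_iff subset_eq extensional_def)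
  also have "?K \<dots> = distr ?K ?I ?t (prod_emb I (\<lambda>i. distr M N g) J (Pi\<^sub>E J A))"
    using J A by (intro emeasure_distr[symmetric] sets_PiM_I t) auto
  finally show "?I (prod_emb I (\<lambda>i. distr M N g) J (Pi\<^sub>E J A))
    = distr ?K ?I ?t (prod_emb I (\<lambda>i. distr M N g) J (Pi\<^sub>E J A))" .
qed simp

lemma sup_norm_image: "sup_norm (h ` F) l = sup_norm F (\<lambda>f. l (h f))"
  unfolding sup_norm_def by (simp add: image_image)

text \<open>The hypothesis concerns the law of X, whereas source membership depends on the whole of
  W = (X, U). Pulling \<open>F\<close> back along \<open>fst\<close> yields a class on the space on
  which the strata are defined; majorants pull back along the componentwise map, which carries
  product law to product law.\<close>

lemma glivenko_cantelli_distr: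
  assumes P: "prob_space P" and g[measurable]: "g \<in> measurable P N"
    and GC: "glivenko_cantelli (distr P N g) F"
  shows "glivenko_cantelli P ((\<lambda>f. f \<circ> g) ` F)"
proof -
  let ?Q = "distr P N g"
  let ?t = "\<lambda>x. \<lambda>i\<in>(UNIV::nat set). g (x i)"
  let ?K = "\<Pi>\<^sub>M i\<in>(UNIV::nat set). P" and ?I = "\<Pi>\<^sub>M i\<in>(UNIV::nat set). ?Q"
  have int: "integrable ?Q f" if "f \<in> F" for f
    using GC that by (auto simp: glivenko_cantelli_def)
  then have meas: "f \<in> borel_measurable N" if "f \<in> F" for f
    using that borel_measurable_integrable[of ?Q f] by simp
  obtain D where D: "\<And>n. D n \<in> borel_measurable ?I"
      "\<And>n x. x \<in> space ?I \<Longrightarrow> sup_norm F (\<lambda>f. empirical n x f - (\<integral>y. f y \<partial>?Q)) \<le> D n x"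
      "AE x in ?I. (\<lambda>n. D n x) \<longlonglongrightarrow> 0"
    using GC unfolding glivenko_cantelli_def outer_AE_null_def by blast
  have t[measurable]: "?t \<in> measurable ?K ?I"
    by (rule measurable_restrict) simp
  have ID: "integral\<^sup>L P (f \<circ> g) = integral\<^sup>L ?Q f" if "f \<in> F" for f
    using integral_distr[OF g meas[OF that]] by (simp add: comp_def)
  show ?thesis
    unfolding glivenko_cantelli_def outer_AE_null_def
  proof (intro conjI exI allI ballI)
    fix h assume "h \<in> (\<lambda>f. f \<circ> g) ` F"
    then obtain f where "f \<in> F" "h = f \<circ> g" by auto
    then show "integrable P h"
      using int integrable_distr[OF g, of f] by (auto simp: comp_def)
  next
    fix n show "(\<lambda>x. D n (?t x)) \<in> borel_measurable ?K"
      using measurable_compose[OF t D(1)] .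
  next
    fix n x assume x: "x \<in> space ?K"
    have "sup_norm ((\<lambda>f. f \<circ> g) ` F) (\<lambda>f. empirical n x f - (\<integral>y. f y \<partial>P))
       = sup_norm F (\<lambda>f. empirical n x (f \<circ> g) - integral\<^sup>L P (f \<circ> g))"
      by (simp add: sup_norm_image)
    also have "\<dots> = sup_norm F (\<lambda>f. empirical n (?t x) f - (\<integral>y. f y \<partial>?Q))"
      unfolding sup_norm_def by (intro SUP_cong refl) (simp only: ID, simp add: empirical_def)
    also have "\<dots> \<le> D n (?t x)"
      using measurable_space[OF t x] by (rule D(2))
    finally show "sup_norm ((\<lambda>f. f \<circ> g) ` F) (\<lambda>f. empirical n x f - (\<integral>y. f y \<partial>P)) \<le> D n (?t x)" .
  next
    have "AE x in distr ?K ?I ?t. (\<lambda>n. D n x) \<longlonglongrightarrow> 0"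
      using D(3) by (simp only: distr_PiM_componentwise[OF P g])
    then show "AE x in ?K. (\<lambda>n. D n (?t x)) \<longlonglongrightarrow> 0"
      by (rule AE_distrD[OF t])
  qed
qed

text \<open>A measurable set of sequences whose coordinate \<open>n\<close> avoids a possibly non-measurable set \<open>A\<close>
  also avoids, almost surely, any measurable hull \<open>H\<close> of \<open>A\<close>. This replaces the measurability of the
  envelope in the Borel-Cantelli argument below.\<close>

lemma inner_null_projection:
  assumes P: "prob_space P"
    and E[measurable]: "E \<in> sets (PiM (UNIV::nat set) (\<lambda>_. P))"
    and H[measurable]: "H \<in> sets P" and cover: "A \<subseteq> H" "outer_measure_of P A = emeasure P H"
    and sub: "\<And>x. x \<in> E \<Longrightarrow> x n \<notin> A"
  shows "AE x in PiM (UNIV::nat set) (\<lambda>_. P). x \<in> E \<longrightarrow> x n \<notin> H"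
proof -
  interpret P: prob_space P by (rule P)
  let ?S = "PiM (UNIV::nat set) (\<lambda>_. P)"
  interpret S: prob_space ?S by (intro prob_space_PiM P)
  let ?t = "\<lambda>(x, y). y(n := x)"
  \<comment> \<open>Cutting out of the hull a measurable set that misses \<open>A\<close> leaves a
    measurable cover of \<open>A\<close>, which cannot have smaller measure.\<close>
  have null: "emeasure P (B \<inter> H) = 0" if B[measurable]: "B \<in> sets P" and "B \<inter> A = {}" for B
  proof -
    have "emeasure P H \<le> emeasure P (H - B)"
      using outer_measure_of_mono[of A "H - B" P] that cover by auto
    also have "\<dots> \<le> emeasure P H"
      by (intro emeasure_mono) auto
    finally have eq: "emeasure P (H - B) = emeasure P H" by simp
    have "emeasure P H = emeasure P (H - B) + emeasure P (B \<inter> H)"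
      by (subst plus_emeasure) (auto intro!: arg_cong[where f="emeasure P"])
    then show ?thesis
      using eq P.emeasure_finite[of H] by (simp add: P.emeasure_eq_measure flip: ennreal_plus)
  qed
  have t[measurable]: "?t \<in> measurable (P \<Otimes>\<^sub>M ?S) ?S"
    unfolding split_beta' by (rule measurable_fun_upd[where J=UNIV]) auto
  \<comment> \<open>Redrawing coordinate \<open>n\<close> independently leaves the product law
    unchanged, so Fubini isolates that coordinate while all others stay fixed.\<close>
  have law: "distr (P \<Otimes>\<^sub>M ?S) ?S ?t = ?S"
    using distr_pair_PiM_eq_PiM[of UNIV "\<lambda>_. P" n] P by simp
  let ?B = "{x \<in> space ?S. x \<in> E \<and> x n \<in> H}"
  have [measurable]: "?B \<in> sets ?S" by measurable
  have "emeasure ?S ?B = emeasure (distr (P \<Otimes>\<^sub>M ?S) ?S ?t) ?B"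
    by (simp add: law)
  also have "\<dots> = emeasure (P \<Otimes>\<^sub>M ?S) (?t -` ?B \<inter> space (P \<Otimes>\<^sub>M ?S))"
    by (rule emeasure_distr) auto
  also have "\<dots> = (\<integral>\<^sup>+y. emeasure P ((\<lambda>x. (x, y)) -` (?t -` ?B \<inter> space (P \<Otimes>\<^sub>M ?S))) \<partial>?S)"
  proof -
    interpret pair_sigma_finite P ?S ..
    show ?thesis by (rule emeasure_pair_measure_alt2) measurable
  qed
  also have "\<dots> = (\<integral>\<^sup>+y. 0 \<partial>?S)"
  proof (rule nn_integral_cong)
    fix y assume y: "y \<in> space ?S"
    let ?C = "{x \<in> space P. y(n := x) \<in> E}"
    have tn: "(\<lambda>x. y(n := x)) \<in> measurable P ?S"
      using measurable_compose[OF measurable_Pair2'[OF y] t] by simp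
    have C: "?C \<in> sets P"
      using measurable_sets[OF tn E] by (simp add: vimage_def Int_def conj_commute)
    have "(\<lambda>x. (x, y)) -` (?t -` ?B \<inter> space (P \<Otimes>\<^sub>M ?S)) = ?C \<inter> H"
      using y sets.sets_into_space[OF E] sets.sets_into_space[OF H]
      by (auto simp: space_pair_measure)
    moreover have "?C \<inter> A = {}"
      using sub by fastforce
    ultimately show "emeasure P ((\<lambda>x. (x, y)) -` (?t -` ?B \<inter> space (P \<Otimes>\<^sub>M ?S))) = 0"
      using null[OF C] by simp
  qed
  finally have "emeasure ?S ?B = 0" by simp
  then have "?B \<in> null_sets ?S" by auto
  then show ?thesis
    by (rule AE_I') auto
qed

section \<open>Integrable envelopes and majorants with vanishing mean\<close>

text \<open>A single centred value at \<open>x n\<close> is a difference of consecutive centred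
  partial sums, so uniformly small averages force \<open>G (x n)\<close> to be at most
  \<open>n + 1\<close> from some index on. By independence this is possible with positive
  probability only if the probabilities of \<open>G > n + 1\<close> are summable, which amounts to
  an integrable majorant of \<open>G\<close>. As \<open>G\<close> need not be measurable, measurable
  hulls of its level sets take their place.\<close>

lemma gc_integrable_envelope:
  fixes P :: "'x measure"
  assumes P: "prob_space P" and GC: "glivenko_cantelli P F"
    and bdd: "sup_norm F (\<lambda>f. \<integral>x. f x \<partial>P) < \<infinity>"
  obtains E where "E \<in> borel_measurable P" "(\<integral>\<^sup>+x. E x \<partial>P) < \<infinity>"
    "\<And>x f. x \<in> space P \<Longrightarrow> f \<in> F \<Longrightarrow> ennreal \<bar>f x\<bar> \<le> E x"
proof -
  interpret P: prob_space P by (rule P)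
  let ?S = "PiM (UNIV::nat set) (\<lambda>_. P)"
  interpret S: product_prob_space "\<lambda>_. P" "UNIV::nat set" ..
  define \<kappa> where "\<kappa> = sup_norm F (\<lambda>f. \<integral>x. f x \<partial>P)"
  define G where "G x = sup_norm F (\<lambda>f. f x - (\<integral>y. f y \<partial>P))" for x
  obtain D where D[measurable]: "\<And>n. D n \<in> borel_measurable ?S"
      and Dle: "\<And>n x. x \<in> space ?S \<Longrightarrow> sup_norm F (\<lambda>f. empirical n x f - (\<integral>y. f y \<partial>P)) \<le> D n x"
      and Dlim: "AE x in ?S. (\<lambda>n. D n x) \<longlonglongrightarrow> 0"
    using GC unfolding glivenko_cantelli_def outer_AE_null_def by blast
  \<comment> \<open>With errors of at most 1/2 at \<open>n\<close> and \<open>n + 1\<close>, the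
    increment is at most \<open>(n + 1)/2 + n/2\<close>, which stays below
    \<open>n + 1\<close>.\<close>
  define B where "B m = {x \<in> space ?S. \<forall>n\<ge>m. D n x \<le> ennreal (1/2)}" for m
  have B[measurable]: "B m \<in> sets ?S" for m
    unfolding B_def by measurable
  have GB: "G (x n) \<le> ennreal (real n + 1)" if x: "x \<in> B m" and n: "m \<le> n" for x m n
    unfolding G_def
  proof (rule sup_norm_least)
    fix f assume f: "f \<in> F"
    let ?c = "\<integral>y. f y \<partial>P"
    have e: "\<bar>empirical k x f - ?c\<bar> \<le> 1/2" if "m \<le> k" for k
    proof -
      have "ennreal \<bar>empirical k x f - ?c\<bar> \<le> D k x"
        using sup_norm_upper[OF f, of "\<lambda>f. empirical k x f - (\<integral>y. f y \<partial>P)"] Dle[of x k] x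
        by (auto simp: B_def intro: order_trans)
      also have "\<dots> \<le> ennreal (1/2)" using x that by (auto simp: B_def)
      finally show ?thesis by (simp only: ennreal_le_iff)
    qed
    have "real k * empirical k x f = (\<Sum>i<k. f (x i))" for k
      by (simp add: empirical_def)
    from this[of n] this[of "Suc n"]
    have "f (x n) - ?c = (real n + 1) * (empirical (Suc n) x f - ?c) - real n * (empirical n x f - ?c)"
      by (simp add: algebra_simps)
    also have "\<bar>\<dots>\<bar> \<le> (real n + 1) * (1/2) + real n * (1/2)"
      using mult_left_mono[OF e[of n], of "real n"] mult_left_mono[OF e[of "Suc n"], of "real n + 1"] n
      by (intro order_trans[OF abs_triangle_ineq4] add_mono) (simp_all only: abs_mult, simp_all)
    also have "\<dots> \<le> real n + 1" by (simp add: field_simps)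
    finally show "ennreal \<bar>f (x n) - ?c\<bar> \<le> ennreal (real n + 1)"
      by (rule ennreal_leI)
  qed
  \<comment> \<open>Almost every sequence lies in some \<open>B m\<close>, so the \<open>B m\<close>
    cannot all be null; positive probability of a single one is all that the argument uses.\<close>
  obtain m where m: "measure ?S (B m) > 0"
  proof (rule ccontr)
    assume "\<not> thesis"
    then have "measure ?S (B m) = 0" for m
      using that by (metis measure_nonneg less_eq_real_def)
    then have "AE x in ?S. x \<notin> B m" for m
      by (intro AE_not_in) (auto simp: S.emeasure_eq_measure)
    then have "AE x in ?S. \<forall>m. x \<notin> B m"
      by (subst AE_all_countable) simp
    moreover have "AE x in ?S. \<exists>m. x \<in> B m"
      using Dlim AE_space
    proof eventually_elim
      case (elim x)
      then have "eventually (\<lambda>n. D n x < ennreal (1/2)) sequentially"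
        by (intro order_tendstoD(2)[OF elim(1)]) (simp only: ennreal_less_zero_iff)
      then show ?case
        using elim unfolding B_def eventually_sequentially by (auto intro: less_imp_le)
    qed
    ultimately have "AE x in ?S. False"
      by eventually_elim auto
    then show False by simp
  qed
  define A where "A n = {x \<in> space P. G x > ennreal (real n + 1)}" for n
  have "\<exists>H. H \<in> sets P \<and> A n \<subseteq> H \<and> outer_measure_of P (A n) = emeasure P H" for n
    using outer_measure_of_attain[of "A n" P] by (auto simp: A_def)
  then obtain H where H[measurable]: "\<And>n. H n \<in> sets P" and AH: "\<And>n. A n \<subseteq> H n"
      and outer: "\<And>n. outer_measure_of P (A n) = emeasure P (H n)"
    by metis
  have AE: "AE x in ?S. x \<in> B m \<longrightarrow> x n \<notin> H n" if "m \<le> n" for n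
    using GB[OF _ that]
    by (intro inner_null_projection[OF P B H AH outer]) (auto simp: A_def not_less[symmetric])
  \<comment> \<open>The second Borel-Cantelli lemma in quantitative form: on \<open>B m\<close> the
    coordinates from \<open>m\<close> on avoid the hulls, so by independence its probability is at
    most a product of factors \<open>1 - p\<close>, each at most \<open>exp (- p)\<close>.
    Positivity of that probability then bounds the sum.\<close>
  have partial: "(\<Sum>n\<in>{m..<k}. measure P (H n)) \<le> - ln (measure ?S (B m))" for k
  proof -
    have "measure ?S (B m) \<le> measure ?S (prod_emb UNIV (\<lambda>_. P) {m..<k} (\<Pi>\<^sub>E n\<in>{m..<k}. space P - H n))"
    proof (rule S.finite_measure_mono_AE)
      have "AE x in ?S. \<forall>n\<in>{m..<k}. x \<in> B m \<longrightarrow> x n \<notin> H n"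
        using AE by (subst AE_ball_countable) auto
      then show "AE x in ?S. x \<in> B m \<longrightarrow>
          x \<in> prod_emb UNIV (\<lambda>_. P) {m..<k} (\<Pi>\<^sub>E n\<in>{m..<k}. space P - H n)"
        using AE_space by eventually_elim (auto simp: prod_emb_def space_PiM)
    qed (auto intro!: sets_PiM_I)
    also have "\<dots> = (\<Prod>n\<in>{m..<k}. measure P (space P - H n))"
      by (intro S.measure_PiM_emb) auto
    also have "\<dots> \<le> (\<Prod>n\<in>{m..<k}. exp (- measure P (H n)))"
    proof (intro prod_mono conjI)
      fix n show "measure P (space P - H n) \<le> exp (- measure P (H n))"
        using exp_ge_add_one_self[of "- measure P (H n)"] by (simp add: P.prob_compl)
    qed simp
    also have "\<dots> = exp (- (\<Sum>n\<in>{m..<k}. measure P (H n)))"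
      by (simp add: exp_sum flip: sum_negf)
    finally have "ln (measure ?S (B m)) \<le> ln (exp (- (\<Sum>n\<in>{m..<k}. measure P (H n))))"
      using m by (subst ln_le_cancel_iff) auto
    then show ?thesis by simp
  qed
  define T where "T x = (\<Sum>n. indicator (H (n + m)) x :: ennreal)" for x
  have T[measurable]: "T \<in> borel_measurable P"
    unfolding T_def by measurable
  have "(\<integral>\<^sup>+x. T x \<partial>P) = (\<Sum>n. emeasure P (H (n + m)))"
    unfolding T_def by (subst nn_integral_suminf) auto
  also have "\<dots> \<le> ennreal (- ln (measure ?S (B m)))"
    unfolding suminf_eq_SUP
  proof (rule SUP_least)
    fix k
    have "(\<Sum>n<k. emeasure P (H (n + m))) = ennreal (\<Sum>n<k. measure P (H (n + m)))"
      by (simp add: P.emeasure_eq_measure sum_nonneg)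
    also have "(\<Sum>n<k. measure P (H (n + m))) = (\<Sum>n\<in>{m..<m+k}. measure P (H n))"
      using sum.shift_bounds_nat_ivl[of "\<lambda>n. measure P (H n)" 0 m k]
      by (simp add: lessThan_atLeast0 add.commute)
    finally show "(\<Sum>n<k. emeasure P (H (n + m))) \<le> ennreal (- ln (measure ?S (B m)))"
      using partial[of "m + k"] by (simp add: ennreal_leI)
  qed
  finally have intT: "(\<integral>\<^sup>+x. T x \<partial>P) < \<infinity>"
    by (simp add: order_le_less_trans)
  \<comment> \<open>\<open>T\<close> counts the hulls containing \<open>x\<close> from index
    \<open>m\<close> on. If \<open>G x\<close> were larger than claimed, then with \<open>k\<close>
    the integer part of \<open>T x\<close> the point would lie in the \<open>k + 1\<close> hulls
    with indices \<open>m\<close> to \<open>m + k\<close>, more than \<open>T\<close>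
    counts.\<close>
  have GT: "G x \<le> ennreal (real m + 1) + T x" if x: "x \<in> space P" for x
  proof (rule ccontr)
    assume "\<not> ?thesis"
    then have less: "ennreal (real m + 1) + T x < G x" by simp
    then have "T x \<noteq> \<infinity>"
      by auto
    then obtain s where s: "T x = ennreal s" "0 \<le> s"
      by (cases "T x") auto
    define k where "k = nat \<lfloor>s\<rfloor>"
    have k: "real k \<le> s" "s < real k + 1"
      using s(2) by (auto simp: k_def)
    have mem: "x \<in> H (n + m)" if "n \<le> k" for n
    proof -
      have "ennreal (real (n + m) + 1) \<le> ennreal (real m + 1) + T x"
        unfolding s using k that s(2) by (subst ennreal_plus[symmetric]) (auto intro!: ennreal_leI)
      from this less have "ennreal (real (n + m) + 1) < G x"
        by (rule le_less_trans)
      then have "x \<in> A (n + m)"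
        unfolding A_def using x by blast
      with AH show ?thesis by auto
    qed
    have "ennreal (real k + 1) = of_nat (Suc k)"
      unfolding ennreal_of_nat_eq_real_of_nat by (simp add: add.commute)
    also have "\<dots> = (\<Sum>n<Suc k. 1)" by simp
    also have "\<dots> = (\<Sum>n<Suc k. indicator (H (n + m)) x)"
      using mem by (intro sum.cong) auto
    also have "\<dots> \<le> T x"
      unfolding T_def by (rule sum_le_suminf) auto
    finally have "real k + 1 \<le> s"
      unfolding s(1) by (simp only: ennreal_le_iff[OF s(2)])
    then show False using k by simp
  qed
  \<comment> \<open>The summand \<open>\<kappa>\<close> undoes the centring; it is finite because
    the means are bounded.\<close>
  define E where "E x = ennreal (real m + 1) + T x + \<kappa>" for x
  show thesis
  proof
    show "E \<in> borel_measurable P" unfolding E_def by measurable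
    have "(\<integral>\<^sup>+x. E x \<partial>P) = ennreal (real m + 1) + (\<integral>\<^sup>+x. T x \<partial>P) + \<kappa>"
      unfolding E_def by (simp add: nn_integral_add P.emeasure_space_1)
    also have "\<dots> < \<infinity>"
      using intT bdd by (simp add: \<kappa>_def less_top)
    finally show "(\<integral>\<^sup>+x. E x \<partial>P) < \<infinity>" .
  next
    fix x f assume x: "x \<in> space P" and f: "f \<in> F"
    let ?c = "\<integral>y. f y \<partial>P"
    have "ennreal \<bar>f x\<bar> \<le> ennreal (\<bar>f x - ?c\<bar> + \<bar>?c\<bar>)"
      by (intro ennreal_leI) linarith
    also have "\<dots> = ennreal \<bar>f x - ?c\<bar> + ennreal \<bar>?c\<bar>"
      by (rule ennreal_plus) auto
    also have "\<dots> \<le> G x + \<kappa>"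
      unfolding G_def \<kappa>_def
      using sup_norm_upper[OF f, of "\<lambda>f. f x - (\<integral>y. f y \<partial>P)"]
        sup_norm_upper[OF f, of "\<lambda>f. \<integral>y. f y \<partial>P"]
      by (intro add_mono)
    also have "\<dots> \<le> E x"
      unfolding E_def using GT[OF x] by (intro add_mono) auto
    finally show "ennreal \<bar>f x\<bar> \<le> E x" .
  qed
qed

text \<open>The usual truncation scheme: the remainder \<open>v K\<close> does not depend on
  \<open>N\<close>, so the level \<open>K\<close> is chosen first and \<open>N\<close> is let go to
  its limit afterwards.\<close>

lemma ennreal_tendsto_zeroI:
  fixes u v :: "'k \<Rightarrow> ennreal"
  assumes split: "\<And>K. eventually (\<lambda>N. g N \<le> u' K N + v K) F"
    and u: "\<And>K. (u' K \<longlongrightarrow> 0) F" and v: "(v \<longlongrightarrow> 0) G" and "G \<noteq> bot"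
  shows "(g \<longlongrightarrow> (0::ennreal)) F"
proof (rule order_tendstoI)
  fix a :: ennreal assume "0 < a"
  then obtain z where z: "0 < z" "z < a"
    using dense by blast
  then obtain e where e: "z = ennreal e" "0 < e"
    by (cases z) (auto simp: top_unique)
  then have half: "0 < ennreal (e/2)" by (simp only: ennreal_less_zero_iff)
  obtain K where K: "v K < ennreal (e/2)"
    using order_tendstoD(2)[OF v half] \<open>G \<noteq> bot\<close> eventually_happens by blast
  show "eventually (\<lambda>N. g N < a) F"
    using split[of K] order_tendstoD(2)[OF u[of K] half]
  proof eventually_elim
    case (elim N)
    note elim(1)
    also have "u' K N + v K \<le> ennreal (e/2) + ennreal (e/2)"
      using elim(2) K by (intro add_mono less_imp_le)
    also have "\<dots> = z" using e by (simp flip: ennreal_plus)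
    finally show ?case using z by simp
  qed
qed simp

lemma ennreal_le_add_diff: "a \<le> k + (a - k)" for a k :: ennreal
  by (cases "k \<le> a") (auto simp: add_diff_inverse_ennreal not_le intro: order_trans[OF less_imp_le])

lemma gc_majorants:
  fixes P :: "'x measure"
  assumes P: "prob_space P" and GC: "glivenko_cantelli P F"
    and bdd: "sup_norm F (\<lambda>f. \<integral>x. f x \<partial>P) < \<infinity>"
  obtains D where "\<And>N. D N \<in> borel_measurable (PiM {..<N} (\<lambda>_. P))"
    "\<And>N x f. x \<in> space (PiM {..<N} (\<lambda>_. P)) \<Longrightarrow> f \<in> F \<Longrightarrow>
       ennreal \<bar>empirical N x f - (\<integral>y. f y \<partial>P)\<bar> \<le> D N x"
    "(\<lambda>N. \<integral>\<^sup>+x. D N x \<partial>PiM {..<N} (\<lambda>_. P)) \<longlonglongrightarrow> 0"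
proof -
  interpret P: prob_space P by (rule P)
  let ?S = "PiM (UNIV::nat set) (\<lambda>_. P)"
  interpret S: sequence_space P ..
  obtain E where E[measurable]: "E \<in> borel_measurable P" and intE: "(\<integral>\<^sup>+x. E x \<partial>P) < \<infinity>"
    and env: "\<And>x f. x \<in> space P \<Longrightarrow> f \<in> F \<Longrightarrow> ennreal \<bar>f x\<bar> \<le> E x"
    using gc_integrable_envelope[OF P GC bdd] by blast
  obtain D0 where D0[measurable]: "\<And>n. D0 n \<in> borel_measurable ?S"
      and D0le: "\<And>n x. x \<in> space ?S \<Longrightarrow> sup_norm F (\<lambda>f. empirical n x f - (\<integral>y. f y \<partial>P)) \<le> D0 n x"
      and D0lim: "AE x in ?S. (\<lambda>n. D0 n x) \<longlonglongrightarrow> 0"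
    using GC unfolding glivenko_cantelli_def outer_AE_null_def by blast
  define c where "c = (\<integral>\<^sup>+x. E x \<partial>P)"
  \<comment> \<open>The first entry of the minimum tends to zero, the second is the trivial bound by
    the envelope and its mean and supplies the uniform integrability.\<close>
  define Dt where "Dt N x = min (D0 N x) (ennreal (1 / real N) * (\<Sum>i<N. E (x i)) + c)" for N x
  have Dt[measurable]: "Dt N \<in> borel_measurable ?S" for N
    unfolding Dt_def by measurable
  have maj: "ennreal \<bar>empirical N x f - (\<integral>y. f y \<partial>P)\<bar> \<le> Dt N x"
    if x: "x \<in> space ?S" and f: "f \<in> F" for N x f
    unfolding Dt_def
  proof (rule min.boundedI)
    show "ennreal \<bar>empirical N x f - (\<integral>y. f y \<partial>P)\<bar> \<le> D0 N x"
      using sup_norm_upper[OF f, of "\<lambda>f. empirical N x f - (\<integral>y. f y \<partial>P)"] D0le[OF x, of N] by simp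
    have "integrable P f" using GC f by (auto simp: glivenko_cantelli_def)
    then have "ennreal \<bar>\<integral>y. f y \<partial>P\<bar> \<le> (\<integral>\<^sup>+y. ennreal \<bar>f y\<bar> \<partial>P)"
      using integral_norm_bound_ennreal[of P f] by simp
    also have "\<dots> \<le> c"
      unfolding c_def by (intro nn_integral_mono env f)
    finally have c: "ennreal \<bar>\<integral>y. f y \<partial>P\<bar> \<le> c" .
    have "\<bar>empirical N x f\<bar> \<le> 1 / real N * (\<Sum>i<N. \<bar>f (x i)\<bar>)"
      using sum_abs[of "\<lambda>i. f (x i)" "{..<N}"] unfolding empirical_def
      by (simp add: divide_right_mono)
    then have "ennreal \<bar>empirical N x f\<bar> \<le> ennreal (1 / real N) * (\<Sum>i<N. ennreal \<bar>f (x i)\<bar>)"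
      by (subst sum_ennreal, simp, subst ennreal_mult[symmetric]) (auto simp: sum_nonneg intro: ennreal_leI)
    also have "\<dots> \<le> ennreal (1 / real N) * (\<Sum>i<N. E (x i))"
      using x f by (intro mult_left_mono sum_mono env) (auto simp: space_PiM PiE_iff)
    finally have "ennreal \<bar>empirical N x f\<bar> + ennreal \<bar>\<integral>y. f y \<partial>P\<bar>
        \<le> ennreal (1 / real N) * (\<Sum>i<N. E (x i)) + c"
      using c by (rule add_mono)
    moreover have "ennreal \<bar>empirical N x f - (\<integral>y. f y \<partial>P)\<bar>
        \<le> ennreal \<bar>empirical N x f\<bar> + ennreal \<bar>\<integral>y. f y \<partial>P\<bar>"
      unfolding ennreal_plus[OF abs_ge_zero abs_ge_zero, symmetric]
      by (intro ennreal_leI abs_triangle_ineq4)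
    ultimately show "ennreal \<bar>empirical N x f - (\<integral>y. f y \<partial>P)\<bar>
        \<le> ennreal (1 / real N) * (\<Sum>i<N. E (x i)) + c" by simp
  qed
  \<comment> \<open>At level \<open>K\<close> the minimum of \<open>D0 N\<close> and
    \<open>K + c\<close> has vanishing integral by dominated convergence with a constant bound. What
    is lost is the average of the truncated differences \<open>E (x i) - K\<close>, whose integral
    is the same for every positive \<open>N\<close> and vanishes as \<open>K\<close> grows.\<close>
  have intDt: "(\<lambda>N. \<integral>\<^sup>+x. Dt N x \<partial>?S) \<longlonglongrightarrow> 0"
  proof (rule ennreal_tendsto_zeroI[where G = sequentially
        and u' = "\<lambda>K N. \<integral>\<^sup>+x. min (D0 N x) (of_nat K + c) \<partial>?S"
        and v = "\<lambda>K. \<integral>\<^sup>+x. E x - of_nat K \<partial>P"])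
    show "(\<lambda>K. \<integral>\<^sup>+x. E x - of_nat K \<partial>P) \<longlonglongrightarrow> 0"
    proof -
      have "(\<lambda>K. \<integral>\<^sup>+x. E x - of_nat K \<partial>P) \<longlonglongrightarrow> (\<integral>\<^sup>+x. 0 \<partial>P)"
      proof (rule nn_integral_dominated_convergence[where w=E])
        have "AE x in P. E x \<noteq> \<infinity>"
          using intE by (intro nn_integral_PInf_AE) auto
        then show "AE x in P. (\<lambda>K. E x - of_nat K) \<longlonglongrightarrow> 0"
        proof eventually_elim
          case (elim x)
          then obtain r where r: "E x = ennreal r" "0 \<le> r" by (cases "E x") auto
          obtain k where "r \<le> real k" using real_arch_simple by blast
          then have "eventually (\<lambda>K. E x - of_nat K = 0) sequentially"
            unfolding eventually_sequentially r
            by (intro exI[of _ k]) (auto simp: ennreal_of_nat_eq_real_of_nat intro!: diff_eq_0_ennreal ennreal_leI)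
          then show ?case by (rule tendsto_eventually)
        qed
      qed (use intE in \<open>auto intro: diff_le_self_ennreal\<close>)
      then show ?thesis by simp
    qed
    show "(\<lambda>N. \<integral>\<^sup>+x. min (D0 N x) (of_nat K + c) \<partial>?S) \<longlonglongrightarrow> 0" for K
    proof -
      have "(\<lambda>N. \<integral>\<^sup>+x. min (D0 N x) (of_nat K + c) \<partial>?S) \<longlonglongrightarrow> (\<integral>\<^sup>+x. 0 \<partial>?S)"
      proof (rule nn_integral_dominated_convergence[where w="\<lambda>_. of_nat K + c"])
        show "(\<integral>\<^sup>+x. of_nat K + c \<partial>?S) < \<infinity>"
          using intE by (simp add: S.emeasure_space_1 c_def less_top ennreal_of_nat_eq_real_of_nat)
        show "AE x in ?S. (\<lambda>N. min (D0 N x) (of_nat K + c)) \<longlonglongrightarrow> 0"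
          using D0lim
        proof eventually_elim
          case (elim x)
          show ?case
            by (rule tendsto_sandwich[OF _ _ tendsto_const elim]) auto
        qed
      qed auto
      then show ?thesis by simp
    qed
    show "eventually (\<lambda>N. (\<integral>\<^sup>+x. Dt N x \<partial>?S)
        \<le> (\<integral>\<^sup>+x. min (D0 N x) (of_nat K + c) \<partial>?S) + (\<integral>\<^sup>+x. E x - of_nat K \<partial>P)) sequentially" for K
      using eventually_gt_at_top[of 0]
    proof eventually_elim
      case (elim N)
      have unit: "ennreal (1 / real N) * of_nat N = 1"
        using elim by (simp add: ennreal_of_nat_eq_real_of_nat flip: ennreal_mult)
      let ?r = "\<lambda>x. ennreal (1 / real N) * (\<Sum>i<N. E (x i) - of_nat K)"
      have le: "Dt N x \<le> min (D0 N x) (of_nat K + c) + ?r x" for x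
      proof -
        have "ennreal (1 / real N) * (\<Sum>i<N. E (x i))
           \<le> ennreal (1 / real N) * (\<Sum>i<N. of_nat K + (E (x i) - of_nat K))"
          by (intro mult_left_mono sum_mono ennreal_le_add_diff) simp
        also have "\<dots> = of_nat K + ?r x"
          using unit by (simp add: sum.distrib distrib_left mult.assoc[symmetric])
        finally have "ennreal (1 / real N) * (\<Sum>i<N. E (x i)) + c \<le> (of_nat K + c) + ?r x"
          by (simp add: ac_simps add_right_mono add_left_mono)
        then show ?thesis
          unfolding Dt_def by (auto simp: min_def intro: order_trans add_increasing2)
      qed
      have "(\<integral>\<^sup>+x. Dt N x \<partial>?S) \<le> (\<integral>\<^sup>+x. min (D0 N x) (of_nat K + c) + ?r x \<partial>?S)"
        by (intro nn_integral_mono le)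
      also have "\<dots> = (\<integral>\<^sup>+x. min (D0 N x) (of_nat K + c) \<partial>?S) + (\<integral>\<^sup>+x. ?r x \<partial>?S)"
        by (intro nn_integral_add) auto
      also have "(\<integral>\<^sup>+x. ?r x \<partial>?S) = ennreal (1 / real N) * (\<Sum>i<N. \<integral>\<^sup>+x. E (x i) - of_nat K \<partial>?S)"
        by (simp add: nn_integral_cmult nn_integral_sum)
      also have "(\<Sum>i<N. \<integral>\<^sup>+x. E (x i) - of_nat K \<partial>?S) = (\<Sum>i<N. \<integral>\<^sup>+x. E x - of_nat K \<partial>P)"
      proof (rule sum.cong[OF refl])
        fix i
        have "(\<integral>\<^sup>+x. E x - of_nat K \<partial>P) = (\<integral>\<^sup>+x. E x - of_nat K \<partial>distr ?S P (\<lambda>x. x i))"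
          by (simp add: S.PiM_component)
        also have "\<dots> = (\<integral>\<^sup>+x. E (x i) - of_nat K \<partial>?S)"
          by (rule nn_integral_distr) auto
        finally show "(\<integral>\<^sup>+x. E (x i) - of_nat K \<partial>?S) = (\<integral>\<^sup>+x. E x - of_nat K \<partial>P)" ..
      qed
      also have "ennreal (1 / real N) * \<dots> = (\<integral>\<^sup>+x. E x - of_nat K \<partial>P)"
        using unit by (simp add: mult.assoc[symmetric])
      finally show ?case .
    qed
  qed simp
  \<comment> \<open>Integrates out the coordinates from \<open>N\<close> on. The empirical process
    of size \<open>N\<close> does not see them, so a majorant remains one, and
    \<open>comb_seq\<close> preserves the product law, so the integral is unchanged.\<close>
  define D where "D N x = (\<integral>\<^sup>+y. Dt N (comb_seq N x y) \<partial>?S)" for N x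
  have comb[measurable]: "(\<lambda>(x, y). comb_seq N x y) \<in> measurable (PiM {..<N} (\<lambda>_. P) \<Otimes>\<^sub>M ?S) ?S" for N
  proof (rule measurable_PiM_single')
    fix i show "(\<lambda>z. (case z of (x, y) \<Rightarrow> comb_seq N x y) i) \<in> measurable (PiM {..<N} (\<lambda>_. P) \<Otimes>\<^sub>M ?S) P"
      by (cases "i < N") (auto simp: comb_seq_def split_beta')
  qed (auto simp: space_pair_measure space_PiM PiE_iff comb_seq_def)
  show thesis
  proof
    show "D N \<in> borel_measurable (PiM {..<N} (\<lambda>_. P))" for N
      unfolding D_def
      by (rule S.P.borel_measurable_nn_integral)
         (use measurable_compose[OF comb Dt] in \<open>simp add: split_beta'\<close>)
  next
    fix N :: nat and x f assume x: "x \<in> space (PiM {..<N} (\<lambda>_. P))" and f: "f \<in> F"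
    have "ennreal \<bar>empirical N x f - (\<integral>y. f y \<partial>P)\<bar> = (\<integral>\<^sup>+y. ennreal \<bar>empirical N x f - (\<integral>y. f y \<partial>P)\<bar> \<partial>?S)"
      by (simp add: S.emeasure_space_1)
    also have "\<dots> \<le> D N x"
      unfolding D_def
    proof (rule nn_integral_mono)
      fix y assume y: "y \<in> space ?S"
      have "comb_seq N x y \<in> space ?S"
        using measurable_space[OF comb, of "(x, y)" N] x y by (simp add: space_pair_measure)
      moreover have "empirical N (comb_seq N x y) f = empirical N x f"
        by (simp add: empirical_def comb_seq_less)
      ultimately show "ennreal \<bar>empirical N x f - (\<integral>y. f y \<partial>P)\<bar> \<le> Dt N (comb_seq N x y)"
        using maj[of "comb_seq N x y" f N] f by simp
    qed
    finally show "ennreal \<bar>empirical N x f - (\<integral>y. f y \<partial>P)\<bar> \<le> D N x" .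
  next
    have "(\<integral>\<^sup>+x. D N x \<partial>PiM {..<N} (\<lambda>_. P)) = (\<integral>\<^sup>+x. Dt N x \<partial>?S)" for N
    proof -
      have D[measurable]: "D N \<in> borel_measurable (PiM {..<N} (\<lambda>_. P))"
        unfolding D_def
        by (rule S.P.borel_measurable_nn_integral)
           (use measurable_compose[OF comb Dt] in \<open>simp add: split_beta'\<close>)
      have "(\<integral>\<^sup>+x. D N x \<partial>PiM {..<N} (\<lambda>_. P))
          = (\<integral>\<^sup>+x. D N x \<partial>distr ?S (PiM {..<N} (\<lambda>_. P)) (\<lambda>x. restrict x {..<N}))"
        by (simp add: S.distr_PiM_restrict_finite)
      also have "\<dots> = (\<integral>\<^sup>+x. D N (restrict x {..<N}) \<partial>?S)"
        by (rule nn_integral_distr) (auto intro: measurable_restrict_subset)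
      also have "\<dots> = (\<integral>\<^sup>+x. \<integral>\<^sup>+y. Dt N (comb_seq N x y) \<partial>?S \<partial>?S)"
      proof -
        have "comb_seq N (restrict x {..<N}) = comb_seq N x" for x :: "nat \<Rightarrow> 'x"
          by (auto simp: comb_seq_def fun_eq_iff)
        then show ?thesis unfolding D_def by simp
      qed
      also have "\<dots> = (\<integral>\<^sup>+z. Dt N ((\<lambda>(x, y). comb_seq N x y) z) \<partial>(?S \<Otimes>\<^sub>M ?S))"
        by (subst S.P.nn_integral_fst[symmetric]) (use measurable_comb_seq in \<open>auto\<close>)
      also have "\<dots> = (\<integral>\<^sup>+z. Dt N z \<partial>distr (?S \<Otimes>\<^sub>M ?S) ?S (\<lambda>(x, y). comb_seq N x y))"
        by (rule nn_integral_distr[symmetric]) (use measurable_comb_seq in auto)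
      also have "\<dots> = (\<integral>\<^sup>+x. Dt N x \<partial>?S)"
        using S.PiM_comb_seq[of N] by simp
      finally show ?thesis .
    qed
    then show "(\<lambda>N. \<integral>\<^sup>+x. D N x \<partial>PiM {..<N} (\<lambda>_. P)) \<longlonglongrightarrow> 0"
      using intDt by simp
  qed
qed

section \<open>Stratified samples\<close>

locale strata = prob_space P for P :: "'w measure" +
  fixes T :: "'w \<Rightarrow> 't" and \<T> :: "'t set"
  assumes finite_strata: "finite \<T>"
    and T_meas[measurable]: "T \<in> measurable P (count_space \<T>)"
begin

definition stratum :: "'t \<Rightarrow> 'w set" where
  "stratum t = {w \<in> space P. T w = t}"

definition q :: "'t \<Rightarrow> real" where
  "q t = measure P (stratum t)"

text \<open>On a null stratum the value is immaterial, but it has to be a probability measure for the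
  products of these laws to make sense.\<close>

definition Q :: "'t \<Rightarrow> 'w measure" where
  "Q t = (if q t = 0 then P else uniform_measure P (stratum t))"

lemma T_in: "w \<in> space P \<Longrightarrow> T w \<in> \<T>"
  using measurable_space[OF T_meas] by simp

lemma stratum_sets[measurable]: "stratum t \<in> sets P"
proof (cases "t \<in> \<T>")
  case True
  have "stratum t = T -` {t} \<inter> space P" by (auto simp: stratum_def)
  then show ?thesis using measurable_sets[OF T_meas, of "{t}"] True by simp
next
  case False
  then have "stratum t = {}" using T_in by (auto simp: stratum_def)
  then show ?thesis by simp
qed

lemma q_nonneg: "0 \<le> q t" by (simp add: q_def)

lemma emeasure_stratum: "emeasure P (stratum t) = ennreal (q t)"
  by (simp add: q_def emeasure_eq_measure)

lemma sets_Q[simp, measurable_cong]: "sets (Q t) = sets P"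
  by (simp add: Q_def)

lemma space_Q[simp]: "space (Q t) = space P"
  using sets_eq_imp_space_eq[OF sets_Q] .

lemma prob_space_Q: "prob_space (Q t)"
  using prob_space_axioms by (auto simp: Q_def emeasure_stratum q_nonneg intro!: prob_space_uniform_measure)

sublocale Q: prob_space "Q t" for t
  by (rule prob_space_Q)

lemma product_prob_space_Q: "product_prob_space (\<lambda>i. Q (\<tau> i))"
  by standard

lemma sets_PiM_Q: "sets (PiM I (\<lambda>i. Q (\<tau> i))) = sets (PiM I (\<lambda>_. P))"
  by (intro sets_PiM_cong) auto

section \<open>Conditioning an independent sample on its strata\<close>

text \<open>Prescribing the stratum of every observation is conditioning on a rectangle, and on
  rectangles both the probability and the intersection with another rectangle factorise. Hence
  independence survives the conditioning.\<close>

lemma PiM_Q_eq_uniform: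
  assumes I: "finite I" and pos: "\<And>i. i \<in> I \<Longrightarrow> q (\<tau> i) \<noteq> 0"
  shows "uniform_measure (PiM I (\<lambda>_. P)) (\<Pi>\<^sub>E i\<in>I. stratum (\<tau> i)) = PiM I (\<lambda>i. Q (\<tau> i))"
proof -
  interpret Q': product_prob_space "\<lambda>i. Q (\<tau> i)" by (rule product_prob_space_Q)
  interpret P': finite_product_prob_space "\<lambda>_. P" I by standard (rule I)
  have "prob_space (PiM I (\<lambda>_. P))"
    by (intro prob_space_PiM prob_space_axioms)
  note emeasure_Pi = finite_measure.emeasure_eq_measure[OF prob_space.finite_measure[OF this]]
  let ?C = "\<Pi>\<^sub>E i\<in>I. stratum (\<tau> i)"
  have C: "measure (PiM I (\<lambda>_. P)) ?C = (\<Prod>i\<in>I. q (\<tau> i))"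
    unfolding q_def by (intro P'.finite_measure_PiM_emb) auto
  show ?thesis
  proof (rule Q'.PiM_eqI[OF I])
    show "sets (uniform_measure (PiM I (\<lambda>_. P)) ?C) = sets (PiM I (\<lambda>i. Q (\<tau> i)))"
      by (simp add: sets_PiM_Q)
    fix A assume "\<And>i. i \<in> I \<Longrightarrow> A i \<in> sets (Q (\<tau> i))"
    then have A: "\<And>i. i \<in> I \<Longrightarrow> A i \<in> sets P" by simp
    have sets: "PiE I A \<in> sets (PiM I (\<lambda>_. P))" "?C \<in> sets (PiM I (\<lambda>_. P))"
      using I A by (auto intro!: sets_PiM_I_finite)
    have pC: "(\<Prod>i\<in>I. q (\<tau> i)) > 0"
      using pos q_nonneg by (intro prod_pos) (metis less_eq_real_def)
    have "emeasure (uniform_measure (PiM I (\<lambda>_. P)) ?C) (PiE I A)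
        = ennreal (measure (PiM I (\<lambda>_. P)) (?C \<inter> PiE I A)) / ennreal (\<Prod>i\<in>I. q (\<tau> i))"
      using sets by (subst emeasure_uniform_measure) (auto simp: emeasure_Pi C)
    also have "?C \<inter> PiE I A = (\<Pi>\<^sub>E i\<in>I. stratum (\<tau> i) \<inter> A i)"
      by (rule PiE_Int)
    also have "measure (PiM I (\<lambda>_. P)) \<dots> = (\<Prod>i\<in>I. measure P (stratum (\<tau> i) \<inter> A i))"
      using A by (intro P'.finite_measure_PiM_emb) auto
    also have "ennreal \<dots> / ennreal (\<Prod>i\<in>I. q (\<tau> i))
        = ennreal (\<Prod>i\<in>I. measure P (stratum (\<tau> i) \<inter> A i) / q (\<tau> i))"
      using pC by (subst divide_ennreal) (auto simp: prod_nonneg prod_dividef)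
    also have "\<dots> = (\<Prod>i\<in>I. ennreal (measure P (stratum (\<tau> i) \<inter> A i) / q (\<tau> i)))"
      by (subst prod_ennreal) (auto simp: q_nonneg)
    also have "\<dots> = (\<Prod>i\<in>I. emeasure (Q (\<tau> i)) (A i))"
    proof (rule prod.cong[OF refl])
      fix i assume i: "i \<in> I"
      have "q (\<tau> i) > 0" using pos[OF i] q_nonneg[of "\<tau> i"] by linarith
      then show "ennreal (measure P (stratum (\<tau> i) \<inter> A i) / q (\<tau> i)) = emeasure (Q (\<tau> i)) (A i)"
        using A[OF i] pos[OF i] emeasure_eq_measure[of "stratum (\<tau> i) \<inter> A i"]
        by (simp add: Q_def emeasure_stratum divide_ennreal)
    qed
    finally show "emeasure (uniform_measure (PiM I (\<lambda>_. P)) ?C) (PiE I A)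
        = (\<Prod>i\<in>I. emeasure (Q (\<tau> i)) (A i))" .
  qed
qed

text \<open>Keeping the probability of the rectangle as a factor, instead of dividing by it,
  includes vectors with a null stratum: there both sides vanish whatever \<open>Q\<close>
  is.\<close>

lemma nn_integral_strata:
  assumes I: "finite I" and h[measurable]: "h \<in> borel_measurable (PiM I (\<lambda>_. P))"
  shows "(\<integral>\<^sup>+w. h w * indicator (\<Pi>\<^sub>E i\<in>I. stratum (\<tau> i)) w \<partial>PiM I (\<lambda>_. P))
    = ennreal (\<Prod>i\<in>I. q (\<tau> i)) * (\<integral>\<^sup>+w. h w \<partial>PiM I (\<lambda>i. Q (\<tau> i)))"
proof -
  interpret P': finite_product_prob_space "\<lambda>_. P" I by standard (rule I)
  have "prob_space (PiM I (\<lambda>_. P))"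
    by (intro prob_space_PiM prob_space_axioms)
  note emeasure_Pi = finite_measure.emeasure_eq_measure[OF prob_space.finite_measure[OF this]]
  let ?C = "\<Pi>\<^sub>E i\<in>I. stratum (\<tau> i)"
  have C: "emeasure (PiM I (\<lambda>_. P)) ?C = ennreal (\<Prod>i\<in>I. q (\<tau> i))"
    unfolding q_def emeasure_Pi
    by (subst P'.finite_measure_PiM_emb) auto
  have [measurable]: "?C \<in> sets (PiM I (\<lambda>_. P))"
    using I by (auto intro!: sets_PiM_I_finite)
  show ?thesis
  proof (cases "\<forall>i\<in>I. q (\<tau> i) \<noteq> 0")
    case True
    then have "(\<Prod>i\<in>I. q (\<tau> i)) > 0"
      using q_nonneg by (intro prod_pos) (metis less_eq_real_def)
    then have "inverse (ennreal (\<Prod>i\<in>I. q (\<tau> i))) * ennreal (\<Prod>i\<in>I. q (\<tau> i)) = 1"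
      by (simp add: inverse_ennreal flip: ennreal_mult)
    moreover have "(\<integral>\<^sup>+w. h w \<partial>PiM I (\<lambda>i. Q (\<tau> i)))
        = (\<integral>\<^sup>+w. h w * indicator ?C w \<partial>PiM I (\<lambda>_. P)) / ennreal (\<Prod>i\<in>I. q (\<tau> i))"
      using True by (subst PiM_Q_eq_uniform[OF I, symmetric]) (auto simp: nn_integral_uniform_measure C)
    ultimately show ?thesis
      by (simp add: mult.commute[of "ennreal _"] divide_ennreal_def mult.assoc)
  next
    case False
    then have "emeasure (PiM I (\<lambda>_. P)) ?C = 0"
      unfolding C using prod_zero[OF I, of "\<lambda>i. q (\<tau> i)"] by auto
    then have "AE w in PiM I (\<lambda>_. P). w \<notin> ?C"
      by (intro AE_not_in) auto
    then have "(\<integral>\<^sup>+w. h w * indicator ?C w \<partial>PiM I (\<lambda>_. P)) = (\<integral>\<^sup>+w. 0 \<partial>PiM I (\<lambda>_. P))"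
      by (intro nn_integral_cong_AE, elim eventually_mono) simp
    then show ?thesis using prod_zero[OF I, of "\<lambda>i. q (\<tau> i)"] False by auto
  qed
qed

text \<open>Redraws the observations outside \<open>B\<close> from the laws of their strata. Averaging a majorant of
  the full empirical process over these redraws yields, by Jensen's inequality, a measurable majorant
  of the process restricted to \<open>B\<close>, and the redraws do not change the law of the sample given its
  strata.\<close>

definition resampled :: "nat \<Rightarrow> ((nat \<Rightarrow> 'w) \<Rightarrow> ennreal) \<Rightarrow> (nat \<Rightarrow> 't) \<Rightarrow> nat set \<Rightarrow> (nat \<Rightarrow> 'w) \<Rightarrow> ennreal" where
  "resampled N D \<tau> B w =
    (\<integral>\<^sup>+y. D (merge B ({..<N} - B) (w, y)) \<partial>PiM ({..<N} - B) (\<lambda>i. Q (\<tau> i)))"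

lemma measurable_merge_P:
  assumes "B \<subseteq> {..<N}"
  shows "merge B ({..<N} - B) \<in> measurable (PiM {..<N} (\<lambda>_. P) \<Otimes>\<^sub>M PiM ({..<N} - B) (\<lambda>i. Q (\<tau> i))) (PiM {..<N} (\<lambda>_. P))"
proof (rule measurable_PiM_single')
  note [measurable_cong] = sets_PiM_Q
  fix i assume "i \<in> {..<N}"
  then show "(\<lambda>z. merge B ({..<N} - B) z i) \<in> measurable (PiM {..<N} (\<lambda>_. P) \<Otimes>\<^sub>M PiM ({..<N} - B) (\<lambda>i. Q (\<tau> i))) P"
    using assms by (cases "i \<in> B") (simp_all add: merge_def split_beta')
qed (use assms in \<open>auto simp: space_pair_measure space_PiM PiE_iff merge_def extensional_def split: if_splits\<close>)

lemma resampled_measurable[measurable]: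
  assumes B: "B \<subseteq> {..<N}" and D: "D \<in> borel_measurable (PiM {..<N} (\<lambda>_. P))"
  shows "resampled N D \<tau> B \<in> borel_measurable (PiM {..<N} (\<lambda>_. P))"
proof -
  interpret C: prob_space "PiM ({..<N} - B) (\<lambda>i. Q (\<tau> i))"
    by (intro prob_space_PiM prob_space_Q)
  show ?thesis
    unfolding resampled_def
    using measurable_compose[OF measurable_merge_P[OF B] D]
    by (intro C.borel_measurable_nn_integral) (simp add: split_beta')
qed

text \<open>\<open>resampled\<close> is the inner integral in Fubini's theorem for \<open>D\<close>
  under the product of the stratum laws and ignores the coordinates outside \<open>B\<close>. The
  value is thus the same for every \<open>B\<close>, which later allows \<open>B\<close> to be
  random.\<close>

lemma nn_integral_resampled:
  assumes B: "B \<subseteq> {..<N}" and D: "D \<in> borel_measurable (PiM {..<N} (\<lambda>_. P))"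
  shows "(\<integral>\<^sup>+w. resampled N D \<tau> B w * indicator (\<Pi>\<^sub>E i\<in>{..<N}. stratum (\<tau> i)) w \<partial>PiM {..<N} (\<lambda>_. P))
    = (\<integral>\<^sup>+w. D w * indicator (\<Pi>\<^sub>E i\<in>{..<N}. stratum (\<tau> i)) w \<partial>PiM {..<N} (\<lambda>_. P))"
proof -
  interpret Q': product_prob_space "\<lambda>i. Q (\<tau> i)" by (rule product_prob_space_Q)
  let ?C = "{..<N} - B"
  have BC: "B \<inter> ?C = {}" "finite B" "finite ?C" "B \<union> ?C = {..<N}"
    using B finite_subset by auto
  have cong: "h \<in> borel_measurable (PiM (B \<union> ?C) (\<lambda>i. Q (\<tau> i)))"
    if "h \<in> borel_measurable (PiM {..<N} (\<lambda>_. P))" for h :: "_ \<Rightarrow> ennreal"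
    using that unfolding BC(4) by (subst measurable_cong_sets[OF sets_PiM_Q refl])
  interpret C: prob_space "PiM ?C (\<lambda>i. Q (\<tau> i))"
    by (intro prob_space_PiM prob_space_Q)
  have "(\<integral>\<^sup>+w. resampled N D \<tau> B w \<partial>PiM {..<N} (\<lambda>i. Q (\<tau> i)))
      = (\<integral>\<^sup>+x. (\<integral>\<^sup>+y. resampled N D \<tau> B (merge B ?C (x, y)) \<partial>PiM ?C (\<lambda>i. Q (\<tau> i))) \<partial>PiM B (\<lambda>i. Q (\<tau> i)))"
    using Q'.product_nn_integral_fold[OF BC(1-3) cong[OF resampled_measurable[OF B D]]]
    unfolding BC(4) .
  also have "\<dots> = (\<integral>\<^sup>+x. resampled N D \<tau> B x \<partial>PiM B (\<lambda>i. Q (\<tau> i)))"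
  proof -
    have "merge B ?C (merge B ?C (x, y), z) = merge B ?C (x, z)" for x y z :: "nat \<Rightarrow> 'w"
      by (auto simp: merge_def fun_eq_iff)
    then show ?thesis by (simp add: resampled_def C.emeasure_space_1)
  qed
  also have "\<dots> = (\<integral>\<^sup>+w. D w \<partial>PiM {..<N} (\<lambda>i. Q (\<tau> i)))"
    using Q'.product_nn_integral_fold[OF BC(1-3) cong[OF D]]
    unfolding BC(4) resampled_def by simp
  finally show ?thesis
    using B D by (simp add: nn_integral_strata resampled_measurable)
qed

section \<open>Stratum means and the cost of centring at them\<close>

text \<open>The factor \<open>q t\<close> keeps the identity valid on a null stratum, where
  \<open>Q t\<close> is \<open>P\<close> and both sides are zero.\<close>

lemma
  fixes f :: "'w \<Rightarrow> real"
  assumes f: "integrable P f"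
  shows integrable_Q: "integrable (Q t) f"
    and q_times_integral_Q: "q t * (\<integral>w. f w \<partial>Q t) = (\<integral>w. indicator (stratum t) w * f w \<partial>P)"
proof -
  have [measurable]: "f \<in> borel_measurable P" using f by auto
  have int: "integrable P (\<lambda>w. indicator (stratum t) w * f w)"
    using integrable_mult_indicator[OF stratum_sets f] by simp
  have "integrable (Q t) f \<and> q t * (\<integral>w. f w \<partial>Q t) = (\<integral>w. indicator (stratum t) w * f w \<partial>P)"
  proof (cases "q t = 0")
    case True
    then have "emeasure P (stratum t) = 0" by (simp add: emeasure_stratum)
    then have "AE w in P. w \<notin> stratum t" by (intro AE_not_in) auto
    then have "(\<integral>w. indicator (stratum t) w * f w \<partial>P) = (\<integral>w. 0 \<partial>P)"
      by (intro integral_cong_AE) (auto elim: eventually_mono)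
    then show ?thesis using True f by (simp add: Q_def)
  next
    case False
    then have pos: "q t > 0" using q_nonneg[of t] by simp
    have eq: "Q t = density P (\<lambda>w. ennreal (indicator (stratum t) w / q t))"
      unfolding Q_def uniform_measure_def using False pos
      by (auto simp: emeasure_stratum divide_ennreal simp flip: ennreal_indicator
           intro!: density_cong)
    have int': "integrable P (\<lambda>w. (indicator (stratum t) w / q t) *\<^sub>R f w)"
      using integrable_divide[OF int, of "q t"] by simp
    have "integrable (Q t) f"
      unfolding eq using int' q_nonneg by (subst integrable_density) auto
    moreover have "(\<integral>w. f w \<partial>Q t) = (\<integral>w. (indicator (stratum t) w / q t) *\<^sub>R f w \<partial>P)"
      unfolding eq using q_nonneg by (subst integral_density) auto
    ultimately show ?thesis
      using pos by simp
  qed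
  then show "integrable (Q t) f" "q t * (\<integral>w. f w \<partial>Q t) = (\<integral>w. indicator (stratum t) w * f w \<partial>P)"
    by auto
qed

lemma sum_strata_integral:
  fixes f :: "'w \<Rightarrow> real"
  assumes f: "integrable P f"
  shows "(\<Sum>t\<in>\<T>. q t * (\<integral>w. f w \<partial>Q t)) = (\<integral>w. f w \<partial>P)"
proof -
  have "(\<Sum>t\<in>\<T>. q t * (\<integral>w. f w \<partial>Q t)) = (\<Sum>t\<in>\<T>. \<integral>w. indicator (stratum t) w * f w \<partial>P)"
    using f by (simp add: q_times_integral_Q)
  also have "\<dots> = (\<integral>w. (\<Sum>t\<in>\<T>. indicator (stratum t) w * f w) \<partial>P)"
    using integrable_mult_indicator[OF stratum_sets f] by (subst Bochner_Integration.integral_sum) auto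
  also have "\<dots> = (\<integral>w. f w \<partial>P)"
  proof (rule Bochner_Integration.integral_cong[OF refl])
    fix w assume w: "w \<in> space P"
    have "(\<Sum>t\<in>\<T>. indicator (stratum t) w * f w) = (\<Sum>t\<in>\<T>. if t = T w then f w else 0)"
      using w by (intro sum.cong) (auto simp: stratum_def)
    also have "\<dots> = f w"
      using T_in[OF w] finite_strata by simp
    finally show "(\<Sum>t\<in>\<T>. indicator (stratum t) w * f w) = f w" .
  qed
  finally show ?thesis .
qed

text \<open>Passing to a stratum of positive probability inflates the norm in L1 by at most
  \<open>1 / q t\<close>; on a null stratum the law is \<open>P\<close> itself. There are finitely
  many strata, so the sum of these bounds serves for all of them.\<close>

lemma integral_Q_bounded:
  fixes F :: "('w \<Rightarrow> real) set"
  assumes K: "\<And>f. f \<in> F \<Longrightarrow> integrable P f" "\<And>f. f \<in> F \<Longrightarrow> (\<integral>w. \<bar>f w\<bar> \<partial>P) \<le> K"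
  obtains K' where "0 \<le> K'" "\<And>f t. f \<in> F \<Longrightarrow> t \<in> \<T> \<Longrightarrow> \<bar>\<integral>w. f w \<partial>Q t\<bar> \<le> K'"
proof
  let ?k = "\<lambda>t. if q t = 0 then \<bar>K\<bar> else \<bar>K\<bar> / q t"
  show "0 \<le> (\<Sum>t\<in>\<T>. ?k t)" by (intro sum_nonneg) (auto simp: q_nonneg)
  fix f t assume f: "f \<in> F" and t: "t \<in> \<T>"
  have "\<bar>\<integral>w. f w \<partial>Q t\<bar> \<le> ?k t"
  proof (cases "q t = 0")
    case True
    have "\<bar>\<integral>w. f w \<partial>P\<bar> \<le> \<bar>K\<bar>"
      using integral_abs_bound[of P f] K(2)[OF f] by linarith
    then show ?thesis using True by (simp add: Q_def)
  next
    case False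
    then have pos: "q t > 0" using q_nonneg[of t] by simp
    have "q t * \<bar>\<integral>w. f w \<partial>Q t\<bar> = \<bar>\<integral>w. indicator (stratum t) w * f w \<partial>P\<bar>"
      using q_times_integral_Q[OF K(1)[OF f], of t] pos by (metis abs_mult abs_of_pos)
    also have "\<dots> \<le> (\<integral>w. \<bar>indicator (stratum t) w * f w\<bar> \<partial>P)" by simp
    also have "\<dots> \<le> (\<integral>w. \<bar>f w\<bar> \<partial>P)"
      using K(1)[OF f] integrable_mult_indicator[OF stratum_sets K(1)[OF f], of t]
      by (intro integral_mono) (auto simp: indicator_def)
    finally have "q t * \<bar>\<integral>w. f w \<partial>Q t\<bar> \<le> \<bar>K\<bar>" using K(2)[OF f] by linarith
    then show ?thesis using pos by (simp add: field_simps)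
  qed
  also have "\<dots> \<le> (\<Sum>t\<in>\<T>. ?k t)"
    using t finite_strata q_nonneg by (intro member_le_sum) auto
  finally show "\<bar>\<integral>w. f w \<partial>Q t\<bar> \<le> (\<Sum>t\<in>\<T>. ?k t)" .
qed

text \<open>A redrawn value of \<open>f\<close> has its stratum mean as expectation, so the
  left-hand side is the absolute value of the average over all redraws of the full centred process.
  The majorant does not depend on \<open>f\<close>, so a bound for each \<open>f\<close> suffices
  and no supremum has to be integrated.\<close>

lemma empirical_resampled_bound:
  fixes f :: "'w \<Rightarrow> real"
  assumes f: "integrable P f" and B: "B \<subseteq> {..<N}" and w: "w \<in> space (PiM {..<N} (\<lambda>_. P))"
    and maj: "\<And>x. x \<in> space (PiM {..<N} (\<lambda>_. P)) \<Longrightarrow>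
      ennreal \<bar>empirical N x f - (\<integral>y. f y \<partial>P)\<bar> \<le> D x"
  shows "ennreal \<bar>((\<Sum>i\<in>B. f (w i)) + (\<Sum>i\<in>{..<N} - B. \<integral>y. f y \<partial>Q (\<tau> i))) / real N - (\<integral>y. f y \<partial>P)\<bar>
    \<le> resampled N D \<tau> B w"
proof -
  let ?C = "{..<N} - B"
  let ?R = "PiM ?C (\<lambda>i. Q (\<tau> i))"
  interpret Q': product_prob_space "\<lambda>i. Q (\<tau> i)" ?C
    by (intro product_prob_space_Q)
  let ?h = "\<lambda>y. ((\<Sum>i\<in>B. f (w i)) + (\<Sum>i\<in>?C. f (y i))) / real N - (\<integral>y. f y \<partial>P)"
  have f_meas[measurable]: "f \<in> borel_measurable P" using f by auto
  have comp: "integrable ?R (\<lambda>y. f (y i))" "(\<integral>y. f (y i) \<partial>?R) = (\<integral>y. f y \<partial>Q (\<tau> i))" if i: "i \<in> ?C" for i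
  proof -
    have d: "distr ?R (Q (\<tau> i)) (\<lambda>y. y i) = Q (\<tau> i)"
      using i by (rule Q'.PiM_component)
    show "integrable ?R (\<lambda>y. f (y i))"
      using integrable_Q[OF f, of "\<tau> i"] i
      by (subst integrable_distr_eq[symmetric, where N="Q (\<tau> i)"]) (auto simp: d)
    show "(\<integral>y. f (y i) \<partial>?R) = (\<integral>y. f y \<partial>Q (\<tau> i))"
      using i by (subst integral_distr[symmetric, where N="Q (\<tau> i)"]) (auto simp: d)
  qed
  have int: "integrable ?R ?h"
    by (intro Bochner_Integration.integrable_diff integrable_divide Bochner_Integration.integrable_add
        Bochner_Integration.integrable_sum comp(1) Q'.P.integrable_const)
  have "(\<integral>y. ?h y \<partial>?R) = ((\<Sum>i\<in>B. f (w i)) + (\<Sum>i\<in>?C. \<integral>y. f y \<partial>Q (\<tau> i))) / real N - (\<integral>y. f y \<partial>P)"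
  proof -
    have "integrable ?R (\<lambda>y. \<Sum>i\<in>?C. f (y i))"
      by (intro Bochner_Integration.integrable_sum comp(1))
    moreover have "(\<integral>y. (\<Sum>i\<in>?C. f (y i)) \<partial>?R) = (\<Sum>i\<in>?C. \<integral>y. f y \<partial>Q (\<tau> i))"
      using comp by (subst Bochner_Integration.integral_sum) auto
    ultimately show ?thesis by (simp add: Q'.P.prob_space)
  qed
  then have "ennreal \<bar>((\<Sum>i\<in>B. f (w i)) + (\<Sum>i\<in>?C. \<integral>y. f y \<partial>Q (\<tau> i))) / real N - (\<integral>y. f y \<partial>P)\<bar>
      = ennreal (norm (\<integral>y. ?h y \<partial>?R))" by simp
  also have "\<dots> \<le> (\<integral>\<^sup>+y. ennreal (norm (?h y)) \<partial>?R)"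
    by (rule integral_norm_bound_ennreal[OF int])
  also have "\<dots> \<le> resampled N D \<tau> B w"
    unfolding resampled_def
  proof (rule nn_integral_mono)
    fix y assume y: "y \<in> space ?R"
    let ?z = "merge B ?C (w, y)"
    have z: "?z \<in> space (PiM {..<N} (\<lambda>_. P))"
      using measurable_space[OF measurable_merge_P[OF B], of "(w, y)" \<tau>] w y
      by (simp add: space_pair_measure)
    have "(\<Sum>i<N. f (?z i)) = (\<Sum>i\<in>B. f (?z i)) + (\<Sum>i\<in>?C. f (?z i))"
      unfolding sum.subset_diff[OF B finite_lessThan] by (rule add.commute)
    also have "\<dots> = (\<Sum>i\<in>B. f (w i)) + (\<Sum>i\<in>?C. f (y i))"
      by (intro arg_cong2[where f="(+)"] sum.cong) (auto simp: merge_def)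
    finally have "empirical N ?z f = ((\<Sum>i\<in>B. f (w i)) + (\<Sum>i\<in>?C. f (y i))) / real N"
      by (simp add: empirical_def)
    with maj[OF z] show "ennreal (norm (?h y)) \<le> D ?z" by simp
  qed
  finally show ?thesis .
qed

text \<open>The price of centring every observation at its stratum mean instead of at the overall
  mean, up to a bound on the stratum means.\<close>

definition deviation :: "nat \<Rightarrow> (nat \<Rightarrow> 'w) \<Rightarrow> real" where
  "deviation N w = (\<Sum>t\<in>\<T>. \<bar>real (card {i\<in>{..<N}. T (w i) = t}) / real N - q t\<bar>)"

lemma sum_over_strata:
  fixes N :: nat and h :: "'t \<Rightarrow> real"
  assumes w: "w \<in> space (PiM {..<N} (\<lambda>_. P))"
  shows "(\<Sum>i<N. h (T (w i))) = (\<Sum>t\<in>\<T>. real (card {i\<in>{..<N}. T (w i) = t}) * h t)"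
proof -
  have "(\<Sum>i<N. h (T (w i))) = (\<Sum>t\<in>\<T>. \<Sum>i\<in>{i\<in>{..<N}. T (w i) = t}. h (T (w i)))"
    using w finite_strata T_in by (intro sum.group[symmetric]) (auto simp: space_PiM PiE_iff)
  then show ?thesis by simp
qed

text \<open>Subtracting the centred average of all stratum means, \<open>?b\<close>, from the
  averaged redraw \<open>?a\<close> cancels the contribution of the units outside \<open>B\<close>
  as well as the overall mean. The term \<open>?b\<close> compares stratum frequencies with stratum
  probabilities.\<close>

lemma empirical_strata_bound:
  fixes f :: "'w \<Rightarrow> real"
  assumes f: "integrable P f" and B: "B \<subseteq> {..<N}" and w: "w \<in> space (PiM {..<N} (\<lambda>_. P))"
    and maj: "\<And>x. x \<in> space (PiM {..<N} (\<lambda>_. P)) \<Longrightarrow>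
      ennreal \<bar>empirical N x f - (\<integral>y. f y \<partial>P)\<bar> \<le> D x"
    and \<tau>: "\<And>i. i < N \<Longrightarrow> \<tau> i = T (w i)"
    and K: "0 \<le> K" "\<And>t. t \<in> \<T> \<Longrightarrow> \<bar>\<integral>y. f y \<partial>Q t\<bar> \<le> K"
  shows "ennreal \<bar>(\<Sum>i\<in>B. f (w i) - (\<integral>y. f y \<partial>Q (\<tau> i))) / real N\<bar>
    \<le> resampled N D \<tau> B w + ennreal (K * deviation N w)"
proof -
  let ?m = "\<lambda>t. \<integral>y. f y \<partial>Q t" and ?I = "\<integral>y. f y \<partial>P"
  let ?a = "((\<Sum>i\<in>B. f (w i)) + (\<Sum>i\<in>{..<N} - B. ?m (\<tau> i))) / real N - ?I"
  let ?b = "(\<Sum>i<N. ?m (\<tau> i)) / real N - ?I"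
  have "(\<Sum>i<N. ?m (\<tau> i)) = (\<Sum>i\<in>B. ?m (\<tau> i)) + (\<Sum>i\<in>{..<N} - B. ?m (\<tau> i))"
    using sum.subset_diff[OF B] by (simp add: add.commute)
  then have "(\<Sum>i\<in>B. f (w i) - ?m (\<tau> i)) / real N = ?a - ?b"
    by (simp add: sum_subtractf diff_divide_distrib add_divide_distrib)
  then have "\<bar>(\<Sum>i\<in>B. f (w i) - ?m (\<tau> i)) / real N\<bar> \<le> \<bar>?a\<bar> + \<bar>?b\<bar>"
    by linarith
  also have "\<bar>?b\<bar> \<le> K * deviation N w"
  proof -
    have "(\<Sum>i<N. ?m (\<tau> i)) = (\<Sum>i<N. ?m (T (w i)))"
      using \<tau> by simp
    also have "\<dots> = (\<Sum>t\<in>\<T>. real (card {i\<in>{..<N}. T (w i) = t}) * ?m t)"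
      by (rule sum_over_strata[OF w])
    finally have "?b = (\<Sum>t\<in>\<T>. (real (card {i\<in>{..<N}. T (w i) = t}) / real N - q t) * ?m t)"
      unfolding sum_strata_integral[OF f, symmetric]
      by (simp add: sum_divide_distrib left_diff_distrib sum_subtractf)
    also have "\<bar>\<dots>\<bar> \<le> (\<Sum>t\<in>\<T>. \<bar>real (card {i\<in>{..<N}. T (w i) = t}) / real N - q t\<bar> * K)"
      using K by (intro order_trans[OF sum_abs] sum_mono) (simp add: abs_mult mult_left_mono)
    finally show ?thesis
      by (simp add: deviation_def sum_distrib_left mult.commute)
  qed
  finally have "ennreal \<bar>(\<Sum>i\<in>B. f (w i) - ?m (\<tau> i)) / real N\<bar>
      \<le> ennreal (\<bar>?a\<bar> + K * deviation N w)"
    by (intro ennreal_leI) simp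
  also have "\<dots> = ennreal \<bar>?a\<bar> + ennreal (K * deviation N w)"
    using K by (intro ennreal_plus) (auto simp: deviation_def sum_nonneg)
  also have "\<dots> \<le> resampled N D \<tau> B w + ennreal (K * deviation N w)"
    by (rule add_mono[OF empirical_resampled_bound[OF f B w maj] order_refl])
  finally show ?thesis .
qed

end

context strata
begin

text \<open>The restriction makes stratum vectors extensional functions, of which there are finitely
  many, so that expectations split into finite sums over them.\<close>

definition types :: "nat \<Rightarrow> (nat \<Rightarrow> 'w) \<Rightarrow> nat \<Rightarrow> 't" where
  "types N w = (\<lambda>i\<in>{..<N}. T (w i))"

lemma types_in: "w \<in> space (PiM {..<N} (\<lambda>_. P)) \<Longrightarrow> types N w \<in> {..<N} \<rightarrow>\<^sub>E \<T>"
  using T_in by (auto simp: types_def space_PiM PiE_iff)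

lemma mem_strata_iff:
  assumes "w \<in> space (PiM {..<N} (\<lambda>_. P))" "\<tau> \<in> {..<N} \<rightarrow>\<^sub>E \<T>"
  shows "w \<in> (\<Pi>\<^sub>E i\<in>{..<N}. stratum (\<tau> i)) \<longleftrightarrow> types N w = \<tau>"
proof -
  have "types N w = \<tau> \<longleftrightarrow> (\<forall>i<N. T (w i) = \<tau> i)"
    using assms(2) by (auto simp: types_def fun_eq_iff PiE_iff extensional_def)
  moreover have "w i \<in> space P" if "i < N" for i
    using assms(1) that by (simp add: space_PiM PiE_iff)
  moreover have "w \<in> extensional {..<N}"
    using assms(1) by (simp add: space_PiM PiE_def)
  ultimately show ?thesis
    by (auto simp: stratum_def PiE_iff)
qed

lemma strata_sets[measurable]: "(\<Pi>\<^sub>E i\<in>{..<N::nat}. stratum (\<tau> i)) \<in> sets (PiM {..<N} (\<lambda>_. P))"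
  by (auto intro!: sets_PiM_I_finite)

lemma finite_types: "finite ({..<N::nat} \<rightarrow>\<^sub>E \<T>)"
  using finite_strata by (intro finite_PiE) auto

end

text \<open>The crucial assumption \<open>selection\<close> says that the conditional law \<open>g\<close> of the selected set given
  the data depends on the strata of the observations only.\<close>

locale stratified_selection = strata P T \<T> + M: prob_space M
  for P :: "'w measure" and T :: "'w \<Rightarrow> 't" and \<T> :: "'t set" and M :: "'o measure" +
  fixes N :: nat and W :: "'o \<Rightarrow> nat \<Rightarrow> 'w" and A :: "'o \<Rightarrow> nat set"
    and g :: "(nat \<Rightarrow> 't) \<Rightarrow> nat set \<Rightarrow> ennreal"
  assumes W_meas[measurable]: "W \<in> measurable M (PiM {..<N} (\<lambda>_. P))"
    and W_law: "distr M (PiM {..<N} (\<lambda>_. P)) W = PiM {..<N} (\<lambda>_. P)"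
    and A_sub: "\<And>\<omega>. \<omega> \<in> space M \<Longrightarrow> A \<omega> \<subseteq> {..<N}"
    and A_meas[measurable]: "\<And>S. {\<omega> \<in> space M. A \<omega> = S} \<in> sets M"
    and g_sum: "\<And>\<tau>. \<tau> \<in> {..<N} \<rightarrow>\<^sub>E \<T> \<Longrightarrow> (\<Sum>S\<in>Pow {..<N}. g \<tau> S) \<le> 1"
    and selection: "\<And>S h. S \<subseteq> {..<N} \<Longrightarrow> h \<in> borel_measurable (PiM {..<N} (\<lambda>_. P)) \<Longrightarrow>
      (\<integral>\<^sup>+\<omega>. indicator {\<omega> \<in> space M. A \<omega> = S} \<omega> * h (W \<omega>) \<partial>M)
      = (\<integral>\<^sup>+\<omega>. g (types N (W \<omega>)) S * h (W \<omega>) \<partial>M)"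
begin

section \<open>Expectations over the data and the selected set\<close>

lemma W_space: "\<omega> \<in> space M \<Longrightarrow> W \<omega> \<in> space (PiM {..<N} (\<lambda>_. P))"
  using measurable_space[OF W_meas] .

lemma nn_integral_W:
  "h \<in> borel_measurable (PiM {..<N} (\<lambda>_. P)) \<Longrightarrow> (\<integral>\<^sup>+\<omega>. h (W \<omega>) \<partial>M) = (\<integral>\<^sup>+w. h w \<partial>PiM {..<N} (\<lambda>_. P))"
  by (subst W_law[symmetric], subst nn_integral_distr) auto

text \<open>There are finitely many pairs of a stratum vector and a selected set. On each piece both
  are constant, so \<open>selection\<close> trades the indicator of the set for the constant
  \<open>g \<tau> S\<close> and leaves an integral over the data alone. Measurability of
  \<open>H\<close> is needed only for each pair separately.\<close>

lemma
  assumes H: "\<And>\<tau> S. \<tau> \<in> {..<N} \<rightarrow>\<^sub>E \<T> \<Longrightarrow> S \<subseteq> {..<N} \<Longrightarrow>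
    H \<tau> S \<in> borel_measurable (PiM {..<N} (\<lambda>_. P))"
  shows measurable_selection: "(\<lambda>\<omega>. H (types N (W \<omega>)) (A \<omega>) (W \<omega>)) \<in> borel_measurable M"
    and nn_integral_selection: "(\<integral>\<^sup>+\<omega>. H (types N (W \<omega>)) (A \<omega>) (W \<omega>) \<partial>M)
      = (\<Sum>\<tau>\<in>{..<N} \<rightarrow>\<^sub>E \<T>. \<Sum>S\<in>Pow {..<N}. g \<tau> S *
          (\<integral>\<^sup>+w. H \<tau> S w * indicator (\<Pi>\<^sub>E i\<in>{..<N}. stratum (\<tau> i)) w \<partial>PiM {..<N} (\<lambda>_. P)))"
proof -
  let ?TT = "{..<N} \<rightarrow>\<^sub>E \<T>"
  let ?C = "\<lambda>\<tau>. \<Pi>\<^sub>E i\<in>{..<N}. stratum (\<tau> i)"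
  let ?h = "\<lambda>\<tau> S w. H \<tau> S w * indicator (?C \<tau>) w"
  let ?ind = "\<lambda>S \<omega>. indicator {\<omega> \<in> space M. A \<omega> = S} \<omega> :: ennreal"
  have h: "?h \<tau> S \<in> borel_measurable (PiM {..<N} (\<lambda>_. P))"
    if "\<tau> \<in> ?TT" "S \<in> Pow {..<N}" for \<tau> S
    using H[of \<tau> S] that by (intro borel_measurable_times_ennreal borel_measurable_indicator strata_sets) auto
  have hW: "(\<lambda>\<omega>. ?ind S \<omega> * ?h \<tau> S (W \<omega>)) \<in> borel_measurable M"
    if "\<tau> \<in> ?TT" "S \<in> Pow {..<N}" for \<tau> S
    using measurable_compose[OF W_meas h[OF that]] by measurable
  have eq: "H (types N (W \<omega>)) (A \<omega>) (W \<omega>) = (\<Sum>\<tau>\<in>?TT. \<Sum>S\<in>Pow {..<N}. ?ind S \<omega> * ?h \<tau> S (W \<omega>))"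
    if \<omega>: "\<omega> \<in> space M" for \<omega>
  proof -
    have "(\<Sum>\<tau>\<in>?TT. \<Sum>S\<in>Pow {..<N}. ?ind S \<omega> * ?h \<tau> S (W \<omega>))
        = (\<Sum>\<tau>\<in>?TT. \<Sum>S\<in>Pow {..<N}. if S = A \<omega> then ?h \<tau> (A \<omega>) (W \<omega>) else 0)"
      using \<omega> by (intro sum.cong refl) auto
    also have "\<dots> = (\<Sum>\<tau>\<in>?TT. ?h \<tau> (A \<omega>) (W \<omega>))"
      using A_sub[OF \<omega>] by simp
    also have "\<dots> = (\<Sum>\<tau>\<in>?TT. if \<tau> = types N (W \<omega>) then H \<tau> (A \<omega>) (W \<omega>) else 0)"
      using mem_strata_iff[OF W_space[OF \<omega>]] by (intro sum.cong refl) (auto simp: indicator_def)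
    also have "\<dots> = H (types N (W \<omega>)) (A \<omega>) (W \<omega>)"
      using types_in[OF W_space[OF \<omega>]] finite_types by simp
    finally show ?thesis ..
  qed
  show "(\<lambda>\<omega>. H (types N (W \<omega>)) (A \<omega>) (W \<omega>)) \<in> borel_measurable M"
    by (rule measurable_cong[OF eq, THEN iffD2], assumption) (intro borel_measurable_sum hW)
  have "(\<integral>\<^sup>+\<omega>. H (types N (W \<omega>)) (A \<omega>) (W \<omega>) \<partial>M)
      = (\<integral>\<^sup>+\<omega>. (\<Sum>\<tau>\<in>?TT. \<Sum>S\<in>Pow {..<N}. ?ind S \<omega> * ?h \<tau> S (W \<omega>)) \<partial>M)"
    by (rule nn_integral_cong[OF eq])
  also have "\<dots> = (\<Sum>\<tau>\<in>?TT. \<integral>\<^sup>+\<omega>. (\<Sum>S\<in>Pow {..<N}. ?ind S \<omega> * ?h \<tau> S (W \<omega>)) \<partial>M)"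
    by (intro nn_integral_sum borel_measurable_sum hW)
  also have "\<dots> = (\<Sum>\<tau>\<in>?TT. \<Sum>S\<in>Pow {..<N}. \<integral>\<^sup>+\<omega>. ?ind S \<omega> * ?h \<tau> S (W \<omega>) \<partial>M)"
    by (intro sum.cong[OF refl] nn_integral_sum hW)
  also have "\<dots> = (\<Sum>\<tau>\<in>?TT. \<Sum>S\<in>Pow {..<N}. g \<tau> S * (\<integral>\<^sup>+w. ?h \<tau> S w \<partial>PiM {..<N} (\<lambda>_. P)))"
  proof (intro sum.cong refl)
    fix \<tau> S assume \<tau>: "\<tau> \<in> ?TT" and S: "S \<in> Pow {..<N}"
    have "(\<integral>\<^sup>+\<omega>. ?ind S \<omega> * ?h \<tau> S (W \<omega>) \<partial>M) = (\<integral>\<^sup>+\<omega>. g (types N (W \<omega>)) S * ?h \<tau> S (W \<omega>) \<partial>M)"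
      using S by (intro selection h \<tau>) auto
    also have "\<dots> = (\<integral>\<^sup>+\<omega>. g \<tau> S * ?h \<tau> S (W \<omega>) \<partial>M)"
      using mem_strata_iff[OF W_space \<tau>] by (intro nn_integral_cong) (auto simp: indicator_def)
    also have "\<dots> = g \<tau> S * (\<integral>\<^sup>+\<omega>. ?h \<tau> S (W \<omega>) \<partial>M)"
      by (rule nn_integral_cmult[OF measurable_compose[OF W_meas h[OF \<tau> S]]])
    finally show "(\<integral>\<^sup>+\<omega>. ?ind S \<omega> * ?h \<tau> S (W \<omega>) \<partial>M) = g \<tau> S * (\<integral>\<^sup>+w. ?h \<tau> S w \<partial>PiM {..<N} (\<lambda>_. P))"
      using nn_integral_W[OF h[OF \<tau> S]] by simp
  qed
  finally show "(\<integral>\<^sup>+\<omega>. H (types N (W \<omega>)) (A \<omega>) (W \<omega>) \<partial>M)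
      = (\<Sum>\<tau>\<in>?TT. \<Sum>S\<in>Pow {..<N}. g \<tau> S * (\<integral>\<^sup>+w. ?h \<tau> S w \<partial>PiM {..<N} (\<lambda>_. P)))" .
qed

text \<open>Conditioning on the strata in the form of an inequality: the rectangles of the stratum
  vectors partition the sample space, so it is enough to compare on each of them.\<close>

lemma nn_integral_selection_le:
  assumes h: "h \<in> borel_measurable (PiM {..<N} (\<lambda>_. P))"
    and H: "\<And>\<tau> S. \<tau> \<in> {..<N} \<rightarrow>\<^sub>E \<T> \<Longrightarrow> S \<subseteq> {..<N} \<Longrightarrow>
      H \<tau> S \<in> borel_measurable (PiM {..<N} (\<lambda>_. P))"
    and le: "\<And>\<tau>. \<tau> \<in> {..<N} \<rightarrow>\<^sub>E \<T> \<Longrightarrow> (\<Sum>S\<in>Pow {..<N}. g \<tau> S *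
          (\<integral>\<^sup>+w. H \<tau> S w * indicator (\<Pi>\<^sub>E i\<in>{..<N}. stratum (\<tau> i)) w \<partial>PiM {..<N} (\<lambda>_. P)))
        \<le> (\<integral>\<^sup>+w. h w * indicator (\<Pi>\<^sub>E i\<in>{..<N}. stratum (\<tau> i)) w \<partial>PiM {..<N} (\<lambda>_. P))"
  shows "(\<integral>\<^sup>+\<omega>. H (types N (W \<omega>)) (A \<omega>) (W \<omega>) \<partial>M) \<le> (\<integral>\<^sup>+w. h w \<partial>PiM {..<N} (\<lambda>_. P))"
proof -
  let ?TT = "{..<N} \<rightarrow>\<^sub>E \<T>"
  let ?C = "\<lambda>\<tau>. \<Pi>\<^sub>E i\<in>{..<N}. stratum (\<tau> i)"
  have "(\<integral>\<^sup>+\<omega>. H (types N (W \<omega>)) (A \<omega>) (W \<omega>) \<partial>M)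
      \<le> (\<Sum>\<tau>\<in>?TT. \<integral>\<^sup>+w. h w * indicator (?C \<tau>) w \<partial>PiM {..<N} (\<lambda>_. P))"
    by (subst nn_integral_selection[OF H]) (auto intro!: sum_mono le)
  also have "\<dots> = (\<integral>\<^sup>+w. (\<Sum>\<tau>\<in>?TT. h w * indicator (?C \<tau>) w) \<partial>PiM {..<N} (\<lambda>_. P))"
    by (intro nn_integral_sum[symmetric] borel_measurable_times_ennreal h borel_measurable_indicator strata_sets)
  also have "\<dots> = (\<integral>\<^sup>+w. h w \<partial>PiM {..<N} (\<lambda>_. P))"
  proof (rule nn_integral_cong)
    fix w assume w: "w \<in> space (PiM {..<N} (\<lambda>_. P))"
    have "(\<Sum>\<tau>\<in>?TT. h w * indicator (?C \<tau>) w) = (\<Sum>\<tau>\<in>?TT. if \<tau> = types N w then h w else 0)"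
      using mem_strata_iff[OF w] by (intro sum.cong refl) (auto simp: indicator_def)
    then show "(\<Sum>\<tau>\<in>?TT. h w * indicator (?C \<tau>) w) = h w"
      using types_in[OF w] finite_types by simp
  qed
  finally show ?thesis .
qed

text \<open>The integral of a redrawn majorant over a stratum rectangle is the same for every
  subset, so the law of the selected set enters only through its total mass, which is at most
  one.\<close>

lemma nn_integral_resampled_selection:
  fixes t assumes D: "D \<in> borel_measurable (PiM {..<N} (\<lambda>_. P))"
  defines "Y \<equiv> \<lambda>\<omega>. resampled N D (types N (W \<omega>)) {i \<in> A \<omega>. types N (W \<omega>) i = t} (W \<omega>)"
  shows "Y \<in> borel_measurable M" "(\<integral>\<^sup>+\<omega>. Y \<omega> \<partial>M) \<le> (\<integral>\<^sup>+w. D w \<partial>PiM {..<N} (\<lambda>_. P))"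
proof -
  let ?H = "\<lambda>\<tau> S. resampled N D \<tau> {i \<in> S. \<tau> i = t}"
  have H: "?H \<tau> S \<in> borel_measurable (PiM {..<N} (\<lambda>_. P))" if "S \<subseteq> {..<N}" for \<tau> S
    using that by (intro resampled_measurable D) auto
  show "Y \<in> borel_measurable M"
    unfolding Y_def by (rule measurable_selection[of ?H]) (rule H)
  show "(\<integral>\<^sup>+\<omega>. Y \<omega> \<partial>M) \<le> (\<integral>\<^sup>+w. D w \<partial>PiM {..<N} (\<lambda>_. P))"
    unfolding Y_def
  proof (rule nn_integral_selection_le[of D ?H, OF D H])
    fix \<tau> assume \<tau>: "\<tau> \<in> {..<N} \<rightarrow>\<^sub>E \<T>"
    let ?I = "\<integral>\<^sup>+w. D w * indicator (\<Pi>\<^sub>E i\<in>{..<N}. stratum (\<tau> i)) w \<partial>PiM {..<N} (\<lambda>_. P)"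
    have "(\<Sum>S\<in>Pow {..<N}. g \<tau> S *
          (\<integral>\<^sup>+w. ?H \<tau> S w * indicator (\<Pi>\<^sub>E i\<in>{..<N}. stratum (\<tau> i)) w \<partial>PiM {..<N} (\<lambda>_. P)))
        = (\<Sum>S\<in>Pow {..<N}. g \<tau> S * ?I)"
      by (intro sum.cong refl arg_cong2[where f="(*)"] nn_integral_resampled D) auto
    also have "\<dots> = (\<Sum>S\<in>Pow {..<N}. g \<tau> S) * ?I"
      by (simp add: sum_distrib_right)
    also have "\<dots> \<le> 1 * ?I"
      by (intro mult_right_mono g_sum \<tau>) simp
    finally show "(\<Sum>S\<in>Pow {..<N}. g \<tau> S *
          (\<integral>\<^sup>+w. ?H \<tau> S w * indicator (\<Pi>\<^sub>E i\<in>{..<N}. stratum (\<tau> i)) w \<partial>PiM {..<N} (\<lambda>_. P))) \<le> ?I"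
      by simp
  qed
qed

lemma nn_integral_count_selection:
  assumes le: "\<And>\<tau>. \<tau> \<in> {..<N} \<rightarrow>\<^sub>E \<T> \<Longrightarrow> (\<Sum>S\<in>Pow {..<N}. g \<tau> S * H \<tau> S) \<le> c"
  defines "Y \<equiv> \<lambda>\<omega>. H (types N (W \<omega>)) (A \<omega>)"
  shows "Y \<in> borel_measurable M" "(\<integral>\<^sup>+\<omega>. Y \<omega> \<partial>M) \<le> c"
proof -
  let ?H = "\<lambda>\<tau> S w. H \<tau> S"
  interpret PN: prob_space "PiM {..<N} (\<lambda>_. P)"
    by (intro prob_space_PiM prob_space_axioms)
  show "Y \<in> borel_measurable M"
    unfolding Y_def by (rule measurable_selection[of ?H]) simp
  have "(\<integral>\<^sup>+\<omega>. Y \<omega> \<partial>M) \<le> (\<integral>\<^sup>+w. c \<partial>PiM {..<N} (\<lambda>_. P))"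
    unfolding Y_def
  proof (rule nn_integral_selection_le[of "\<lambda>_. c" ?H])
    fix \<tau> assume \<tau>: "\<tau> \<in> {..<N} \<rightarrow>\<^sub>E \<T>"
    let ?p = "emeasure (PiM {..<N} (\<lambda>_. P)) (\<Pi>\<^sub>E i\<in>{..<N}. stratum (\<tau> i))"
    have "(\<Sum>S\<in>Pow {..<N}. g \<tau> S * (H \<tau> S * ?p)) = (\<Sum>S\<in>Pow {..<N}. g \<tau> S * H \<tau> S) * ?p"
      by (simp add: sum_distrib_right mult.assoc)
    also have "\<dots> \<le> c * ?p"
      by (intro mult_right_mono le \<tau>) simp
    finally show "(\<Sum>S\<in>Pow {..<N}. g \<tau> S *
          (\<integral>\<^sup>+w. H \<tau> S * indicator (\<Pi>\<^sub>E i\<in>{..<N}. stratum (\<tau> i)) w \<partial>PiM {..<N} (\<lambda>_. P)))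
        \<le> (\<integral>\<^sup>+w. c * indicator (\<Pi>\<^sub>E i\<in>{..<N}. stratum (\<tau> i)) w \<partial>PiM {..<N} (\<lambda>_. P))"
      by (simp add: nn_integral_cmult_indicator)
  qed auto
  then show "(\<integral>\<^sup>+\<omega>. Y \<omega> \<partial>M) \<le> c"
    by (simp add: PN.emeasure_space_1)
qed

end

section \<open>Second moments of simple random samples\<close>

lemma card_subsets_containing:
  assumes I: "finite I" and A: "A \<subseteq> I" and k: "card A \<le> k"
  shows "card {S. S \<subseteq> I \<and> card S = k \<and> A \<subseteq> S} = (card I - card A) choose (k - card A)"
proof -
  have fin: "finite A" using I A finite_subset by blast
  have "bij_betw (\<lambda>S. S - A) {S. S \<subseteq> I \<and> card S = k \<and> A \<subseteq> S} {S. S \<subseteq> I - A \<and> card S = k - card A}"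
  proof (rule bij_betw_byWitness[where f'="\<lambda>S. S \<union> A"])
    show "(\<lambda>S. S \<union> A) ` {S. S \<subseteq> I - A \<and> card S = k - card A} \<subseteq> {S. S \<subseteq> I \<and> card S = k \<and> A \<subseteq> S}"
    proof clarify
      fix S assume S: "S \<subseteq> I - A" "card S = k - card A"
      then have "card (S \<union> A) = card S + card A"
        using fin finite_subset[OF S(1)] I by (intro card_Un_disjoint) auto
      then show "S \<union> A \<subseteq> I \<and> card (S \<union> A) = k \<and> A \<subseteq> S \<union> A"
        using S A k by auto
    qed
  qed (auto simp: card_Diff_subset fin)
  then have "card {S. S \<subseteq> I \<and> card S = k \<and> A \<subseteq> S} = card {S. S \<subseteq> I - A \<and> card S = k - card A}"
    by (rule bij_betw_same_card)
  also have "\<dots> = card (I - A) choose (k - card A)"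
    using I by (intro n_subsets) auto
  finally show ?thesis
    using fin A by (simp add: card_Diff_subset)
qed

text \<open>The count weighted by the inverse sampling fraction \<open>r\<close> is unbiased for
  \<open>card L\<close>, and inclusions of distinct units are negatively correlated. Bounding the
  covariances by zero leaves the diagonal terms, which account for
  \<open>r * card L\<close>.\<close>

lemma srs_second_moment:
  fixes I :: "nat set"
  assumes I: "finite I" and k: "0 < k" "k \<le> card I" and L: "L \<subseteq> I"
  defines "r \<equiv> real (card I) / real k"
  shows "measure_pmf.expectation (srs I k) (\<lambda>S. (r * real (card (S \<inter> L)) - real (card L))\<^sup>2)
    \<le> r * real (card L)"
proof -
  let ?m = "card I"
  define \<Omega> where "\<Omega> = {S. S \<subseteq> I \<and> card S = k}"
  have fin: "finite \<Omega>" unfolding \<Omega>_def using I by auto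
  have finL: "finite L" using I L finite_subset by blast
  have card: "card \<Omega> = ?m choose k"
    unfolding \<Omega>_def by (rule n_subsets[OF I])
  then have ne: "\<Omega> \<noteq> {}" and pos: "card \<Omega> > 0"
    using k by (auto simp: zero_less_binomial_iff card_gt_0_iff fin)
  have r: "r > 0" using k by (simp add: r_def)
  obtain m' k' where mk: "?m = Suc m'" "k = Suc k'"
    using k by (metis Suc_pred' less_le_trans)
  have "k * (?m choose k) = ?m * ((?m - 1) choose (k - 1))"
    using Suc_times_binomial[of k' m'] mk by simp
  then have "real k * real (card \<Omega>) = real ?m * real ((?m - 1) choose (k - 1))"
    unfolding card by (metis of_nat_mult)
  then have c1': "real ((?m - 1) choose (k - 1)) = real (card \<Omega>) / r"
    using k by (simp add: r_def field_simps)
  have c1: "real (card {S\<in>\<Omega>. i \<in> S}) = real (card \<Omega>) / r" if "i \<in> L" for i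
  proof -
    have "{S\<in>\<Omega>. i \<in> S} = {S. S \<subseteq> I \<and> card S = k \<and> {i} \<subseteq> S}"
      by (auto simp: \<Omega>_def)
    moreover have "card {S. S \<subseteq> I \<and> card S = k \<and> {i} \<subseteq> S} = (?m - 1) choose (k - 1)"
      using that L k by (subst card_subsets_containing[OF I]) auto
    ultimately show ?thesis
      by (simp only: c1')
  qed
  \<comment> \<open>Negative correlation comes from \<open>(k - 1) / (m - 1) \<le> k / m\<close> for
    \<open>k \<le> m\<close>, where \<open>m\<close> is the size of \<open>I\<close>. The case
    \<open>k = 1\<close> is separate because no sample then contains two units and the binomial
    count requires at least two.\<close>
  have c2: "real (card {S\<in>\<Omega>. i \<in> S \<and> l \<in> S}) \<le> real (card \<Omega>) / r\<^sup>2"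
    if "i \<in> L" "l \<in> L" "i \<noteq> l" for i l
  proof (cases "k \<ge> 2")
    case False
    then have "k = 1" using k by simp
    then have "{S\<in>\<Omega>. i \<in> S \<and> l \<in> S} = {}"
      using that by (auto simp: \<Omega>_def card_1_singleton_iff)
    then have "card {S\<in>\<Omega>. i \<in> S \<and> l \<in> S} = 0"
      by (simp only: card.empty)
    then show ?thesis by simp
  next
    case True
    then obtain k'' m'' where mk2: "?m = Suc (Suc m'')" "k = Suc (Suc k'')"
      using k by (metis Suc_le_D le_trans numeral_2_eq_2 Suc_le_mono)
    have "{S\<in>\<Omega>. i \<in> S \<and> l \<in> S} = {S. S \<subseteq> I \<and> card S = k \<and> {i, l} \<subseteq> S}"
      by (auto simp: \<Omega>_def)
    moreover have "card {S. S \<subseteq> I \<and> card S = k \<and> {i, l} \<subseteq> S} = (?m - 2) choose (k - 2)"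
      using that L True by (subst card_subsets_containing[OF I]) (auto simp: numeral_2_eq_2)
    ultimately have "card {S\<in>\<Omega>. i \<in> S \<and> l \<in> S} = (?m - 2) choose (k - 2)"
      by (simp only:)
    then have e: "card {S\<in>\<Omega>. i \<in> S \<and> l \<in> S} = m'' choose k''"
      using mk2 by simp
    have "(k - 1) * ((?m - 1) choose (k - 1)) = (?m - 1) * (m'' choose k'')"
      using Suc_times_binomial[of k'' m''] mk2 by simp
    then have "real (k - 1) * real ((?m - 1) choose (k - 1)) = real (?m - 1) * real (m'' choose k'')"
      by (metis of_nat_mult)
    then have "real (m'' choose k'') = real (k - 1) / real (?m - 1) * (real (card \<Omega>) / r)"
      using mk2 unfolding c1' by (simp add: field_simps)
    also have "\<dots> \<le> 1 / r * (real (card \<Omega>) / r)"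
    proof (intro mult_right_mono)
      show "real (k - 1) / real (?m - 1) \<le> 1 / r"
        using mk2 k by (simp add: r_def field_simps)
    qed (use r in simp)
    finally show ?thesis
      unfolding e by (simp add: power2_eq_square)
  qed
  have cnt: "real (card (S \<inter> L)) = (\<Sum>i\<in>L. of_bool (i \<in> S))" for S
    using finL by (simp add: Int_def of_bool_def sum.If_cases) (metis Int_commute Int_def)
  have s1: "(\<Sum>S\<in>\<Omega>. real (card (S \<inter> L))) = real (card L) * (real (card \<Omega>) / r)"
  proof -
    have "(\<Sum>S\<in>\<Omega>. real (card (S \<inter> L))) = (\<Sum>i\<in>L. \<Sum>S\<in>\<Omega>. of_bool (i \<in> S))"
      unfolding cnt by (rule sum.swap)
    also have "\<dots> = (\<Sum>i\<in>L. real (card {S\<in>\<Omega>. i \<in> S}))"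
      using fin by (intro sum.cong refl) (simp add: of_bool_def sum.If_cases Int_def)
    finally show ?thesis using c1 by simp
  qed
  have s2: "(\<Sum>S\<in>\<Omega>. (real (card (S \<inter> L)))\<^sup>2)
    \<le> real (card L) * (real (card \<Omega>) / r) + (real (card L))\<^sup>2 * (real (card \<Omega>) / r\<^sup>2)"
  proof -
    have "(\<Sum>S\<in>\<Omega>. (real (card (S \<inter> L)))\<^sup>2) = (\<Sum>S\<in>\<Omega>. \<Sum>i\<in>L. \<Sum>l\<in>L. of_bool (i \<in> S \<and> l \<in> S))"
      unfolding cnt by (simp add: power2_eq_square sum_product of_bool_conj)
    also have "\<dots> = (\<Sum>i\<in>L. \<Sum>S\<in>\<Omega>. \<Sum>l\<in>L. of_bool (i \<in> S \<and> l \<in> S))"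
      by (rule sum.swap)
    also have "\<dots> = (\<Sum>i\<in>L. \<Sum>l\<in>L. \<Sum>S\<in>\<Omega>. of_bool (i \<in> S \<and> l \<in> S))"
      by (intro sum.cong refl sum.swap)
    also have "\<dots> = (\<Sum>i\<in>L. \<Sum>l\<in>L. real (card {S\<in>\<Omega>. i \<in> S \<and> l \<in> S}))"
      using fin by (intro sum.cong refl) (simp add: of_bool_def sum.If_cases Int_def)
    also have "\<dots> \<le> (\<Sum>i\<in>L. \<Sum>l\<in>L. (if l = i then real (card \<Omega>) / r else 0) + real (card \<Omega>) / r\<^sup>2)"
    proof (intro sum_mono)
      fix i l assume "i \<in> L" "l \<in> L"
      then show "real (card {S\<in>\<Omega>. i \<in> S \<and> l \<in> S})
          \<le> (if l = i then real (card \<Omega>) / r else 0) + real (card \<Omega>) / r\<^sup>2"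
        using c1[of i] c2[of i l] by (cases "l = i") auto
    qed
    also have "\<dots> = real (card L) * (real (card \<Omega>) / r) + (real (card L))\<^sup>2 * (real (card \<Omega>) / r\<^sup>2)"
      using finL by (simp add: sum.distrib power2_eq_square distrib_left)
    finally show ?thesis .
  qed
  have "(\<Sum>S\<in>\<Omega>. (r * real (card (S \<inter> L)) - real (card L))\<^sup>2)
      = r\<^sup>2 * (\<Sum>S\<in>\<Omega>. (real (card (S \<inter> L)))\<^sup>2) - 2 * r * real (card L) * (\<Sum>S\<in>\<Omega>. real (card (S \<inter> L)))
        + real (card \<Omega>) * (real (card L))\<^sup>2"
    by (simp add: power2_diff sum.distrib sum_subtractf sum_distrib_left power_mult_distrib algebra_simps)
  also have "\<dots> \<le> r\<^sup>2 * (real (card L) * (real (card \<Omega>) / r) + (real (card L))\<^sup>2 * (real (card \<Omega>) / r\<^sup>2))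
        - 2 * r * real (card L) * (real (card L) * (real (card \<Omega>) / r)) + real (card \<Omega>) * (real (card L))\<^sup>2"
    unfolding s1 using s2 by (intro add_right_mono diff_right_mono mult_left_mono) auto
  \<comment> \<open>The terms quadratic in \<open>card L\<close> appear with coefficients 1, -2 and
    1 and cancel.\<close>
  also have "\<dots> = r * real (card L) * real (card \<Omega>)"
    using r by (simp add: field_simps power2_eq_square)
  finally have "(\<Sum>S\<in>\<Omega>. (r * real (card (S \<inter> L)) - real (card L))\<^sup>2) / real (card \<Omega>) \<le> r * real (card L)"
    using pos by (simp add: field_simps)
  then show ?thesis
    unfolding srs_def \<Omega>_def[symmetric] by (subst integral_pmf_of_set[OF ne fin])
qed

lemma srs_second_moment_sum:
  fixes I :: "nat set"
  assumes I: "I \<subseteq> {..<N}" and k: "0 < k" "k \<le> card I" and L: "L \<subseteq> I"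
  defines "r \<equiv> real (card I) / real k"
  shows "(\<Sum>S\<in>Pow {..<N}. pmf (srs I k) S * (r * real (card (S \<inter> L)) - real (card L))\<^sup>2)
    \<le> r * real (card L)"
proof -
  have fin: "finite I" using I finite_subset by blast
  have ne: "{S. S \<subseteq> I \<and> card S = k} \<noteq> {}"
    using obtain_subset_with_card_n[OF k(2)] by blast
  have "set_pmf (srs I k) \<subseteq> Pow {..<N}"
    unfolding srs_def using ne fin I by (subst set_pmf_of_set) auto
  then have "measure_pmf.expectation (srs I k) (\<lambda>S. (r * real (card (S \<inter> L)) - real (card L))\<^sup>2)
    = (\<Sum>S\<in>Pow {..<N}. (r * real (card (S \<inter> L)) - real (card L))\<^sup>2 * pmf (srs I k) S)"
    by (intro integral_measure_pmf_real) auto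
  then show ?thesis
    using srs_second_moment[OF fin k L] by (simp add: r_def mult.commute)
qed

section \<open>Convergence to zero in outer probability\<close>

lemma outer_measure_of_Un:
  assumes "A \<subseteq> space M" "B \<subseteq> space M"
  shows "outer_measure_of M (A \<union> B) \<le> outer_measure_of M A + outer_measure_of M B"
proof -
  obtain A' where A': "A' \<in> sets M" "A \<subseteq> A'" "outer_measure_of M A = emeasure M A'"
    using outer_measure_of_attain[OF assms(1)] by blast
  obtain B' where B': "B' \<in> sets M" "B \<subseteq> B'" "outer_measure_of M B = emeasure M B'"
    using outer_measure_of_attain[OF assms(2)] by blast
  have "outer_measure_of M (A \<union> B) \<le> outer_measure_of M (A' \<union> B')"
    using A'(2) B'(2) by (intro outer_measure_of_mono) auto
  also have "\<dots> \<le> emeasure M A' + emeasure M B'"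
    using A'(1) B'(1) by (simp add: emeasure_subadditive)
  finally show ?thesis using A'(3) B'(3) by simp
qed

lemma tendsto_zero_le_ennreal:
  fixes f g :: "nat \<Rightarrow> ennreal"
  assumes "g \<longlonglongrightarrow> 0" "eventually (\<lambda>N. f N \<le> g N) sequentially"
  shows "f \<longlonglongrightarrow> 0"
  by (rule tendsto_sandwich[OF _ assms(2) tendsto_const assms(1)]) simp

lemma outer_prob_nullD:
  "outer_prob_null M Z \<Longrightarrow> e > 0 \<Longrightarrow>
    (\<lambda>N. outer_measure_of M {\<omega> \<in> space M. Z N \<omega> > ennreal e}) \<longlonglongrightarrow> 0"
  by (simp add: outer_prob_null_def)

text \<open>The events \<open>bad N\<close> absorb the samples with an atypical sampling fraction,
  on which no bound is available. The empty sample is exempt because averages divide by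
  \<open>N\<close>.\<close>

lemma outer_prob_null_mono:
  assumes X: "outer_prob_null M X"
    and bad: "\<And>N. bad N \<subseteq> space M" "(\<lambda>N. outer_measure_of M (bad N)) \<longlonglongrightarrow> 0"
    and le: "\<And>N \<omega>. N > 0 \<Longrightarrow> \<omega> \<in> space M \<Longrightarrow> \<omega> \<notin> bad N \<Longrightarrow> Z N \<omega> \<le> X N \<omega>"
  shows "outer_prob_null M Z"
  unfolding outer_prob_null_def
proof (intro allI impI)
  fix e :: real assume e: "e > 0"
  have "(\<lambda>N. outer_measure_of M {\<omega> \<in> space M. X N \<omega> > ennreal e} + outer_measure_of M (bad N)) \<longlonglongrightarrow> 0 + 0"
    by (intro tendsto_add outer_prob_nullD X e bad)
  then show "(\<lambda>N. outer_measure_of M {\<omega> \<in> space M. Z N \<omega> > ennreal e}) \<longlonglongrightarrow> 0"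
    unfolding add_0_left
  proof (rule tendsto_zero_le_ennreal)
    show "eventually (\<lambda>N. outer_measure_of M {\<omega> \<in> space M. Z N \<omega> > ennreal e}
      \<le> outer_measure_of M {\<omega> \<in> space M. X N \<omega> > ennreal e} + outer_measure_of M (bad N)) sequentially"
      using eventually_gt_at_top[of 0]
    proof eventually_elim
      case (elim N)
      have "outer_measure_of M {\<omega> \<in> space M. Z N \<omega> > ennreal e}
          \<le> outer_measure_of M ({\<omega> \<in> space M. X N \<omega> > ennreal e} \<union> bad N)"
        using le[OF elim] by (intro outer_measure_of_mono) (auto intro: less_le_trans)
      also have "\<dots> \<le> outer_measure_of M {\<omega> \<in> space M. X N \<omega> > ennreal e} + outer_measure_of M (bad N)"
        using bad(1) by (intro outer_measure_of_Un) auto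
      finally show ?case .
    qed
  qed
qed

lemma outer_prob_null_add:
  assumes "outer_prob_null M X" "outer_prob_null M Y"
  shows "outer_prob_null M (\<lambda>N \<omega>. X N \<omega> + Y N \<omega>)"
  unfolding outer_prob_null_def
proof (intro allI impI)
  fix e :: real assume e: "e > 0"
  let ?X = "\<lambda>N. {\<omega> \<in> space M. X N \<omega> > ennreal (e/2)}" and ?Y = "\<lambda>N. {\<omega> \<in> space M. Y N \<omega> > ennreal (e/2)}"
  have "(\<lambda>N. outer_measure_of M (?X N) + outer_measure_of M (?Y N)) \<longlonglongrightarrow> 0 + 0"
    using e by (intro tendsto_add outer_prob_nullD assms) auto
  then show "(\<lambda>N. outer_measure_of M {\<omega> \<in> space M. X N \<omega> + Y N \<omega> > ennreal e}) \<longlonglongrightarrow> 0"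
    unfolding add_0_left
  proof (rule tendsto_zero_le_ennreal)
    have split: "x > ennreal (e/2) \<or> y > ennreal (e/2)" if "x + y > ennreal e" for x y
    proof (rule ccontr)
      assume "\<not> ?thesis"
      then have "x + y \<le> ennreal (e/2) + ennreal (e/2)"
        by (intro add_mono) (auto simp: not_less)
      also have "\<dots> = ennreal e" using e by (subst ennreal_plus[symmetric]) auto
      finally show False using that by simp
    qed
    have "outer_measure_of M {\<omega> \<in> space M. X N \<omega> + Y N \<omega> > ennreal e}
        \<le> outer_measure_of M (?X N) + outer_measure_of M (?Y N)" for N
      using split by (intro order_trans[OF outer_measure_of_mono outer_measure_of_Un]) blast+
    then show "eventually (\<lambda>N. outer_measure_of M {\<omega> \<in> space M. X N \<omega> + Y N \<omega> > ennreal e}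
        \<le> outer_measure_of M (?X N) + outer_measure_of M (?Y N)) sequentially"
      by simp
  qed
qed

lemma outer_prob_null_zero: "outer_prob_null M (\<lambda>N \<omega>. 0)"
  by (simp add: outer_prob_null_def)

lemma outer_prob_null_sum:
  "finite I \<Longrightarrow> (\<And>i. i \<in> I \<Longrightarrow> outer_prob_null M (X i)) \<Longrightarrow>
    outer_prob_null M (\<lambda>N \<omega>. \<Sum>i\<in>I. X i N \<omega>)"
  by (induction I rule: finite_induct) (simp_all add: outer_prob_null_zero outer_prob_null_add)

lemma outer_prob_null_cmult:
  assumes X: "outer_prob_null M X"
  shows "outer_prob_null M (\<lambda>N \<omega>. ennreal c * X N \<omega>)"
proof (cases "c > 0")
  case False
  then show ?thesis by (simp add: outer_prob_null_zero ennreal_neg)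
next
  case True
  show ?thesis
    unfolding outer_prob_null_def
  proof (intro allI impI)
    fix e :: real assume e: "e > 0"
    show "(\<lambda>N. outer_measure_of M {\<omega> \<in> space M. ennreal c * X N \<omega> > ennreal e}) \<longlonglongrightarrow> 0"
    proof (rule tendsto_zero_le_ennreal)
      show "(\<lambda>N. outer_measure_of M {\<omega> \<in> space M. X N \<omega> > ennreal (e / c)}) \<longlonglongrightarrow> 0"
        using True e by (intro outer_prob_nullD X) simp
      have "x > ennreal (e / c)" if "ennreal c * x > ennreal e" for x
      proof (rule ccontr)
        assume "\<not> ?thesis"
        then have "ennreal c * x \<le> ennreal c * ennreal (e / c)"
          by (intro mult_left_mono) (auto simp: not_less)
        also have "\<dots> = ennreal e"
          using True e by (subst ennreal_mult[symmetric]) auto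
        finally show False using that by simp
      qed
      then show "eventually (\<lambda>N. outer_measure_of M {\<omega> \<in> space M. ennreal c * X N \<omega> > ennreal e}
        \<le> outer_measure_of M {\<omega> \<in> space M. X N \<omega> > ennreal (e / c)}) sequentially"
        by (intro always_eventually allI outer_measure_of_mono) auto
    qed
  qed
qed

lemma outer_prob_null_nn_integral:
  assumes [measurable]: "\<And>N. Y N \<in> borel_measurable M"
    and lim: "(\<lambda>N. \<integral>\<^sup>+\<omega>. Y N \<omega> \<partial>M) \<longlonglongrightarrow> 0"
  shows "outer_prob_null M Y"
  unfolding outer_prob_null_def
proof (intro allI impI)
  fix e :: real assume e: "e > 0"
  have "(\<lambda>N. ennreal (1 / e) * (\<integral>\<^sup>+\<omega>. Y N \<omega> \<partial>M)) \<longlonglongrightarrow> ennreal (1 / e) * 0"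
    using lim by (intro ennreal_tendsto_cmult) auto
  then show "(\<lambda>N. outer_measure_of M {\<omega> \<in> space M. Y N \<omega> > ennreal e}) \<longlonglongrightarrow> 0"
    unfolding mult_zero_right
  proof (rule tendsto_zero_le_ennreal)
    have "outer_measure_of M {\<omega> \<in> space M. Y N \<omega> > ennreal e} \<le> ennreal (1 / e) * (\<integral>\<^sup>+\<omega>. Y N \<omega> \<partial>M)" for N
    proof -
      have "outer_measure_of M {\<omega> \<in> space M. Y N \<omega> > ennreal e} = emeasure M {\<omega> \<in> space M. Y N \<omega> > ennreal e}"
        by simp
      also have "\<dots> \<le> emeasure M {\<omega> \<in> space M. 1 \<le> ennreal (1 / e) * Y N \<omega>}"
      proof (intro emeasure_mono subsetI CollectI conjI)
        fix \<omega> assume "\<omega> \<in> {\<omega> \<in> space M. Y N \<omega> > ennreal e}"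
        then have "ennreal (1 / e) * ennreal e \<le> ennreal (1 / e) * Y N \<omega>"
          by (intro mult_left_mono) auto
        then show "1 \<le> ennreal (1 / e) * Y N \<omega>"
          using e by (simp add: ennreal_mult[symmetric])
      qed auto
      also have "\<dots> \<le> ennreal (1 / e) * (\<integral>\<^sup>+\<omega>. Y N \<omega> * indicator (space M) \<omega> \<partial>M)"
        using nn_integral_Markov_inequality[of "Y N" "space M" M "ennreal (1 / e)"] by simp
      also have "(\<integral>\<^sup>+\<omega>. Y N \<omega> * indicator (space M) \<omega> \<partial>M) = (\<integral>\<^sup>+\<omega>. Y N \<omega> \<partial>M)"
        by (intro nn_integral_cong) auto
      finally show ?thesis .
    qed
    then show "eventually (\<lambda>N. outer_measure_of M {\<omega> \<in> space M. Y N \<omega> > ennreal e}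
        \<le> ennreal (1 / e) * (\<integral>\<^sup>+\<omega>. Y N \<omega> \<partial>M)) sequentially"
      by simp
  qed
qed

text \<open>Hoeffding's inequality for the indicators gives the tail bound
  \<open>2 * exp (- 2 * e\<^sup>2 * N)\<close>, hence convergence in probability directly.\<close>

lemma (in prob_space) outer_prob_null_frequency:
  assumes indep: "indep_vars (\<lambda>_. S) W UNIV" and law: "\<And>i::nat. distr M S (W i) = P" and B: "B \<in> sets S"
  shows "outer_prob_null M (\<lambda>N \<omega>. ennreal \<bar>real (card {i\<in>{..<N}. W i \<omega> \<in> B}) / real N - measure P B\<bar>)"
  unfolding outer_prob_null_def
proof (intro allI impI)
  fix e :: real assume e: "e > 0"
  have W[measurable]: "W i \<in> measurable M S" for i
    using indep by (auto simp: indep_vars_def)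
  let ?X = "\<lambda>i \<omega>. indicator B (W i \<omega>) :: real"
  let ?Z = "\<lambda>N \<omega>. \<bar>real (card {i\<in>{..<N}. W i \<omega> \<in> B}) / real N - measure P B\<bar>"
  note [measurable] = B
  have exp: "expectation (?X i) = measure P B" for i
  proof -
    have "expectation (?X i) = (\<integral>w. indicator B w \<partial>distr M S (W i))"
      by (subst integral_distr) auto
    then show ?thesis
      using law[of i] sets_distr[of M S "W i"] B by (simp add: Int_absorb1 sets.sets_into_space)
  qed
  have bound: "prob {\<omega> \<in> space M. ?Z N \<omega> > e} \<le> 2 * exp (- 2 * e\<^sup>2 * real N)" if N: "N > 0" for N
  proof -
    interpret Hoeffding_ineq M "{..<N}" ?X "\<lambda>_. 0" "\<lambda>_. 1" "real N * measure P B"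
    proof unfold_locales
      show "indep_vars (\<lambda>_. borel) ?X {..<N}"
        by (rule indep_vars_compose2[OF indep_vars_subset[OF indep]]) auto
    qed (auto simp: exp)
    have cnt: "(\<Sum>i<N. ?X i \<omega>) = real (card {i\<in>{..<N}. W i \<omega> \<in> B})" for \<omega>
      by (simp add: indicator_def sum.If_cases Int_def)
    have "{\<omega> \<in> space M. ?Z N \<omega> > e} \<subseteq> {\<omega> \<in> space M. \<bar>(\<Sum>i<N. ?X i \<omega>) - real N * measure P B\<bar> \<ge> e * real N}"
    proof (intro subsetI CollectI conjI)
      fix \<omega> assume "\<omega> \<in> {\<omega> \<in> space M. ?Z N \<omega> > e}"
      then have "e * real N \<le> ?Z N \<omega> * \<bar>real N\<bar>"
        by (intro mult_mono) auto
      also have "\<dots> = \<bar>(\<Sum>i<N. ?X i \<omega>) - real N * measure P B\<bar>"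
        unfolding cnt abs_mult[symmetric] using N by (simp add: algebra_simps)
      finally show "e * real N \<le> \<bar>(\<Sum>i<N. ?X i \<omega>) - real N * measure P B\<bar>" .
    qed auto
    then have "prob {\<omega> \<in> space M. ?Z N \<omega> > e} \<le> prob {\<omega> \<in> space M. \<bar>(\<Sum>i<N. ?X i \<omega>) - real N * measure P B\<bar> \<ge> e * real N}"
      by (intro finite_measure_mono) auto
    also have "\<dots> \<le> 2 * exp (- 2 * (e * real N)\<^sup>2 / (\<Sum>i<N. (1 - 0)\<^sup>2))"
      using e N by (intro Hoeffding_ineq_abs_ge) auto
    also have "\<dots> = 2 * exp (- 2 * e\<^sup>2 * real N)"
      using N by (simp add: power2_eq_square)
    finally show ?thesis .
  qed
  have lim: "(\<lambda>N. ennreal (2 * exp (- 2 * e\<^sup>2 * real N))) \<longlonglongrightarrow> 0"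
  proof -
    have "(\<lambda>N. 2 * exp (- 2 * e\<^sup>2 * real N)) = (\<lambda>N. 2 * exp (- 2 * e\<^sup>2) ^ N)"
      by (simp add: exp_of_nat_mult[symmetric] mult.commute)
    moreover have "(\<lambda>N. 2 * exp (- 2 * e\<^sup>2) ^ N) \<longlonglongrightarrow> 2 * 0"
      using e by (intro tendsto_mult tendsto_const LIMSEQ_power_zero) simp
    ultimately have "(\<lambda>N. 2 * exp (- 2 * e\<^sup>2 * real N)) \<longlonglongrightarrow> 0"
      by (simp only: mult_zero_right)
    from tendsto_ennrealI[OF this] show ?thesis by simp
  qed
  show "(\<lambda>N. outer_measure_of M {\<omega> \<in> space M. ennreal (?Z N \<omega>) > ennreal e}) \<longlonglongrightarrow> 0"
  proof (rule tendsto_zero_le_ennreal[OF lim])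
    show "eventually (\<lambda>N. outer_measure_of M {\<omega> \<in> space M. ennreal (?Z N \<omega>) > ennreal e}
        \<le> ennreal (2 * exp (- 2 * e\<^sup>2 * real N))) sequentially"
      using eventually_gt_at_top[of 0]
    proof eventually_elim
      case (elim N)
      have eq: "{\<omega> \<in> space M. ennreal (?Z N \<omega>) > ennreal e} = {\<omega> \<in> space M. ?Z N \<omega> > e}"
        using e by (simp add: ennreal_less_iff)
      have "(\<lambda>\<omega>. real (card {i\<in>{..<N}. W i \<omega> \<in> B})) = (\<lambda>\<omega>. \<Sum>i<N. ?X i \<omega>)"
        by (simp add: indicator_def sum.If_cases Int_def fun_eq_iff)
      then have [measurable]: "(\<lambda>\<omega>. real (card {i\<in>{..<N}. W i \<omega> \<in> B})) \<in> borel_measurable M"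
        by simp
      have "{\<omega> \<in> space M. ?Z N \<omega> > e} \<in> sets M"
        by measurable
      then show ?case
        unfolding eq using bound[OF elim] by (simp add: emeasure_eq_measure ennreal_leI)
    qed
  qed
qed

section \<open>Conditional probabilities given the data\<close>

text \<open>\<open>real_cond_exp\<close> is a difference of two extended nonnegative conditional
  expectations. For an indicator the subtracted one vanishes and the other is at most one almost
  surely, so no information is lost in the conversion to reals, and the defining property against
  functions measurable for \<open>G\<close> applies.\<close>

lemma nn_integral_cond_prob_alg:
  assumes "prob_space M" and sub: "subalgebra M G" and Q[measurable]: "{\<omega> \<in> space M. Q \<omega>} \<in> sets M"
    and r: "AE \<omega> in M. cond_prob_alg M G Q \<omega> = r \<omega>" and h: "h \<in> borel_measurable G"
  shows "(\<integral>\<^sup>+\<omega>. indicator {\<omega> \<in> space M. Q \<omega>} \<omega> * h \<omega> \<partial>M) = (\<integral>\<^sup>+\<omega>. ennreal (r \<omega>) * h \<omega> \<partial>M)"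
proof -
  interpret prob_space M by fact
  interpret G: finite_measure_subalgebra M G
    by standard (rule sub)
  let ?i = "indicator {\<omega> \<in> space M. Q \<omega>} :: _ \<Rightarrow> real"
  have "AE \<omega> in M. 0 = nn_cond_exp M G (\<lambda>_. 0) \<omega>"
    by (rule G.nn_cond_exp_F_meas) simp
  moreover have "AE \<omega> in M. 1 = nn_cond_exp M G (\<lambda>_. 1) \<omega>"
    by (rule G.nn_cond_exp_F_meas) simp
  moreover have "AE \<omega> in M. nn_cond_exp M G (\<lambda>\<omega>. ennreal (?i \<omega>)) \<omega> \<le> nn_cond_exp M G (\<lambda>_. 1) \<omega>"
    by (rule G.nn_cond_exp_mono) (auto simp: indicator_def)
  ultimately have AE: "AE \<omega> in M. nn_cond_exp M G (\<lambda>\<omega>. ennreal (?i \<omega>)) \<omega> = ennreal (r \<omega>)"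
    using r
  proof eventually_elim
    case (elim \<omega>)
    have "(\<lambda>\<omega>. ennreal (- ?i \<omega>)) = (\<lambda>_. 0)"
      by (auto simp: fun_eq_iff indicator_def ennreal_neg)
    then have "r \<omega> = enn2real (nn_cond_exp M G (\<lambda>\<omega>. ennreal (?i \<omega>)) \<omega>)"
      using elim by (simp add: cond_prob_alg_def real_cond_exp_def)
    moreover have "nn_cond_exp M G (\<lambda>\<omega>. ennreal (?i \<omega>)) \<omega> < \<infinity>"
      using elim(2,3) by (metis ennreal_one_less_top infinity_ennreal_def le_less_trans)
    ultimately show ?case by simp
  qed
  have "(\<integral>\<^sup>+\<omega>. indicator {\<omega> \<in> space M. Q \<omega>} \<omega> * h \<omega> \<partial>M) = (\<integral>\<^sup>+\<omega>. h \<omega> * ennreal (?i \<omega>) \<partial>M)"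
    by (intro nn_integral_cong) (auto simp: indicator_def)
  also have "\<dots> = (\<integral>\<^sup>+\<omega>. h \<omega> * nn_cond_exp M G (\<lambda>\<omega>. ennreal (?i \<omega>)) \<omega> \<partial>M)"
    by (rule G.nn_cond_exp_intg[symmetric, OF h]) simp
  also have "\<dots> = (\<integral>\<^sup>+\<omega>. ennreal (r \<omega>) * h \<omega> \<partial>M)"
    using AE by (intro nn_integral_cong_AE) (auto simp: mult.commute)
  finally show ?thesis .
qed

section \<open>The H-empirical measure\<close>

definition pattern :: "nat \<Rightarrow> (nat \<Rightarrow> 'v set) \<Rightarrow> 'v \<Rightarrow> nat set" where
  "pattern J Vs v = {j\<in>{1..J}. v \<in> Vs j}"

text \<open>Constancy on the regions lets the weights factor through the pattern. Patterns that no
  point of the union attains get weight zero: the bounds then hold for every \<open>t\<close>,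
  whereas the weights sum to one only at attained patterns.\<close>

lemma weight_function_pattern:
  assumes "weight_function J Vs \<rho>"
  obtains \<sigma> where
    "\<And>v j. v \<in> (\<Union>j\<in>{1..J}. Vs j) \<Longrightarrow> j \<in> {1..J} \<Longrightarrow> \<rho> j v = \<sigma> j (pattern J Vs v)"
    "\<And>j t. j \<in> {1..J} \<Longrightarrow> 0 \<le> \<sigma> j t \<and> \<sigma> j t \<le> 1"
    "\<And>j t. j \<in> {1..J} \<Longrightarrow> j \<notin> t \<Longrightarrow> \<sigma> j t = 0"
    "\<And>v. v \<in> (\<Union>j\<in>{1..J}. Vs j) \<Longrightarrow> (\<Sum>j=1..J. \<sigma> j (pattern J Vs v)) = 1"
proof -
  let ?U = "\<Union>j\<in>{1..J}. Vs j"
  define rep where "rep t = (SOME v. v \<in> ?U \<and> pattern J Vs v = t)" for t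
  define \<sigma> where "\<sigma> j t = (if \<exists>v. v \<in> ?U \<and> pattern J Vs v = t then \<rho> j (rep t) else 0)" for j t
  have rep: "rep t \<in> ?U" "pattern J Vs (rep t) = t" if "\<exists>v. v \<in> ?U \<and> pattern J Vs v = t" for t
    using someI_ex[OF that] by (auto simp: rep_def)
  have eq: "\<rho> j v = \<sigma> j (pattern J Vs v)" if v: "v \<in> ?U" and j: "j \<in> {1..J}" for v j
  proof -
    have ex: "\<exists>u. u \<in> ?U \<and> pattern J Vs u = pattern J Vs v" using v by blast
    define u where "u = rep (pattern J Vs v)"
    have u: "u \<in> ?U" "pattern J Vs u = pattern J Vs v"
      using rep[OF ex] by (auto simp: u_def)
    then have "\<forall>l\<in>{1..J}. v \<in> Vs l \<longleftrightarrow> u \<in> Vs l"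
      unfolding pattern_def by blast
    then have "\<rho> j v = \<rho> j (rep (pattern J Vs v))"
      using assms v j u(1) unfolding weight_function_def u_def[symmetric] by blast
    then show ?thesis using ex by (simp only: \<sigma>_def if_True)
  qed
  have w: "v \<in> ?U \<Longrightarrow> j \<in> {1..J} \<Longrightarrow> 0 \<le> \<rho> j v \<and> \<rho> j v \<le> 1"
    "v \<in> ?U \<Longrightarrow> j \<in> {1..J} \<Longrightarrow> v \<notin> Vs j \<Longrightarrow> \<rho> j v = 0"
    "v \<in> ?U \<Longrightarrow> (\<Sum>j=1..J. \<rho> j v) = 1" for v j
    using assms unfolding weight_function_def by blast+
  show thesis
  proof (rule that[of \<sigma>])
    show "\<rho> j v = \<sigma> j (pattern J Vs v)" if "v \<in> ?U" "j \<in> {1..J}" for v j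
      using eq that .
    show "0 \<le> \<sigma> j t \<and> \<sigma> j t \<le> 1" if "j \<in> {1..J}" for j t
    proof (cases "\<exists>v. v \<in> ?U \<and> pattern J Vs v = t")
      case True
      then show ?thesis
        unfolding \<sigma>_def if_P[OF True] by (intro w(1) rep(1) that)
    next
      case False
      then show ?thesis unfolding \<sigma>_def if_not_P[OF False] by simp
    qed
    show "\<sigma> j t = 0" if "j \<in> {1..J}" "j \<notin> t" for j t
    proof (cases "\<exists>v. v \<in> ?U \<and> pattern J Vs v = t")
      case True
      have "rep t \<notin> Vs j" using rep(2)[OF True] that unfolding pattern_def by blast
      then show ?thesis
        unfolding \<sigma>_def if_P[OF True] by (intro w(2) rep(1)[OF True] that)
    next
      case False
      then show ?thesis unfolding \<sigma>_def if_not_P[OF False] by simp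
    qed
    show "(\<Sum>j=1..J. \<sigma> j (pattern J Vs v)) = 1" if "v \<in> ?U" for v
    proof -
      have "(\<Sum>j=1..J. \<sigma> j (pattern J Vs v)) = (\<Sum>j=1..J. \<rho> j v)"
        using eq[OF that] by (intro sum.cong) auto
      then show ?thesis using w(3)[OF that] by simp
    qed
  qed
qed

section \<open>Deterministic decomposition of the error\<close>

text \<open>The three sums are the fluctuation of \<open>f\<close> around its stratum means over the
  selected units, the error of the weighted counts of selected units, and the error of the stratum
  frequencies. Only the first sees more of \<open>f\<close> than its stratum means. Terms with
  \<open>j\<close> outside \<open>t\<close> are dropped from the second sum because their weight is
  zero; nobody is selected there, so the count error would not be small.\<close>

lemma H_empirical_error_bound:
  fixes N J :: nat and v :: "nat \<Rightarrow> 'v" and x :: "nat \<Rightarrow> 'x"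
    and mu q :: "nat set \<Rightarrow> real" and f :: "'x \<Rightarrow> real"
    and k :: "nat \<Rightarrow> nat \<Rightarrow> nat" and r :: "nat \<Rightarrow> nat \<Rightarrow> bool"
  assumes weights: "weight_function J Vs \<rho>"
    and v: "\<And>i. i < N \<Longrightarrow> v i \<in> (\<Union>j\<in>{1..J}. Vs j)"
    and r: "\<And>i j. i < N \<Longrightarrow> j \<in> {1..J} \<Longrightarrow> r j i \<Longrightarrow> v i \<in> Vs j"
    and mu: "\<And>t. t \<in> Pow {1..J} \<Longrightarrow> \<bar>mu t\<bar> \<le> K"
  defines "\<kappa> \<equiv> \<lambda>j. real (card (units (Vs j) N v)) / real (k j (card (units (Vs j) N v)))"
    and "c \<equiv> \<lambda>t. real (card {i\<in>{..<N}. pattern J Vs (v i) = t})"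
    and "A \<equiv> \<lambda>j t. {i. i < N \<and> r j i \<and> pattern J Vs (v i) = t}"
  assumes C: "\<And>j. j \<in> {1..J} \<Longrightarrow> \<kappa> j \<le> C"
  shows "\<bar>H_empirical J Vs \<rho> k r N v x f - (\<Sum>t\<in>Pow {1..J}. q t * mu t)\<bar>
    \<le> C * (\<Sum>j=1..J. \<Sum>t\<in>Pow {1..J}. \<bar>(\<Sum>i\<in>A j t. f (x i) - mu t) / real N\<bar>)
      + K * (\<Sum>j=1..J. \<Sum>t\<in>Pow {1..J}. if j \<in> t then \<bar>\<kappa> j * real (card (A j t)) - c t\<bar> / real N else 0)
      + K * (\<Sum>t\<in>Pow {1..J}. \<bar>c t / real N - q t\<bar>)"
proof -
  let ?\<T> = "Pow {1..J}"
  let ?p = "\<lambda>i. pattern J Vs (v i)"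
  obtain \<sigma> where \<sigma>: "\<And>v j. v \<in> (\<Union>j\<in>{1..J}. Vs j) \<Longrightarrow> j \<in> {1..J} \<Longrightarrow> \<rho> j v = \<sigma> j (pattern J Vs v)"
      "\<And>j t. j \<in> {1..J} \<Longrightarrow> 0 \<le> \<sigma> j t \<and> \<sigma> j t \<le> 1"
      "\<And>j t. j \<in> {1..J} \<Longrightarrow> j \<notin> t \<Longrightarrow> \<sigma> j t = 0"
      "\<And>v. v \<in> (\<Union>j\<in>{1..J}. Vs j) \<Longrightarrow> (\<Sum>j=1..J. \<sigma> j (pattern J Vs v)) = 1"
    using weight_function_pattern[OF weights] by blast
  have p_in: "?p i \<in> ?\<T>" for i by (auto simp: pattern_def)
  \<comment> \<open>A selected unit lies in the source, so the indicator in the sampling probability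
    is one and its inverse is \<open>\<kappa> j\<close>; for an unselected unit both sides are
    zero.\<close>
  have summand: "of_bool (r j i) * \<rho> j (v i) / sampling_prob (Vs j) (k j) N v (v i) * f (x i)
      = of_bool (r j i) * (\<sigma> j (?p i) * \<kappa> j * f (x i))" if "i < N" "j \<in> {1..J}" for i j
    using r[OF that] \<sigma>(1)[OF v[OF that(1)] that(2)]
    by (auto simp: sampling_prob_def Let_def \<kappa>_def)
  have group: "(\<Sum>i<N. of_bool (r j i) * (\<sigma> j (?p i) * \<kappa> j * f (x i)))
      = (\<Sum>t\<in>?\<T>. \<sigma> j t * \<kappa> j * (\<Sum>i\<in>A j t. f (x i)))" for j
  proof -
    have "(\<Sum>i<N. of_bool (r j i) * (\<sigma> j (?p i) * \<kappa> j * f (x i)))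
        = (\<Sum>i\<in>{i. i < N \<and> r j i}. \<sigma> j (?p i) * \<kappa> j * f (x i))"
      by (rule sum.mono_neutral_cong_right) auto
    also have "\<dots> = (\<Sum>t\<in>?\<T>. \<Sum>i\<in>{i\<in>{i. i < N \<and> r j i}. ?p i = t}. \<sigma> j (?p i) * \<kappa> j * f (x i))"
      using p_in by (intro sum.group[symmetric]) auto
    also have "\<dots> = (\<Sum>t\<in>?\<T>. \<sigma> j t * \<kappa> j * (\<Sum>i\<in>A j t. f (x i)))"
      unfolding sum_distrib_left by (intro sum.cong refl) (auto simp: A_def)
    finally show ?thesis .
  qed
  have "H_empirical J Vs \<rho> k r N v x f
      = (\<Sum>i<N. \<Sum>j=1..J. of_bool (r j i) * (\<sigma> j (?p i) * \<kappa> j * f (x i))) / real N"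
    unfolding H_empirical_def
    by (intro arg_cong2[where f="(/)"] sum.cong refl summand) auto
  also have "\<dots> = (\<Sum>j=1..J. \<Sum>t\<in>?\<T>. \<sigma> j t * \<kappa> j * (\<Sum>i\<in>A j t. f (x i))) / real N"
    unfolding sum.swap[of _ _ "{..<N}"] group ..
  finally have H: "H_empirical J Vs \<rho> k r N v x f
      = (\<Sum>j=1..J. \<Sum>t\<in>?\<T>. \<sigma> j t * \<kappa> j * ((\<Sum>i\<in>A j t. f (x i)) / real N))"
    unfolding sum_divide_distrib[of _ "{1..J}"] sum_divide_distrib[of _ "Pow {1..J}"] by simp
  let ?a = "\<lambda>j t. (\<Sum>i\<in>A j t. f (x i) - mu t) / real N"
  let ?b = "\<lambda>j t. \<kappa> j * real (card (A j t)) - c t"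
  have split: "\<sigma> j t * \<kappa> j * ((\<Sum>i\<in>A j t. f (x i)) / real N)
      = \<sigma> j t * \<kappa> j * ?a j t + \<sigma> j t * mu t * (?b j t / real N) + \<sigma> j t * (mu t * c t / real N)" for j t
    by (simp add: sum_subtractf diff_divide_distrib algebra_simps)
  \<comment> \<open>An empty stratum contributes nothing; any other pattern is attained by some
    unit, and then the weights sum to one.\<close>
  have total: "(\<Sum>j=1..J. \<sigma> j t * (mu t * c t / real N)) = mu t * c t / real N" for t
  proof (cases "{i\<in>{..<N}. ?p i = t} = {}")
    case True
    then have "c t = 0" by (simp only: c_def card.empty of_nat_0)
    then show ?thesis by simp
  next
    case False
    then obtain i where "i < N" "?p i = t" by auto
    then have "(\<Sum>j=1..J. \<sigma> j t) = 1" using \<sigma>(4)[OF v] by blast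
    then show ?thesis by (simp flip: sum_distrib_right sum_divide_distrib)
  qed
  have "H_empirical J Vs \<rho> k r N v x f - (\<Sum>t\<in>?\<T>. q t * mu t)
      = (\<Sum>j=1..J. \<Sum>t\<in>?\<T>. \<sigma> j t * \<kappa> j * ?a j t)
        + (\<Sum>j=1..J. \<Sum>t\<in>?\<T>. \<sigma> j t * mu t * (?b j t / real N))
        + (\<Sum>t\<in>?\<T>. mu t * (c t / real N - q t))"
  proof -
    have "(\<Sum>j=1..J. \<Sum>t\<in>?\<T>. \<sigma> j t * (mu t * c t / real N)) = (\<Sum>t\<in>?\<T>. mu t * c t / real N)"
      by (subst sum.swap) (simp only: total)
    moreover have "(\<Sum>t\<in>?\<T>. mu t * (c t / real N - q t))
        = (\<Sum>t\<in>?\<T>. mu t * c t / real N) - (\<Sum>t\<in>?\<T>. q t * mu t)"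
      by (simp add: right_diff_distrib sum_subtractf mult.commute)
    ultimately show ?thesis
      unfolding H split sum.distrib by simp
  qed
  moreover have "\<bar>\<Sum>j=1..J. \<Sum>t\<in>?\<T>. \<sigma> j t * \<kappa> j * ?a j t\<bar> \<le> C * (\<Sum>j=1..J. \<Sum>t\<in>?\<T>. \<bar>?a j t\<bar>)"
    unfolding sum_distrib_left
  proof (intro order_trans[OF sum_abs] sum_mono)
    fix j t assume j: "j \<in> {1..J}"
    have "0 \<le> \<kappa> j" by (simp add: \<kappa>_def)
    then have "\<sigma> j t * \<kappa> j \<le> 1 * C"
      using \<sigma>(2)[OF j, of t] C[OF j] by (intro mult_mono) auto
    then have "\<sigma> j t * \<kappa> j * \<bar>?a j t\<bar> \<le> C * \<bar>?a j t\<bar>"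
      by (intro mult_right_mono) auto
    moreover have "\<bar>\<sigma> j t * \<kappa> j\<bar> = \<sigma> j t * \<kappa> j"
      using \<sigma>(2)[OF j, of t] \<open>0 \<le> \<kappa> j\<close> by simp
    ultimately show "\<bar>\<sigma> j t * \<kappa> j * ?a j t\<bar> \<le> C * \<bar>?a j t\<bar>"
      by (simp only: abs_mult[of _ "?a j t"])
  qed
  moreover have "\<bar>\<Sum>j=1..J. \<Sum>t\<in>?\<T>. \<sigma> j t * mu t * (?b j t / real N)\<bar>
      \<le> K * (\<Sum>j=1..J. \<Sum>t\<in>?\<T>. if j \<in> t then \<bar>?b j t\<bar> / real N else 0)"
    unfolding sum_distrib_left
  proof (intro order_trans[OF sum_abs] sum_mono)
    fix j t assume j: "j \<in> {1..J}" and t: "t \<in> ?\<T>"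
    have "\<bar>\<sigma> j t * mu t\<bar> \<le> 1 * K"
      unfolding abs_mult using \<sigma>(2)[OF j, of t] mu[OF t] by (intro mult_mono) auto
    then have "\<bar>\<sigma> j t * mu t\<bar> * \<bar>?b j t / real N\<bar> \<le> K * \<bar>?b j t / real N\<bar>"
      by (intro mult_right_mono) auto
    then show "\<bar>\<sigma> j t * mu t * (?b j t / real N)\<bar> \<le> K * (if j \<in> t then \<bar>?b j t\<bar> / real N else 0)"
      using \<sigma>(3)[OF j, of t] by (auto simp: abs_mult)
  qed
  moreover have "\<bar>\<Sum>t\<in>?\<T>. mu t * (c t / real N - q t)\<bar> \<le> K * (\<Sum>t\<in>?\<T>. \<bar>c t / real N - q t\<bar>)"
    unfolding sum_distrib_left
    by (intro order_trans[OF sum_abs] sum_mono) (simp add: abs_mult mult_right_mono mu)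
  ultimately show ?thesis by linarith
qed

lemma sum_pmf_le_1: "finite A \<Longrightarrow> (\<Sum>x\<in>A. pmf p x) \<le> 1"
  by (simp add: measure_measure_pmf_finite[symmetric])

text \<open>A variance of order \<open>N\<close> makes the relative error of order
  \<open>1 / sqrt N\<close>. In the constant, \<open>C\<close> comes from the second moment, at most
  \<open>C * N\<close>, and 1 from the remainder in \<open>young\<close>. The cut-off discards
  samples whose inverse fraction is undefined or large, for which there is no such bound.\<close>

lemma srs_count_error:
  assumes N: "N > 0" and I: "I \<subseteq> {..<N}" and k: "k \<le> card I" and L: "L \<subseteq> I"
  defines "r \<equiv> real (card I) / real k"
  shows "(\<Sum>S\<in>Pow {..<N}. ennreal (pmf (srs I k) S) *
      ennreal (if 0 < k \<and> r \<le> C then \<bar>r * real (card (S \<inter> L)) - real (card L)\<bar> / real N else 0))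
    \<le> ennreal ((C + 1) / sqrt (real N))"
proof (cases "0 < k \<and> r \<le> C")
  case True
  let ?s = "sqrt (real N)"
  let ?z = "\<lambda>S. r * real (card (S \<inter> L)) - real (card L)"
  have s: "?s > 0" "?s * ?s = real N" using N by auto
  have r0: "0 \<le> r" by (simp add: r_def)
  have cL: "real (card L) \<le> real N"
    using card_mono[of "{..<N}" L] I L by fastforce
  \<comment> \<open>Trades the first moment for the second one, which is of order \<open>N\<close>.\<close>
  have young: "\<bar>z\<bar> / real N \<le> z\<^sup>2 / (real N * ?s) + 1 / ?s" for z
  proof -
    have "\<bar>z\<bar> * ?s \<le> z\<^sup>2 + ?s\<^sup>2"
    proof -
      have "2 * \<bar>z\<bar> * ?s \<le> \<bar>z\<bar>\<^sup>2 + ?s\<^sup>2" by (rule sum_squares_bound)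
      moreover have "0 \<le> \<bar>z\<bar> * ?s" by simp
      ultimately show ?thesis unfolding power2_abs by linarith
    qed
    then have "\<bar>z\<bar> * ?s / (real N * ?s) \<le> (z\<^sup>2 + ?s\<^sup>2) / (real N * ?s)"
      using s N by (intro divide_right_mono) auto
    then show ?thesis
      using s N by (simp add: add_divide_distrib power2_eq_square)
  qed
  have "(\<Sum>S\<in>Pow {..<N}. ennreal (pmf (srs I k) S) * ennreal (\<bar>?z S\<bar> / real N))
      = ennreal (\<Sum>S\<in>Pow {..<N}. pmf (srs I k) S * (\<bar>?z S\<bar> / real N))"
    by (subst sum_ennreal[symmetric], simp) (intro sum.cong refl ennreal_mult[symmetric], simp_all)
  also have "\<dots> \<le> ennreal ((C + 1) / ?s)"
  proof (rule ennreal_leI)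
    have "(\<Sum>S\<in>Pow {..<N}. pmf (srs I k) S * (\<bar>?z S\<bar> / real N))
        \<le> (\<Sum>S\<in>Pow {..<N}. pmf (srs I k) S * ((?z S)\<^sup>2 / (real N * ?s) + 1 / ?s))"
      by (intro sum_mono mult_left_mono young) simp
    also have "\<dots> = (\<Sum>S\<in>Pow {..<N}. pmf (srs I k) S * (?z S)\<^sup>2) / (real N * ?s)
        + (\<Sum>S\<in>Pow {..<N}. pmf (srs I k) S) / ?s"
      by (simp add: distrib_left sum.distrib sum_divide_distrib)
    also have "\<dots> \<le> (C * real N) / (real N * ?s) + 1 / ?s"
    proof (intro add_mono divide_right_mono)
      have "(\<Sum>S\<in>Pow {..<N}. pmf (srs I k) S * (?z S)\<^sup>2) \<le> r * real (card L)"
        unfolding r_def using True k by (intro srs_second_moment_sum I L) auto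
      also have "\<dots> \<le> C * real N"
        using True cL r0 by (intro mult_mono) auto
      finally show "(\<Sum>S\<in>Pow {..<N}. pmf (srs I k) S * (?z S)\<^sup>2) \<le> C * real N" .
    qed (use s N in \<open>auto intro: sum_pmf_le_1\<close>)
    also have "\<dots> = (C + 1) / ?s"
      using s N by (simp add: add_divide_distrib)
    finally show "(\<Sum>S\<in>Pow {..<N}. pmf (srs I k) S * (\<bar>?z S\<bar> / real N)) \<le> (C + 1) / ?s" .
  qed
  finally show ?thesis using True by simp
qed (simp only: if_False, simp)

text \<open>Bounded means alone do not control the stratum means, since contributions of different
  strata may cancel in the overall mean; the envelope bounds the norms in L1.\<close>

lemma glivenko_cantelli_integral_abs_bounded:
  fixes P :: "'x measure"
  assumes P: "prob_space P" and GC: "glivenko_cantelli P F"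
    and bdd: "sup_norm F (\<lambda>f. \<integral>x. f x \<partial>P) < \<infinity>"
  obtains K where "\<And>f. f \<in> F \<Longrightarrow> (\<integral>x. \<bar>f x\<bar> \<partial>P) \<le> K"
proof -
  obtain E where E: "E \<in> borel_measurable P" "(\<integral>\<^sup>+x. E x \<partial>P) < \<infinity>"
    "\<And>x f. x \<in> space P \<Longrightarrow> f \<in> F \<Longrightarrow> ennreal \<bar>f x\<bar> \<le> E x"
    using gc_integrable_envelope[OF P GC bdd] by blast
  show thesis
  proof
    fix f assume f: "f \<in> F"
    then have "integrable P f" using GC by (auto simp: glivenko_cantelli_def)
    then have "(\<integral>x. \<bar>f x\<bar> \<partial>P) = enn2real (\<integral>\<^sup>+x. ennreal \<bar>f x\<bar> \<partial>P)"
      by (intro integral_eq_nn_integral) auto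
    also have "\<dots> \<le> enn2real (\<integral>\<^sup>+x. E x \<partial>P)"
      using E(2) by (intro enn2real_mono nn_integral_mono E(3) f) auto
    finally show "(\<integral>x. \<bar>f x\<bar> \<partial>P) \<le> enn2real (\<integral>\<^sup>+x. E x \<partial>P)" .
  qed
qed

section \<open>From the sampling design to selection given the strata\<close>

text \<open>The law of the whole sequence is identified first and then restricted, which treats
  every \<open>N\<close> at once, the empty sample included.\<close>

lemma (in prob_space) distr_iid_restrict:
  fixes N :: nat
  assumes indep: "indep_vars (\<lambda>_. S) W (UNIV :: nat set)" and law: "\<And>i. distr M S (W i) = P"
  shows "(\<lambda>\<omega>. \<lambda>i\<in>{..<N}. W i \<omega>) \<in> measurable M (PiM {..<N} (\<lambda>_. P))"
    and "distr M (PiM {..<N} (\<lambda>_. P)) (\<lambda>\<omega>. \<lambda>i\<in>{..<N}. W i \<omega>) = PiM {..<N} (\<lambda>_. P)"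
proof -
  have W: "W i \<in> measurable M S" for i
    using indep by (auto simp: indep_vars_def)
  have sets: "sets P = sets S"
    using law[of 0] by (metis sets_distr)
  have WP[measurable]: "W i \<in> measurable M P" for i
    using W measurable_cong_sets[OF refl sets] by blast
  show m: "(\<lambda>\<omega>. \<lambda>i\<in>{..<N}. W i \<omega>) \<in> measurable M (PiM {..<N} (\<lambda>_. P))"
    by (rule measurable_restrict) simp
  interpret P: prob_space P
    using prob_space_distr[OF W[of 0]] law[of 0] by simp
  interpret PP: product_prob_space "\<lambda>_. P" "UNIV :: nat set" ..
  let ?S = "PiM (UNIV::nat set) (\<lambda>_. P)"
  have mU: "(\<lambda>\<omega> i. W i \<omega>) \<in> measurable M ?S"
    by (rule measurable_PiM_single') (use measurable_space[OF WP] in auto)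
  have sS: "sets (PiM (UNIV::nat set) (\<lambda>_. S)) = sets ?S"
    by (intro sets_PiM_cong) (auto simp: sets)
  have "distr M ?S (\<lambda>\<omega> i. W i \<omega>) = distr M (PiM (UNIV::nat set) (\<lambda>_. S)) (\<lambda>\<omega>. \<lambda>i\<in>UNIV. W i \<omega>)"
    by (intro distr_cong) (auto simp: sS)
  also have "\<dots> = ?S"
    using indep_vars_iff_distr_eq_PiM'[where I=UNIV and M'="\<lambda>_. S" and X=W] W indep by (simp add: law)
  finally have U: "distr M ?S (\<lambda>\<omega> i. W i \<omega>) = ?S" .
  have "distr M (PiM {..<N} (\<lambda>_. P)) (\<lambda>\<omega>. \<lambda>i\<in>{..<N}. W i \<omega>)
      = distr (distr M ?S (\<lambda>\<omega> i. W i \<omega>)) (PiM {..<N} (\<lambda>_. P)) (\<lambda>x. restrict x {..<N})"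
    by (subst distr_distr[OF _ mU]) (auto intro: measurable_restrict_subset simp: comp_def)
  also have "\<dots> = PiM {..<N} (\<lambda>_. P)"
    unfolding U by (intro PP.distr_PiM_restrict_finite) auto
  finally show "distr M (PiM {..<N} (\<lambda>_. P)) (\<lambda>\<omega>. \<lambda>i\<in>{..<N}. W i \<omega>) = PiM {..<N} (\<lambda>_. P)" .
qed

text \<open>Unit \<open>i\<close> belongs to source \<open>j\<close> exactly when \<open>j\<close>
  is an element of its pattern. The units of the source, their number, the sample size and hence the
  conditional law of the selected set can therefore all be read off the stratum vector.\<close>

lemma design_stratified_selection:
  fixes P :: "'w measure" and c :: "'w \<Rightarrow> 'v" and J :: nat and Vs :: "nat \<Rightarrow> 'v set"
  assumes M: "prob_space M" and strata: "strata P (\<lambda>w. pattern J Vs (c w)) (Pow {1..J})"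
    and sets: "sets P = sets S" and indep: "prob_space.indep_vars M (\<lambda>_. S) W UNIV"
    and law: "\<And>i. distr M S (W i) = P"
    and design: "multi_source_design M (data_algebra M S W N) J Vs N (\<lambda>i \<omega>. c (W i \<omega>)) k r"
    and j: "j \<in> {1..J}"
  shows "stratified_selection P (\<lambda>w. pattern J Vs (c w)) (Pow {1..J}) M N (\<lambda>\<omega>. \<lambda>i\<in>{..<N}. W i \<omega>)
    (\<lambda>\<omega>. {i. i < N \<and> r j i \<omega>})
    (\<lambda>\<tau> S. ennreal (pmf (srs {i. i < N \<and> j \<in> \<tau> i} (k j (card {i. i < N \<and> j \<in> \<tau> i}))) S))"
proof -
  interpret M: prob_space M by (rule M)
  interpret strata P "\<lambda>w. pattern J Vs (c w)" "Pow {1..J}" by (rule strata)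
  let ?W = "\<lambda>\<omega>. \<lambda>i\<in>{..<N}. W i \<omega>"
  let ?G = "data_algebra M S W N"
  let ?sel = "\<lambda>\<omega>. {i. i < N \<and> r j i \<omega>}"
  let ?g = "\<lambda>\<tau> S. pmf (srs {i. i < N \<and> j \<in> \<tau> i} (k j (card {i. i < N \<and> j \<in> \<tau> i}))) S"
  note W_meas = M.distr_iid_restrict(1)[OF indep law, of N]
  have "j \<in> types N (?W \<omega>) i \<longleftrightarrow> c (W i \<omega>) \<in> Vs j" if "i < N" for i \<omega>
    unfolding types_def using j that by (simp add: pattern_def)
  then have units: "units (Vs j) N (\<lambda>i. c (W i \<omega>)) = {i. i < N \<and> j \<in> types N (?W \<omega>) i}" for \<omega>
    by (auto simp: units_def)
  have r_meas: "r j i \<in> measurable M (count_space UNIV)" if "i < N" for i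
    using design j that unfolding multi_source_design_def Let_def by blast
  have sel_meas: "{\<omega> \<in> space M. ?sel \<omega> = A} \<in> sets M" for A
  proof (cases "A \<subseteq> {..<N}")
    case True
    then have "{\<omega> \<in> space M. ?sel \<omega> = A} = {\<omega> \<in> space M. \<forall>i\<in>{..<N}. r j i \<omega> = (i \<in> A)}"
      by auto
    also have "\<dots> \<in> sets M"
    proof (intro sets.sets_Collect_finite_All)
      fix i assume "i \<in> {..<N}"
      then show "{\<omega> \<in> space M. r j i \<omega> = (i \<in> A)} \<in> sets M"
        using measurable_sets[OF r_meas, of i "{i \<in> A}"] by (simp add: vimage_def Int_def conj_commute)
    qed simp
    finally show ?thesis .
  next
    case False
    then have "{\<omega> \<in> space M. ?sel \<omega> = A} = {}" by auto
    then show ?thesis by (simp only: sets.empty_sets)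
  qed
  have setsN: "sets (PiM {..<N} (\<lambda>_. S)) = sets (PiM {..<N} (\<lambda>_. P))"
    by (intro sets_PiM_cong) (auto simp: sets)
  have W_S: "?W \<in> measurable M (PiM {..<N} (\<lambda>_. S))"
    using W_meas measurable_cong_sets[OF refl setsN] by blast
  have sub: "subalgebra M ?G"
    unfolding subalgebra_def data_algebra_def
    using W_S measurable_space[OF W_S]
    by (auto simp: sets_vimage_algebra2 Pi_iff dest: measurable_sets)
  show ?thesis
  proof unfold_locales
    show "?W \<in> measurable M (PiM {..<N} (\<lambda>_. P))" by (rule W_meas)
    show "distr M (PiM {..<N} (\<lambda>_. P)) ?W = PiM {..<N} (\<lambda>_. P)"
      by (rule M.distr_iid_restrict(2)[OF indep law])
    show "?sel \<omega> \<subseteq> {..<N}" for \<omega> by auto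
    show "{\<omega> \<in> space M. ?sel \<omega> = A} \<in> sets M" for A by (rule sel_meas)
    show "(\<Sum>A\<in>Pow {..<N}. ennreal (?g \<tau> A)) \<le> 1" for \<tau>
      using sum_pmf_le_1[of "Pow {..<N}"] by (subst sum_ennreal) auto
  next
    fix A and h :: "(nat \<Rightarrow> 'w) \<Rightarrow> ennreal"
    assume h: "h \<in> borel_measurable (PiM {..<N} (\<lambda>_. P))"
    have h': "h \<in> borel_measurable (PiM {..<N} (\<lambda>_. S))"
      using h measurable_cong_sets[OF setsN refl] by blast
    have "?W \<in> measurable ?G (PiM {..<N} (\<lambda>_. S))"
      unfolding data_algebra_def using measurable_space[OF W_S]
      by (intro measurable_vimage_algebra1) auto
    then have hG: "(\<lambda>\<omega>. h (?W \<omega>)) \<in> borel_measurable ?G"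
      using h' by (rule measurable_compose)
    let ?u = "\<lambda>\<omega>. units (Vs j) N (\<lambda>i. c (W i \<omega>))"
    have "AE \<omega> in M. cond_prob_alg M ?G (\<lambda>\<omega>'. ?sel \<omega>' = A) \<omega> = pmf (srs (?u \<omega>) (k j (card (?u \<omega>)))) A"
      using design j unfolding multi_source_design_def Let_def by blast
    then have AE: "AE \<omega> in M. cond_prob_alg M ?G (\<lambda>\<omega>'. ?sel \<omega>' = A) \<omega> = ?g (types N (?W \<omega>)) A"
      unfolding units .
    show "(\<integral>\<^sup>+\<omega>. indicator {\<omega> \<in> space M. ?sel \<omega> = A} \<omega> * h (?W \<omega>) \<partial>M)
        = (\<integral>\<^sup>+\<omega>. ennreal (?g (types N (?W \<omega>)) A) * h (?W \<omega>) \<partial>M)"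
      by (rule nn_integral_cond_prob_alg[where Q = "\<lambda>\<omega>. ?sel \<omega> = A", OF M sub sel_meas AE hG])
  qed
qed

section \<open>Uniform law of large numbers for the H-empirical measure\<close>

theorem theorem3p1:
  fixes M :: "'o measure"
    and Xs :: "'x measure" and Us :: "'u measure" and Cs :: "'c measure"
    and Pt :: "('x \<times> 'u) measure" and P0 :: "'x measure"
    and W :: "nat \<Rightarrow> 'o \<Rightarrow> 'x \<times> 'u" and X :: "nat \<Rightarrow> 'o \<Rightarrow> 'x" and V :: "nat \<Rightarrow> 'o \<Rightarrow> 'c \<times> 'u"
    and chi :: "'x \<Rightarrow> 'c"
    and J :: nat and Vs :: "nat \<Rightarrow> ('c \<times> 'u) set" and \<rho> :: "nat \<Rightarrow> 'c \<times> 'u \<Rightarrow> real"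
    and n :: "nat \<Rightarrow> nat \<Rightarrow> nat \<Rightarrow> nat" and R :: "nat \<Rightarrow> nat \<Rightarrow> nat \<Rightarrow> 'o \<Rightarrow> bool"
    and p :: "nat \<Rightarrow> real" and c :: real
    and F :: "('x \<Rightarrow> real) set"
  defines "P0 \<equiv> distr Pt Xs fst"
    and "X \<equiv> \<lambda>i \<omega>. fst (W i \<omega>)"
    and "V \<equiv> \<lambda>i \<omega>. coarse_obs chi (W i \<omega>)"
  assumes "prob_space M" and "prob_space Pt" and "sets Pt = sets (Xs \<Otimes>\<^sub>M Us)"
    and coarsening: "chi \<in> measurable Xs Cs"
    and sources: "\<forall>j\<in>{1..J}. Vs j \<in> sets (Cs \<Otimes>\<^sub>M Us)"
    and cover: "\<forall>w\<in>space (Xs \<Otimes>\<^sub>M Us). coarse_obs chi w \<in> (\<Union>j\<in>{1..J}. Vs j)"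
    and overlap: "\<exists>j\<in>{1..J}. \<exists>l\<in>{1..J}. j \<noteq> l \<and> Vs j \<inter> Vs l \<noteq> {}"
    and weights: "weight_function J Vs \<rho>"
    and indep: "prob_space.indep_vars M (\<lambda>_. Xs \<Otimes>\<^sub>M Us) W UNIV"
    and law: "\<forall>i. distr M (Xs \<Otimes>\<^sub>M Us) (W i) = Pt"
    and design: "\<forall>N. multi_source_design M (data_algebra M (Xs \<Otimes>\<^sub>M Us) W N) J Vs N V (n N) (R N)"
    and fractions: "\<forall>j\<in>{1..J}. outer_prob_null M
          (\<lambda>N \<omega>. let m = card (units (Vs j) N (\<lambda>i. V i \<omega>))
                 in ennreal \<bar>real (n N j m) / real m - p j\<bar>)"
    and "c > 0" and "\<forall>j\<in>{1..J}. p j \<ge> c"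
    and measurable_class: "F \<subseteq> borel_measurable Xs"
    and GC: "glivenko_cantelli P0 F"
    and bounded_P0: "sup_norm F (\<lambda>f. \<integral>x. f x \<partial>P0) < \<infinity>"
  shows "outer_prob_null M
    (\<lambda>N \<omega>. sup_norm F (\<lambda>f.
       H_empirical J Vs \<rho> (n N) (\<lambda>j i. R N j i \<omega>) N (\<lambda>i. V i \<omega>) (\<lambda>i. X i \<omega>) f
       - (\<integral>w. f (fst w) \<partial>Pt)))"
proof -
  let ?S = "Xs \<Otimes>\<^sub>M Us" and ?\<T> = "Pow {1..J}"
  let ?T = "\<lambda>w. pattern J Vs (coarse_obs chi w)"
  interpret M: prob_space M by fact
  have sets_Pt[measurable_cong]: "sets Pt = sets ?S" by fact
  have space_Pt: "space Pt = space ?S" using sets_eq_imp_space_eq[OF sets_Pt] .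
  have law': "distr M ?S (W i) = Pt" for i using law by blast
  have W_meas: "W i \<in> measurable M ?S" for i
    using indep by (auto simp: M.indep_vars_def)
  have fst_meas: "fst \<in> measurable Pt Xs"
    using measurable_cong_sets[OF sets_Pt refl] by auto
  have coarse: "coarse_obs chi \<in> measurable ?S (Cs \<Otimes>\<^sub>M Us)"
    unfolding coarse_obs_def[abs_def] using coarsening by measurable
  have strata: "strata Pt ?T ?\<T>"
  proof (intro strata.intro strata_axioms.intro)
    show "?T \<in> measurable Pt (count_space ?\<T>)"
    proof (subst measurable_count_space_eq2, simp, intro conjI ballI)
      show "?T \<in> space Pt \<rightarrow> ?\<T>" by (auto simp: pattern_def)
      fix t assume t: "t \<in> ?\<T>"
      have "pattern J Vs v = t \<longleftrightarrow> (\<forall>j\<in>{1..J}. (v \<in> Vs j) = (j \<in> t))" for v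
        using t unfolding pattern_def by blast
      then have "?T -` {t} \<inter> space Pt = {w \<in> space ?S. \<forall>j\<in>{1..J}. (coarse_obs chi w \<in> Vs j) = (j \<in> t)}"
        unfolding space_Pt by blast
      also have "\<dots> \<in> sets ?S"
      proof (intro sets.sets_Collect_finite_All)
        fix j assume j: "j \<in> {1..J}"
        have "{w \<in> space ?S. coarse_obs chi w \<in> Vs j} \<in> sets ?S"
          using measurable_sets[OF coarse, of "Vs j"] sources j
          by (simp add: vimage_def Int_def conj_commute)
        then show "{w \<in> space ?S. (coarse_obs chi w \<in> Vs j) = (j \<in> t)} \<in> sets ?S"
          by (cases "j \<in> t") (auto intro: sets.sets_Collect_neg)
      qed simp
      finally show "?T -` {t} \<inter> space Pt \<in> sets Pt" by (simp add: sets_Pt)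
    qed
  qed (simp_all add: \<open>prob_space Pt\<close>)
  interpret strata Pt ?T ?\<T> by (rule strata)
  let ?F = "(\<lambda>f. f \<circ> fst) ` F"
  have GC': "glivenko_cantelli Pt ?F"
    using GC unfolding P0_def by (rule glivenko_cantelli_distr[OF \<open>prob_space Pt\<close> fst_meas])
  have bounded: "sup_norm ?F (\<lambda>f. \<integral>w. f w \<partial>Pt) < \<infinity>"
  proof -
    have "sup_norm ?F (\<lambda>f. \<integral>w. f w \<partial>Pt) = sup_norm F (\<lambda>f. \<integral>x. f x \<partial>P0)"
      unfolding sup_norm_image unfolding sup_norm_def P0_def
      using measurable_class by (intro SUP_cong refl) (subst integral_distr[OF fst_meas], auto simp: comp_def)
    with bounded_P0 show ?thesis by simp
  qed
  have intF: "integrable Pt f" if "f \<in> ?F" for f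
    using GC' that by (auto simp: glivenko_cantelli_def)
  obtain K0 where K0: "\<And>f. f \<in> ?F \<Longrightarrow> (\<integral>w. \<bar>f w\<bar> \<partial>Pt) \<le> K0"
    using glivenko_cantelli_integral_abs_bounded[OF \<open>prob_space Pt\<close> GC' bounded] by blast
  obtain K where K: "0 \<le> K" "\<And>f t. f \<in> ?F \<Longrightarrow> t \<in> ?\<T> \<Longrightarrow> \<bar>\<integral>w. f w \<partial>Q t\<bar> \<le> K"
    using integral_Q_bounded[of ?F K0, OF intF K0] by blast
  obtain D where D: "\<And>N. D N \<in> borel_measurable (PiM {..<N} (\<lambda>_. Pt))"
    "\<And>N x f. x \<in> space (PiM {..<N} (\<lambda>_. Pt)) \<Longrightarrow> f \<in> ?F \<Longrightarrow>
       ennreal \<bar>empirical N x f - (\<integral>y. f y \<partial>Pt)\<bar> \<le> D N x"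
    "(\<lambda>N. \<integral>\<^sup>+x. D N x \<partial>PiM {..<N} (\<lambda>_. Pt)) \<longlonglongrightarrow> 0"
    using gc_majorants[OF \<open>prob_space Pt\<close> GC' bounded] by blast
  define w where "w N \<omega> = (\<lambda>i\<in>{..<N}. W i \<omega>)" for N :: nat and \<omega>
  define A where "A N j \<omega> = {i. i < N \<and> R N j i \<omega>}" for N j \<omega>
  define I where "I N j \<tau> = {i. i < N \<and> j \<in> \<tau> i}" for N j :: nat and \<tau> :: "nat \<Rightarrow> nat set"
  define g where "g N j \<tau> B = ennreal (pmf (srs (I N j \<tau>) (n N j (card (I N j \<tau>)))) B)" for N j \<tau> B
  have sel: "stratified_selection Pt ?T ?\<T> M N (w N) (A N j) (g N j)" if "j \<in> {1..J}" for N j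
    using design_stratified_selection[OF \<open>prob_space M\<close> strata sets_Pt indep law' _ that, of N "n N" "R N"] design
    unfolding w_def A_def g_def I_def V_def by blast
  have w_space: "w N \<omega> \<in> space (PiM {..<N} (\<lambda>_. Pt))" if "\<omega> \<in> space M" for N \<omega>
    using measurable_space[OF W_meas that] by (auto simp: w_def space_PiM space_Pt)
  have types_w: "types N (w N \<omega>) i = pattern J Vs (V i \<omega>)" if "i < N" for N i \<omega>
    using that by (simp add: types_def w_def V_def)

  \<comment> \<open>A sampling fraction within \<open>c / 2\<close> of a limit that is at least
    \<open>c\<close> is itself at least \<open>c / 2\<close>, so the inverse fractions are at most
    \<open>2 / c\<close>.\<close>
  define C where "C = 2 / c"
  have "C > 0" using \<open>c > 0\<close> by (simp add: C_def)
  define Y where "Y j t N \<omega> = resampled N (D N) (types N (w N \<omega>)) {i \<in> A N j \<omega>. types N (w N \<omega>) i = t} (w N \<omega>)"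
    for j t N \<omega>
  \<comment> \<open>The cut-off is expressed through \<open>\<tau>\<close> alone, so
    \<open>E\<close> is a function of the strata and the selected set and its mean can be bounded
    for each stratum vector.\<close>
  define E where "E N j t \<tau> B = (let r = real (card (I N j \<tau>)) / real (n N j (card (I N j \<tau>))) in
      if 0 < n N j (card (I N j \<tau>)) \<and> r \<le> C \<and> j \<in> t
      then \<bar>r * real (card {i\<in>B. \<tau> i = t}) - real (card {i\<in>{..<N}. \<tau> i = t})\<bar> / real N else 0)"
    for N j t \<tau> B
  define Z where "Z j t N \<omega> = ennreal (E N j t (types N (w N \<omega>)) (A N j \<omega>))" for j t N \<omega>

  have Y_null: "outer_prob_null M (Y j t)" if j: "j \<in> {1..J}" for j t
  proof (rule outer_prob_null_nn_integral)
    fix N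
    interpret stratified_selection Pt ?T ?\<T> M N "w N" "A N j" "g N j" by (rule sel[OF j])
    show "Y j t N \<in> borel_measurable M"
      unfolding Y_def by (rule nn_integral_resampled_selection(1)[OF D(1)])
  next
    show "(\<lambda>N. \<integral>\<^sup>+\<omega>. Y j t N \<omega> \<partial>M) \<longlonglongrightarrow> 0"
    proof (rule tendsto_zero_le_ennreal[OF D(3)], intro always_eventually allI)
      fix N
      interpret stratified_selection Pt ?T ?\<T> M N "w N" "A N j" "g N j" by (rule sel[OF j])
      show "(\<integral>\<^sup>+\<omega>. Y j t N \<omega> \<partial>M) \<le> (\<integral>\<^sup>+x. D N x \<partial>PiM {..<N} (\<lambda>_. Pt))"
        unfolding Y_def by (rule nn_integral_resampled_selection(2)[OF D(1)])
    qed
  qed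

  have Z_le: "(\<Sum>B\<in>Pow {..<N}. g N j \<tau> B * ennreal (E N j t \<tau> B)) \<le> ennreal ((C + 1) / sqrt (real N))"
    if "N > 0" "j \<in> {1..J}" for N j t \<tau>
  proof (cases "j \<in> t")
    case True
    let ?I = "I N j \<tau>" and ?L = "{i\<in>{..<N}. \<tau> i = t}"
    have sub: "?I \<subseteq> {..<N}" "?L \<subseteq> ?I" using True by (auto simp: I_def)
    have k: "n N j (card ?I) \<le> card ?I"
      using design that(2) unfolding multi_source_design_def Let_def by blast
    have "(\<Sum>B\<in>Pow {..<N}. g N j \<tau> B * ennreal (E N j t \<tau> B))
        = (\<Sum>B\<in>Pow {..<N}. ennreal (pmf (srs ?I (n N j (card ?I))) B) *
           ennreal (if 0 < n N j (card ?I) \<and> real (card ?I) / real (n N j (card ?I)) \<le> C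
             then \<bar>real (card ?I) / real (n N j (card ?I)) * real (card (B \<inter> ?L)) - real (card ?L)\<bar> / real N else 0))"
    proof (intro sum.cong refl)
      fix B assume "B \<in> Pow {..<N}"
      then have "{i\<in>B. \<tau> i = t} = B \<inter> ?L" by auto
      then show "g N j \<tau> B * ennreal (E N j t \<tau> B) = ennreal (pmf (srs ?I (n N j (card ?I))) B) *
           ennreal (if 0 < n N j (card ?I) \<and> real (card ?I) / real (n N j (card ?I)) \<le> C
             then \<bar>real (card ?I) / real (n N j (card ?I)) * real (card (B \<inter> ?L)) - real (card ?L)\<bar> / real N else 0)"
        unfolding E_def Let_def g_def using True by (simp only: simp_thms)
    qed
    also have "\<dots> \<le> ennreal ((C + 1) / sqrt (real N))"
      by (rule srs_count_error[OF that(1) sub(1) k sub(2)])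
    finally show ?thesis .
  next
    case False
    then show ?thesis by (simp add: E_def Let_def)
  qed

  have Z_null: "outer_prob_null M (Z j t)" if j: "j \<in> {1..J}" for j t
  proof -
    have meas: "Z j t N \<in> borel_measurable M" "(\<integral>\<^sup>+\<omega>. Z j t N \<omega> \<partial>M) \<le> ennreal ((C + 1) / sqrt (real N))"
      if "N > 0" for N
    proof -
      interpret stratified_selection Pt ?T ?\<T> M N "w N" "A N j" "g N j" by (rule sel[OF j])
      show "Z j t N \<in> borel_measurable M" "(\<integral>\<^sup>+\<omega>. Z j t N \<omega> \<partial>M) \<le> ennreal ((C + 1) / sqrt (real N))"
        unfolding Z_def
        using nn_integral_count_selection[of "\<lambda>\<tau> B. ennreal (E N j t \<tau> B)", OF Z_le[OF that j]] by auto
    qed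
    \<comment> \<open>The bound \<open>Z_le\<close> is for nonempty samples; replacing the value at
      \<open>N = 0\<close> does not affect the limit.\<close>
    let ?Z = "\<lambda>N. if N = 0 then (\<lambda>_. 0) else Z j t N"
    have "outer_prob_null M ?Z"
    proof (rule outer_prob_null_nn_integral)
      show "?Z N \<in> borel_measurable M" for N using meas(1)[of N] by auto
      have "(\<lambda>N. (C + 1) / sqrt (real N)) \<longlonglongrightarrow> 0"
        by real_asymp
      then have "(\<lambda>N. ennreal ((C + 1) / sqrt (real N))) \<longlonglongrightarrow> 0"
        using tendsto_ennrealI by fastforce
      then show "(\<lambda>N. \<integral>\<^sup>+\<omega>. ?Z N \<omega> \<partial>M) \<longlonglongrightarrow> 0"
        by (rule tendsto_zero_le_ennreal) (use meas(2) in auto)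
    qed
    then show ?thesis
      by (rule outer_prob_null_mono[where bad="\<lambda>_. {}"]) auto
  qed

  have dev_null: "outer_prob_null M (\<lambda>N \<omega>. ennreal (deviation N (w N \<omega>)))"
  proof -
    have "outer_prob_null M (\<lambda>N \<omega>. \<Sum>t\<in>?\<T>.
        ennreal \<bar>real (card {i\<in>{..<N}. W i \<omega> \<in> stratum t}) / real N - measure Pt (stratum t)\<bar>)"
      using stratum_sets by (intro outer_prob_null_sum M.outer_prob_null_frequency[OF indep law']) (auto simp: sets_Pt)
    then show ?thesis
    proof (rule outer_prob_null_mono[where bad="\<lambda>_. {}"])
      fix N :: nat and \<omega> assume \<omega>: "\<omega> \<in> space M"
      have "{i\<in>{..<N}. W i \<omega> \<in> stratum t} = {i\<in>{..<N}. ?T (w N \<omega> i) = t}" for t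
        using measurable_space[OF W_meas \<omega>] by (auto simp: stratum_def w_def space_Pt)
      then show "ennreal (deviation N (w N \<omega>)) \<le> (\<Sum>t\<in>?\<T>.
        ennreal \<bar>real (card {i\<in>{..<N}. W i \<omega> \<in> stratum t}) / real N - measure Pt (stratum t)\<bar>)"
        unfolding deviation_def q_def by (simp add: sum_ennreal)
    qed auto
  qed

  define frac where "frac j N \<omega> = (let m = card (units (Vs j) N (\<lambda>i. V i \<omega>))
      in ennreal \<bar>real (n N j m) / real m - p j\<bar>)" for j N \<omega>
  \<comment> \<open>Summing over the finitely many sources controls all fractions by one event; the
    threshold matches the choice of \<open>C\<close>.\<close>
  define bad where "bad N = {\<omega> \<in> space M. (\<Sum>j=1..J. frac j N \<omega>) > ennreal (c / 2)}" for N
  have bad: "(\<lambda>N. outer_measure_of M (bad N)) \<longlonglongrightarrow> 0"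
    unfolding bad_def using fractions \<open>c > 0\<close>
    by (intro outer_prob_nullD outer_prob_null_sum) (auto simp: frac_def)

  let ?X = "\<lambda>N \<omega>. ennreal C * (\<Sum>j=1..J. \<Sum>t\<in>?\<T>. Y j t N \<omega> + ennreal K * ennreal (deviation N (w N \<omega>)))
      + ennreal K * (\<Sum>j=1..J. \<Sum>t\<in>?\<T>. Z j t N \<omega>) + ennreal K * ennreal (deviation N (w N \<omega>))"
  have "outer_prob_null M ?X"
    by (intro outer_prob_null_add outer_prob_null_cmult outer_prob_null_sum Y_null Z_null dev_null) auto
  then show ?thesis
  proof (rule outer_prob_null_mono[where bad=bad])
    show "bad N \<subseteq> space M" for N by (auto simp: bad_def)
    show "(\<lambda>N. outer_measure_of M (bad N)) \<longlonglongrightarrow> 0" by (rule bad)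
  next
    fix N :: nat and \<omega> assume N: "N > 0" and \<omega>: "\<omega> \<in> space M" "\<omega> \<notin> bad N"
    let ?m = "\<lambda>j. card (units (Vs j) N (\<lambda>i. V i \<omega>))"
    let ?\<tau> = "types N (w N \<omega>)"
    let ?\<kappa> = "\<lambda>j. real (?m j) / real (n N j (?m j))"
    \<comment> \<open>An empty source, or one without selected units, has fraction zero by the
      convention for division, at distance \<open>p j \<ge> c\<close> from its limit, so off
      \<open>bad N\<close> this cannot occur.\<close>
    have good: "0 < n N j (?m j) \<and> ?\<kappa> j \<le> C" if j: "j \<in> {1..J}" for j
    proof -
      have "frac j N \<omega> \<le> (\<Sum>j=1..J. frac j N \<omega>)"
        using j by (intro member_le_sum) auto
      also have "\<dots> \<le> ennreal (c / 2)"
        using \<omega> by (auto simp: bad_def not_less)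
      finally have "\<bar>real (n N j (?m j)) / real (?m j) - p j\<bar> \<le> c / 2"
        using \<open>c > 0\<close> by (simp add: frac_def Let_def)
      moreover have "p j \<ge> c" using j \<open>\<forall>j\<in>{1..J}. p j \<ge> c\<close> by blast
      ultimately have le: "c / 2 \<le> real (n N j (?m j)) / real (?m j)" by linarith
      then have pos: "0 < real (n N j (?m j)) / real (?m j)" using \<open>c > 0\<close> by linarith
      then have "0 < n N j (?m j)" "0 < ?m j"
        by (auto simp: zero_less_divide_iff)
      with le show ?thesis
        using \<open>c > 0\<close> by (simp add: C_def field_simps)
    qed
    have "j \<in> ?\<tau> i \<longleftrightarrow> V i \<omega> \<in> Vs j" if "i < N" "j \<in> {1..J}" for i j
      unfolding types_w[OF that(1)] using that(2) by (simp add: pattern_def)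
    then have I: "I N j ?\<tau> = units (Vs j) N (\<lambda>i. V i \<omega>)" if "j \<in> {1..J}" for j
      using that by (auto simp: I_def units_def)
    have A_eq: "{i. i < N \<and> R N j i \<omega> \<and> pattern J Vs (V i \<omega>) = t} = {i \<in> A N j \<omega>. ?\<tau> i = t}" for j t
      using types_w[of _ N \<omega>] by (auto simp: A_def)
    have card_eq: "{i\<in>{..<N}. pattern J Vs (V i \<omega>) = t} = {i\<in>{..<N}. ?\<tau> i = t}" for t
      using types_w[of _ N \<omega>] by auto
    have dev: "deviation N (w N \<omega>) = (\<Sum>t\<in>?\<T>. \<bar>real (card {i\<in>{..<N}. ?\<tau> i = t}) / real N - q t\<bar>)"
      unfolding deviation_def by (intro sum.cong refl arg_cong[where f=abs] arg_cong2[where f="(-)"]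
          arg_cong2[where f="(/)"] arg_cong[where f=real] arg_cong[where f=card]) (auto simp: types_def)
    show "sup_norm F (\<lambda>f. H_empirical J Vs \<rho> (n N) (\<lambda>j i. R N j i \<omega>) N (\<lambda>i. V i \<omega>) (\<lambda>i. X i \<omega>) f
       - (\<integral>w. f (fst w) \<partial>Pt)) \<le> ?X N \<omega>"
    proof (rule sup_norm_least)
      fix f assume "f \<in> F"
      then have f: "f \<circ> fst \<in> ?F" by auto
      let ?f = "f \<circ> fst"
      let ?mu = "\<lambda>t. \<integral>w. ?f w \<partial>Q t"
      let ?dev = "deviation N (w N \<omega>)"
      let ?B = "\<lambda>j t. {i \<in> A N j \<omega>. ?\<tau> i = t}"
      have dev0: "0 \<le> ?dev" unfolding deviation_def by (simp add: sum_nonneg)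
      have "(\<integral>w. f (fst w) \<partial>Pt) = (\<Sum>t\<in>?\<T>. q t * ?mu t)"
        unfolding sum_strata_integral[OF intF[OF f]] by (simp add: comp_def)
      then have "\<bar>H_empirical J Vs \<rho> (n N) (\<lambda>j i. R N j i \<omega>) N (\<lambda>i. V i \<omega>) (\<lambda>i. X i \<omega>) f - (\<integral>w. f (fst w) \<partial>Pt)\<bar>
        \<le> C * (\<Sum>j=1..J. \<Sum>t\<in>?\<T>. \<bar>(\<Sum>i\<in>?B j t. f (X i \<omega>) - ?mu t) / real N\<bar>)
          + K * (\<Sum>j=1..J. \<Sum>t\<in>?\<T>. if j \<in> t then
              \<bar>?\<kappa> j * real (card (?B j t)) - real (card {i\<in>{..<N}. ?\<tau> i = t})\<bar> / real N else 0)
          + K * ?dev"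
        unfolding dev A_eq[symmetric] card_eq[symmetric]
      proof (simp only:, intro H_empirical_error_bound weights K(2) f)
        show "V i \<omega> \<in> (\<Union>j\<in>{1..J}. Vs j)" for i
          using cover measurable_space[OF W_meas \<omega>(1)] by (auto simp: V_def)
        show "V i \<omega> \<in> Vs j" if "i < N" "j \<in> {1..J}" "R N j i \<omega>" for i j
          using design that \<omega>(1) unfolding multi_source_design_def Let_def by blast
      qed (use good in auto)
      \<comment> \<open>Off \<open>bad N\<close> the cut-off in \<open>E\<close> is inactive for
        every source.\<close>
      also have "(\<Sum>j=1..J. \<Sum>t\<in>?\<T>. if j \<in> t then
              \<bar>?\<kappa> j * real (card (?B j t)) - real (card {i\<in>{..<N}. ?\<tau> i = t})\<bar> / real N else 0)
          = (\<Sum>j=1..J. \<Sum>t\<in>?\<T>. E N j t ?\<tau> (A N j \<omega>))"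
        using good by (intro sum.cong refl) (auto simp: E_def Let_def I)
      finally have "ennreal \<bar>H_empirical J Vs \<rho> (n N) (\<lambda>j i. R N j i \<omega>) N (\<lambda>i. V i \<omega>) (\<lambda>i. X i \<omega>) f - (\<integral>w. f (fst w) \<partial>Pt)\<bar>
        \<le> ennreal (C * (\<Sum>j=1..J. \<Sum>t\<in>?\<T>. \<bar>(\<Sum>i\<in>?B j t. f (X i \<omega>) - ?mu t) / real N\<bar>)
          + K * (\<Sum>j=1..J. \<Sum>t\<in>?\<T>. E N j t ?\<tau> (A N j \<omega>)) + K * ?dev)"
        by (rule ennreal_leI)
      also have "\<dots> = ennreal C * (\<Sum>j=1..J. \<Sum>t\<in>?\<T>. ennreal \<bar>(\<Sum>i\<in>?B j t. f (X i \<omega>) - ?mu t) / real N\<bar>)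
          + ennreal K * (\<Sum>j=1..J. \<Sum>t\<in>?\<T>. Z j t N \<omega>) + ennreal K * ennreal ?dev"
      proof -
        have E0: "0 \<le> E N j t \<tau> B" for j t \<tau> B by (simp add: E_def Let_def)
        show ?thesis
          unfolding Z_def using \<open>C > 0\<close> K(1) dev0 E0
          by (simp add: ennreal_plus ennreal_mult sum_nonneg flip: sum_ennreal)
      qed
      also have "\<dots> \<le> ?X N \<omega>"
      proof (intro add_mono mult_left_mono sum_mono order_refl)
        fix j t assume j: "j \<in> {1..J}" and t: "t \<in> ?\<T>"
        \<comment> \<open>All units of \<open>?B j t\<close> have stratum \<open>t\<close>, so the
          common mean may be written as the mean of each unit's own stratum, the form required by
          \<open>empirical_strata_bound\<close>.\<close>
        have eq: "(\<Sum>i\<in>?B j t. f (X i \<omega>) - ?mu t) = (\<Sum>i\<in>?B j t. ?f (w N \<omega> i) - (\<integral>w. ?f w \<partial>Q (?\<tau> i)))"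
          by (intro sum.cong refl) (auto simp: w_def X_def A_def)
        have "ennreal \<bar>(\<Sum>i\<in>?B j t. ?f (w N \<omega> i) - (\<integral>w. ?f w \<partial>Q (?\<tau> i))) / real N\<bar> \<le> Y j t N \<omega> + ennreal (K * ?dev)"
          unfolding Y_def
        proof (rule empirical_strata_bound[OF intF[OF f] _ w_space[OF \<omega>(1)] _ _ K(1) K(2)[OF f]])
          show "?B j t \<subseteq> {..<N}" unfolding A_def by blast
          show "types N (w N \<omega>) i = ?T (w N \<omega> i)" if "i < N" for i
            unfolding types_def using that by simp
        qed (rule D(2)[OF _ f])
        then show "ennreal \<bar>(\<Sum>i\<in>?B j t. f (X i \<omega>) - ?mu t) / real N\<bar> \<le> Y j t N \<omega> + ennreal K * ennreal ?dev"
          unfolding eq ennreal_mult[OF K(1) dev0] .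
      qed auto
      finally show "ennreal \<bar>H_empirical J Vs \<rho> (n N) (\<lambda>j i. R N j i \<omega>) N (\<lambda>i. V i \<omega>) (\<lambda>i. X i \<omega>) f - (\<integral>w. f (fst w) \<partial>Pt)\<bar>
        \<le> ?X N \<omega>" .
    qed
  qed
qed

end
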